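(* A smooth, ruled, Lagrangian surface of $\mathbb{C}^2$ is either the Cartesian product $\mathcal{L}\times\Gamma$ of a straight line $\mathcal{L}$ with a planar curve $\Gamma$, or may be locally parametrized, up to translation, by an immersion $X: I\times\mathbb{R}\to\mathbb{C}^2$ of the form $$X(s,t)=\gamma(s)\,t+\int_{s_0}^s\alpha(u)\,(\gamma_1'(u),\gamma_2'(u))\,du,$$ where $\gamma=(\gamma_1,\gamma_2)$ is some Legendrian curve of $\mathbb{S}^3$ and $\alpha=(x,y)\simeq x+iy$ is some planar curve. Moreover, the only self-similar ruled Lagrangian surfaces of $\mathbb{C}^2$ are Cartesian products $\mathcal{L}\times\Gamma$, where $\mathcal{L}$ is a straight line and $\Gamma$ is a planar self-similar curve.
   Context: $\mathbb{C}^2\simeq\mathbb{R}^4$ carries its standard Euclidean inner product $\langle\cdot,\cdot\rangle$ and complex structure $J$ (multiplication by $i$). A surface is Lagrangian if $\langle v,Jw\rangle=0$ for all tangent vectors $v,w$ at the same point, and ruled if it is foliated by straight lines. The statement is local. $I\subset\mathbb{R}$ is an interval and $s_0\in I$. A curve $\gamma$ in the unit sphere $\mathbb{S}^3\subset\mathbb{C}^2$ is Legendrian if $\langle\gamma',J\gamma\rangle=0$. The planar curve $\alpha$ is regarded as a $\mathbb{C}$-valued function, and $\alpha(\gamma_1',\gamma_2')$ is complex scalar multiplication. In the Cartesian products $\mathcal{L}\times\Gamma$, one has $\mathcal{L}\subset P_1$ and $\Gamma\subset P_2$, where $P_1$ and $P_2$ are two orthogonal complex planes (complex lines of $\mathbb{C}^2$).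 A surface is self-similar if it satisfies $H+\lambda X^{\perp}=0$ for some non-vanishing real number $\lambda$, where $H$ is the mean curvature vector and $X^{\perp}$ is the normal component of the position vector $X$. A planar curve is self-similar if it satisfies $k+\lambda\langle X,N\rangle=0$ for some non-vanishing real $\lambda$, where $X$ is its position vector, $k$ its curvature and $N$ its unit normal vector.
   Formalization: The local dichotomy is claimed only on an open dense set: where the ruling direction is non-stationary, or stationary nearby (it fails elsewhere, e.g. γ'=s e, V'=ie). Surfaces are embedded; t runs over all of ℝ when the leaves are entire lines, else over an interval (cones degenerate). *)

theory Defs
  imports "HOL-Analysis.Analysis"
begin

section \<open>Smooth maps\<close>

primrec k_times_differentiable_on ::
  "nat \<Rightarrow> 'a::real_normed_vector set \<Rightarrow> ('a \<Rightarrow> 'b::real_normed_vector) \<Rightarrow> bool" where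
  "k_times_differentiable_on 0 U f \<longleftrightarrow> continuous_on U f"
| "k_times_differentiable_on (Suc k) U f \<longleftrightarrow>
     (\<forall>u\<in>U. f differentiable (at u)) \<and>
     (\<forall>h. k_times_differentiable_on k U (\<lambda>u. frechet_derivative f (at u) h))"

text \<open>Only used for open \<open>U\<close>.\<close>

definition smooth_on :: "'a::real_normed_vector set \<Rightarrow> ('a \<Rightarrow> 'b::real_normed_vector) \<Rightarrow> bool" where
  "smooth_on U f \<longleftrightarrow> (\<forall>k. k_times_differentiable_on k U f)"

definition open_interval :: "real set \<Rightarrow> bool" where
  "open_interval I \<longleftrightarrow> open I \<and> is_interval I \<and> I \<noteq> {}"


section \<open>The plane \<open>\<complex>\<^sup>2\<close>\<close>

text \<open>The inner product that the library puts on \<^typ>\<open>complex^2\<close> is the Euclidean one of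
  \<open>\<real>\<^sup>4\<close>; \<open>c *s v\<close> is complex scalar multiplication.\<close>

definition J :: "complex^2 \<Rightarrow> complex^2" where
  "J v = \<i> *s v"

definition complex_line :: "(complex^2) set \<Rightarrow> bool" where
  "complex_line P \<longleftrightarrow> (\<exists>v. v \<noteq> 0 \<and> P = range (\<lambda>c. c *s v))"

definition straight_line :: "(complex^2) set \<Rightarrow> bool" where
  "straight_line L \<longleftrightarrow> affine L \<and> aff_dim L = 1"

definition cartesian_product :: "(complex^2) set \<Rightarrow> (complex^2) set \<Rightarrow> (complex^2) set" where
  "cartesian_product A B = {a + b | a b. a \<in> A \<and> b \<in> B}"


section \<open>Surfaces\<close>

definition local_parametrization ::
  "(complex^2) set \<Rightarrow> (real \<times> real) set \<Rightarrow> (real \<times> real \<Rightarrow> complex^2) \<Rightarrow> bool" where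
  "local_parametrization S U \<phi> \<longleftrightarrow>
     open U \<and> smooth_on U \<phi> \<and> (\<forall>u\<in>U. inj (frechet_derivative \<phi> (at u))) \<and>
     openin (top_of_set S) (\<phi> ` U) \<and> (\<exists>\<psi>. homeomorphism U (\<phi> ` U) \<phi> \<psi>)"

definition smooth_surface :: "(complex^2) set \<Rightarrow> bool" where
  "smooth_surface S \<longleftrightarrow> (\<forall>p\<in>S. \<exists>U \<phi>. local_parametrization S U \<phi> \<and> p \<in> \<phi> ` U)"

definition tangent_space :: "(complex^2) set \<Rightarrow> complex^2 \<Rightarrow> (complex^2) set" where
  "tangent_space S p =
     {frechet_derivative \<phi> (at u) h | U \<phi> u h. local_parametrization S U \<phi> \<and> u \<in> U \<and> \<phi> u = p}"

definition lagrangian :: "(complex^2) set \<Rightarrow> bool" where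
  "lagrangian S \<longleftrightarrow> (\<forall>p\<in>S. \<forall>v\<in>tangent_space S p. \<forall>w\<in>tangent_space S p. v \<bullet> J w = 0)"


section \<open>Rulings\<close>

text \<open>Chart of a foliation by pieces of lines: the plaques are the images of \<open>{s} \<times> T\<close>.\<close>

definition foliated_chart ::
  "(complex^2) set \<Rightarrow> (complex^2) set set \<Rightarrow> real set \<Rightarrow> real set \<Rightarrow> (real \<times> real \<Rightarrow> complex^2) \<Rightarrow> bool" where
  "foliated_chart S F I T \<phi> \<longleftrightarrow>
     open_interval I \<and> open_interval T \<and> local_parametrization S (I \<times> T) \<phi> \<and>
     (\<forall>s\<in>I. \<exists>l\<in>F. \<phi> ` ({s} \<times> T) \<subseteq> l)"

text \<open>Leaves are open intervals of straight lines, so that open pieces of ruled surfaces are ruled;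
  a ruling is complete if its leaves are entire straight lines.\<close>

definition ruling :: "(complex^2) set \<Rightarrow> (complex^2) set set \<Rightarrow> bool" where
  "ruling S F \<longleftrightarrow>
     \<Union>F = S \<and> disjoint F \<and>
     (\<forall>l\<in>F. l \<noteq> {} \<and> connected l \<and> (\<exists>L. straight_line L \<and> openin (top_of_set L) l)) \<and>
     (\<forall>p\<in>S. \<exists>I T \<phi>. foliated_chart S F I T \<phi> \<and> p \<in> \<phi> ` (I \<times> T))"

definition complete_ruling :: "(complex^2) set set \<Rightarrow> bool" where
  "complete_ruling F \<longleftrightarrow> (\<forall>l\<in>F. straight_line l)"

text \<open>The unit direction of the leaf through \<open>\<phi> u\<close>, oriented by the chart.\<close>

definition leaf_direction :: "(real \<times> real \<Rightarrow> complex^2) \<Rightarrow> real \<times> real \<Rightarrow> complex^2" where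
  "leaf_direction \<phi> u = sgn (frechet_derivative \<phi> (at u) (0, 1))"

definition stationary_ruling_at :: "(complex^2) set \<Rightarrow> (complex^2) set set \<Rightarrow> complex^2 \<Rightarrow> bool" where
  "stationary_ruling_at S F p \<longleftrightarrow>
     (\<forall>I T \<phi> u. foliated_chart S F I T \<phi> \<and> u \<in> I \<times> T \<and> \<phi> u = p \<longrightarrow>
        frechet_derivative (leaf_direction \<phi>) (at u) = (\<lambda>h. 0))"

text \<open>Points near which the ruling has a definite type: its direction is not stationary at \<open>p\<close>, or
  is stationary in a whole neighbourhood. The local alternative fails at other points: for
  \<open>\<gamma>' = s e\<close> and \<open>V' = \<i> e\<close>, with \<open>e\<close> spanning the Hermitian complement of \<open>\<gamma>\<close>, the ruled
  Lagrangian surface \<open>\<gamma>(s) t + V(s)\<close> is immersed, but it is not a product near \<open>s = 0\<close>, and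
  \<open>V' = \<alpha> \<gamma>'\<close> forces \<open>\<alpha>(s) = \<i> / s\<close>.\<close>

definition generic_point :: "(complex^2) set \<Rightarrow> (complex^2) set set \<Rightarrow> complex^2 \<Rightarrow> bool" where
  "generic_point S F p \<longleftrightarrow>
     p \<in> S \<and>
     (\<not> stationary_ruling_at S F p \<or>
      (\<exists>N. openin (top_of_set S) N \<and> p \<in> N \<and> (\<forall>q\<in>N. stationary_ruling_at S F q)))"


section \<open>Curves\<close>

abbreviation deriv_curve :: "(real \<Rightarrow> 'a::real_normed_vector) \<Rightarrow> real \<Rightarrow> 'a" where
  "deriv_curve g s \<equiv> vector_derivative g (at s)"

definition legendrian_curve :: "real set \<Rightarrow> (real \<Rightarrow> complex^2) \<Rightarrow> bool" where
  "legendrian_curve I \<gamma> \<longleftrightarrow>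
     smooth_on I \<gamma> \<and> (\<forall>s\<in>I. norm (\<gamma> s) = 1) \<and> (\<forall>s\<in>I. deriv_curve \<gamma> s \<bullet> J (\<gamma> s) = 0)"

text \<open>Regular, embedded curve in the complex line \<open>P\<close>, a plane whose origin is \<open>0\<close>.\<close>

definition planar_curve :: "(complex^2) set \<Rightarrow> real set \<Rightarrow> (real \<Rightarrow> complex^2) \<Rightarrow> bool" where
  "planar_curve P I g \<longleftrightarrow>
     open_interval I \<and> smooth_on I g \<and> g ` I \<subseteq> P \<and> (\<forall>s\<in>I. deriv_curve g s \<noteq> 0) \<and>
     (\<exists>h. homeomorphism I (g ` I) g h)"

text \<open>In a complex line, \<open>J\<close> is the rotation by a right angle.\<close>

definition unit_normal :: "(real \<Rightarrow> complex^2) \<Rightarrow> real \<Rightarrow> complex^2" where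
  "unit_normal g s = J (sgn (deriv_curve g s))"

definition curvature :: "(real \<Rightarrow> complex^2) \<Rightarrow> real \<Rightarrow> real" where
  "curvature g s = (deriv_curve (deriv_curve g) s \<bullet> unit_normal g s) / (norm (deriv_curve g s))\<^sup>2"

definition self_similar_curve :: "real set \<Rightarrow> (real \<Rightarrow> complex^2) \<Rightarrow> bool" where
  "self_similar_curve I g \<longleftrightarrow>
     (\<exists>c::real. c \<noteq> 0 \<and> (\<forall>s\<in>I. curvature g s + c * (g s \<bullet> unit_normal g s) = 0))"


section \<open>Mean curvature and self-similar surfaces\<close>

definition normal_component :: "(complex^2) set \<Rightarrow> complex^2 \<Rightarrow> complex^2" where
  "normal_component V x = (THE n. x - n \<in> V \<and> (\<forall>v\<in>V. n \<bullet> v = 0))"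

text \<open>The trace of the second fundamental form with respect to the first one; dividing by the
  dimension instead would only rescale the constant in the definition of self-similarity.\<close>

definition mean_curvature_vector :: "(real \<times> real \<Rightarrow> complex^2) \<Rightarrow> real \<times> real \<Rightarrow> complex^2" where
  "mean_curvature_vector \<phi> u =
    (let D = (\<lambda>h w. frechet_derivative \<phi> (at w) h);
         D2 = (\<lambda>h k. frechet_derivative (D k) (at u) h);
         a = (1, 0); b = (0, 1);
         E = D a u \<bullet> D a u; F = D a u \<bullet> D b u; G = D b u \<bullet> D b u
     in (1 / (E * G - F\<^sup>2)) *\<^sub>R
          normal_component (range (\<lambda>h. D h u)) (G *\<^sub>R D2 a a - (2 * F) *\<^sub>R D2 a b + E *\<^sub>R D2 b b))"

definition self_similar_surface :: "(complex^2) set \<Rightarrow> bool" where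
  "self_similar_surface S \<longleftrightarrow>
     (\<exists>c::real. c \<noteq> 0 \<and>
       (\<forall>U \<phi> u. local_parametrization S U \<phi> \<and> u \<in> U \<longrightarrow>
          mean_curvature_vector \<phi> u + c *\<^sub>R normal_component (tangent_space S (\<phi> u)) (\<phi> u) = 0))"


section \<open>The two local models\<close>

text \<open>Near \<open>p\<close>, the surface is a product of a line and the curve \<open>g\<close> (all of the product if
  the leaves are entire lines, an open piece of it otherwise).\<close>

definition cartesian_near ::
  "(complex^2) set \<Rightarrow> (complex^2) set set \<Rightarrow> complex^2 \<Rightarrow> real set \<Rightarrow> (real \<Rightarrow> complex^2) \<Rightarrow> bool" where
  "cartesian_near S F p I g \<longleftrightarrow>
     (\<exists>P1 P2 L N.
        complex_line P1 \<and> complex_line P2 \<and> (\<forall>v\<in>P1. \<forall>w\<in>P2. v \<bullet> w = 0) \<and>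
        straight_line L \<and> L \<subseteq> P1 \<and> planar_curve P2 I g \<and>
        p \<in> N \<and> openin (top_of_set S) N \<and> openin (top_of_set (cartesian_product L (g ` I))) N \<and>
        (complete_ruling F \<longrightarrow> N = cartesian_product L (g ` I)))"

text \<open>The interval integral is oriented, as needed for \<open>s < s0\<close>.\<close>

definition legendrian_ruled_map ::
  "(real \<Rightarrow> complex^2) \<Rightarrow> (real \<Rightarrow> complex) \<Rightarrow> real \<Rightarrow> real \<times> real \<Rightarrow> complex^2" where
  "legendrian_ruled_map \<gamma> \<alpha> s0 = (\<lambda>(s, t). t *\<^sub>R \<gamma> s + (LBINT u=s0..s. \<alpha> u *s deriv_curve \<gamma> u))"

text \<open>The parameter \<open>t\<close> runs through \<open>\<real>\<close> if the leaves are entire lines.\<close>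

definition legendrian_ruled_near ::
  "(complex^2) set \<Rightarrow> (complex^2) set set \<Rightarrow> complex^2 \<Rightarrow> bool" where
  "legendrian_ruled_near S F p \<longleftrightarrow>
     (\<exists>I T s0 \<gamma> \<alpha> c.
        open_interval I \<and> s0 \<in> I \<and> open_interval T \<and> (complete_ruling F \<longrightarrow> T = UNIV) \<and>
        legendrian_curve I \<gamma> \<and> smooth_on I \<alpha> \<and>
        local_parametrization S (I \<times> T) (\<lambda>u. c + legendrian_ruled_map \<gamma> \<alpha> s0 u) \<and>
        p \<in> (\<lambda>u. c + legendrian_ruled_map \<gamma> \<alpha> s0 u) ` (I \<times> T))"

end

theory Submission
  imports Defs
begin

text \<open>
  Near each of its points, a ruled Lagrangian surface is the image of a ruled map
  \<open>X(s, t) = V(s) + t \<gamma>(s)\<close> with \<open>\<bar>\<gamma>\<bar> = 1\<close>, and the base curve \<open>V\<close> can be slid along the rulings until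
  \<open>V'\<close> is orthogonal to \<open>\<gamma>\<close>. The Lagrangian condition says that \<open>V' + t \<gamma>'\<close> is orthogonal to \<open>J \<gamma>\<close> for all
  \<open>t\<close>. Hence \<open>\<gamma>'\<close> and \<open>V'\<close> both lie in the Hermitian complement of \<open>\<gamma>\<close>, which is a complex line: if \<open>e\<close>
  is the image of \<open>\<gamma>\<close> under the quaternionic structure of \<open>\<complex>\<^sup>2\<close>, then \<open>\<gamma>' = a e\<close>, \<open>V' = b e\<close> and
  \<open>e' = - cnj a \<gamma>\<close> for complex functions \<open>a\<close> and \<open>b\<close>. All of the geometry is contained in this frame
  equation; the patches in this normal form are the locale \<open>ruled_patch\<close>, and
  \<open>foliated_chart_imp_ruled_patch\<close> produces them.

  Where \<open>a \<noteq> 0\<close>, one has \<open>V' = (b / a) \<gamma>'\<close>, which integrates to the Legendrian form. Where \<open>a\<close> vanishes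
  identically, \<open>\<gamma>\<close> and \<open>e\<close> are constant, and the patch is the product of a line in \<open>\<complex> \<gamma>\<close> and a curve in
  \<open>\<complex> e\<close>. The points near which one of these alternatives holds are the generic ones.

  If the leaves are entire lines, the patch can be taken to consist of entire lines
  (\<open>ruled_patch_complete\<close>). Two things could go wrong far out on a line: the lines could meet, which
  is excluded because leaves are disjoint, or the ruled map could become singular, as the tangent
  developable of a curve does on the curve. The latter is excluded by comparison with a patch around
  the critical point.

  For self-similar surfaces, \<open>X\<^sub>s = (t a + b) e\<close> is orthogonal to \<open>X\<^sub>t = \<gamma>\<close>, and \<open>H + c X\<^sup>\<bottom> = 0\<close> becomes the
  pair of equations \<open>equation_along_ruling\<close> and \<open>equation_across_ruling\<close>, one for each of the normal
  vectors \<open>J X\<^sub>t\<close> and \<open>J X\<^sub>s\<close>. Both hold for all \<open>t\<close> in an interval. Comparing powers of \<open>t\<close> gives that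
  \<open>a = r b\<close> for a real function \<open>r\<close>, that \<open>Im (b' cnj b) = - c \<bar>b\<bar>\<^sup>2 w\<close> for the function
  \<open>w = Im (v cnj b)\<close>, where \<open>v\<close> is the component of \<open>V\<close> along \<open>e\<close>, and that \<open>w = 0\<close> wherever \<open>a \<noteq> 0\<close>.
  Points where \<open>a\<close> vanishes without vanishing nearby are a possible obstacle to gluing the two local models, but \<open>w\<close>
  satisfies a homogeneous linear differential equation. So on each patch one of two things happens.
  Either \<open>a\<close> vanishes identically; then the patch is a product, and the equation for
  \<open>Im (b' cnj b)\<close> is the self-similarity of its planar factor. Or \<open>w\<close> vanishes identically; then \<open>\<gamma>\<close> and
  \<open>b e\<close> span a constant real plane through the origin which contains the patch. A Lagrangian plane is
  itself the product of two orthogonal real lines through the origin. If the leaves are entire lines, \<open>a \<noteq> 0\<close> is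
  impossible, because \<open>t a + b\<close> would vanish at \<open>t = - 1 / r\<close>.
\<close>

section \<open>Calculus of smooth maps\<close>

lemma k_times_differentiable_on_cong:
  assumes "open U" "\<And>u. u \<in> U \<Longrightarrow> f u = g u" "k_times_differentiable_on k U f"
  shows "k_times_differentiable_on k U g"
  using assms(2,3)
proof (induction k arbitrary: f g)
  case 0
  then show ?case using continuous_on_cong by fastforce
next
  case (Suc k)
  have deriv: "(g has_derivative frechet_derivative f (at u)) (at u)" if "u \<in> U" for u
  proof (rule has_derivative_transform_within_open[OF _ \<open>open U\<close> that])
    show "(f has_derivative frechet_derivative f (at u)) (at u)"
      using Suc.prems(2) that by (simp add: frechet_derivative_works[symmetric])
  qed (use Suc.prems(1) in auto)
  have "frechet_derivative f (at u) h = frechet_derivative g (at u) h" if "u \<in> U" for u h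
    using frechet_derivative_at[OF deriv[OF that]] by simp
  then have "k_times_differentiable_on k U (\<lambda>u. frechet_derivative g (at u) h)" for h
    using Suc.IH[of "\<lambda>u. frechet_derivative f (at u) h"] Suc.prems(2) by auto
  then show ?case using deriv by (auto simp: differentiable_def)
qed

lemma k_times_differentiable_on_SucI:
  assumes "open U" "\<And>u. u \<in> U \<Longrightarrow> (f has_derivative f' u) (at u)"
    "\<And>h. k_times_differentiable_on k U (\<lambda>u. f' u h)"
  shows "k_times_differentiable_on (Suc k) U f"
proof -
  have "k_times_differentiable_on k U (\<lambda>u. frechet_derivative f (at u) h)" for h
    by (rule k_times_differentiable_on_cong[OF assms(1) _ assms(3)[of h]])
       (use frechet_derivative_at[OF assms(2)] in metis)
  then show ?thesis using assms(2) by (auto simp: differentiable_def)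
qed

lemma k_times_differentiable_on_SucD:
  assumes "k_times_differentiable_on (Suc k) U f"
  shows "\<And>u. u \<in> U \<Longrightarrow> (f has_derivative frechet_derivative f (at u)) (at u)"
    "\<And>h. k_times_differentiable_on k U (\<lambda>u. frechet_derivative f (at u) h)"
  using assms by (auto simp: frechet_derivative_works[symmetric])

lemma k_times_differentiable_on_Suc_imp:
  "k_times_differentiable_on (Suc k) U f \<Longrightarrow> k_times_differentiable_on k U f"
proof (induction k arbitrary: f)
  case 0
  then have "\<forall>u\<in>U. isCont f u"
    using differentiable_imp_continuous_within by auto
  then show ?case by (simp add: continuous_at_imp_continuous_on)
next
  case (Suc k)
  then show ?case by (metis k_times_differentiable_on.simps(2))
qed

lemma k_times_differentiable_on_imp_continuous:
  "k_times_differentiable_on k U f \<Longrightarrow> continuous_on U f"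
proof (induction k)
  case (Suc k)
  then show ?case using k_times_differentiable_on_Suc_imp by blast
qed simp

lemma k_times_differentiable_on_subset:
  "k_times_differentiable_on k U f \<Longrightarrow> V \<subseteq> U \<Longrightarrow> k_times_differentiable_on k V f"
  by (induction k arbitrary: f) (auto intro: continuous_on_subset)

lemma k_times_differentiable_on_const:
  "open U \<Longrightarrow> k_times_differentiable_on k U (\<lambda>u. c)"
proof (induction k arbitrary: c)
  case (Suc k)
  show ?case
    by (rule k_times_differentiable_on_SucI[where f' = "\<lambda>u h. 0"]) (use Suc in auto)
qed auto

lemma k_times_differentiable_on_bounded_linear:
  assumes "open U" "bounded_linear f"
  shows "k_times_differentiable_on k U f"
proof (cases k)
  case 0
  then show ?thesis using assms(2) linear_continuous_on by auto
next
  case (Suc j)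
  show ?thesis unfolding Suc
    by (rule k_times_differentiable_on_SucI[where f' = "\<lambda>u. f"])
       (use assms bounded_linear_imp_has_derivative k_times_differentiable_on_const in auto)
qed

lemma k_times_differentiable_on_add:
  assumes "open U" "k_times_differentiable_on k U f" "k_times_differentiable_on k U g"
  shows "k_times_differentiable_on k U (\<lambda>u. f u + g u)"
  using assms(2,3)
proof (induction k arbitrary: f g)
  case 0
  then show ?case by (auto intro: continuous_intros)
next
  case (Suc k)
  show ?case
    by (rule k_times_differentiable_on_SucI[OF assms(1)])
       (rule has_derivative_add[OF k_times_differentiable_on_SucD(1)[OF Suc.prems(1)]
           k_times_differentiable_on_SucD(1)[OF Suc.prems(2)]],
        assumption+,
        rule Suc.IH[OF k_times_differentiable_on_SucD(2)[OF Suc.prems(1)]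
           k_times_differentiable_on_SucD(2)[OF Suc.prems(2)]])
qed

lemma k_times_differentiable_on_sum:
  assumes "open U" "finite A" "\<And>i. i \<in> A \<Longrightarrow> k_times_differentiable_on k U (f i)"
  shows "k_times_differentiable_on k U (\<lambda>u. \<Sum>i\<in>A. f i u)"
  using assms(2,3)
  by (induction A rule: finite_induct)
     (auto intro: k_times_differentiable_on_const k_times_differentiable_on_add assms(1))

lemma k_times_differentiable_on_bilinear:
  assumes "bounded_bilinear B" "open U"
    "k_times_differentiable_on k U f" "k_times_differentiable_on k U g"
  shows "k_times_differentiable_on k U (\<lambda>u. B (f u) (g u))"
  using assms(3,4)
proof (induction k arbitrary: f g)
  case 0
  then show ?case using bounded_bilinear.continuous_on[OF assms(1)] by auto
next
  case (Suc k)
  show ?case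
  proof (rule k_times_differentiable_on_SucI[OF assms(2)])
    show "((\<lambda>u. B (f u) (g u)) has_derivative
        (\<lambda>h. B (f u) (frechet_derivative g (at u) h) + B (frechet_derivative f (at u) h) (g u))) (at u)"
      if "u \<in> U" for u
      by (rule bounded_bilinear.FDERIV[OF assms(1)])
        (rule k_times_differentiable_on_SucD(1)[OF Suc.prems(1) that]
          k_times_differentiable_on_SucD(1)[OF Suc.prems(2) that])+
    show "k_times_differentiable_on k U
      (\<lambda>u. B (f u) (frechet_derivative g (at u) h) + B (frechet_derivative f (at u) h) (g u))" for h
      by (intro k_times_differentiable_on_add assms(2) Suc.IH
          k_times_differentiable_on_Suc_imp[OF Suc.prems(1)]
          k_times_differentiable_on_Suc_imp[OF Suc.prems(2)]
          k_times_differentiable_on_SucD(2)[OF Suc.prems(1)]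
          k_times_differentiable_on_SucD(2)[OF Suc.prems(2)])
  qed
qed

text \<open>The derivative of a composite is expanded in a basis of the middle space, so that it becomes
  a sum of products of maps which the induction hypothesis covers.\<close>

lemma k_times_differentiable_on_compose:
  fixes f :: "'a::real_normed_vector \<Rightarrow> 'b::euclidean_space"
  assumes "open U" "open V" "f ` U \<subseteq> V"
    "k_times_differentiable_on k U f" "k_times_differentiable_on k V g"
  shows "k_times_differentiable_on k U (\<lambda>u. g (f u))"
  using assms(4,5)
proof (induction k arbitrary: g)
  case 0
  then show ?case using assms(3) by (auto intro: continuous_on_compose2)
next
  case (Suc k)
  note df = k_times_differentiable_on_SucD[OF Suc.prems(1)]
  note dg = k_times_differentiable_on_SucD[OF Suc.prems(2)]
  show ?case
  proof (rule k_times_differentiable_on_SucI[OF assms(1)])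
    fix u assume u: "u \<in> U"
    then have fu: "f u \<in> V" using assms(3) by auto
    have "((\<lambda>u. g (f u)) has_derivative
        (\<lambda>h. frechet_derivative g (at (f u)) (frechet_derivative f (at u) h))) (at u)"
      using has_derivative_compose[OF df(1)[OF u] dg(1)[OF fu]] .
    moreover have "frechet_derivative g (at (f u)) (frechet_derivative f (at u) h) =
        (\<Sum>b\<in>Basis. (frechet_derivative f (at u) h \<bullet> b) *\<^sub>R frechet_derivative g (at (f u)) b)" for h
    proof -
      have lin: "linear (frechet_derivative g (at (f u)))"
        using dg(1)[OF fu] has_derivative_linear by blast
      show ?thesis
        by (subst (1) euclidean_representation[of "frechet_derivative f (at u) h", symmetric])
           (simp add: linear_sum[OF lin] linear_cmul[OF lin])
    qed
    ultimately show "((\<lambda>u. g (f u)) has_derivative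
        (\<lambda>h. \<Sum>b\<in>Basis. (frechet_derivative f (at u) h \<bullet> b) *\<^sub>R frechet_derivative g (at (f u)) b)) (at u)"
      by simp
  next
    fix h
    have "k_times_differentiable_on k U (\<lambda>u. frechet_derivative f (at u) h \<bullet> b)" for b
      by (rule k_times_differentiable_on_bilinear[OF bounded_bilinear_inner assms(1) df(2)])
         (rule k_times_differentiable_on_const[OF assms(1)])
    moreover have "k_times_differentiable_on k U (\<lambda>u. frechet_derivative g (at (f u)) b)" for b
      using Suc.IH[OF k_times_differentiable_on_Suc_imp[OF Suc.prems(1)] dg(2)] .
    ultimately show "k_times_differentiable_on k U
      (\<lambda>u. \<Sum>b\<in>Basis. (frechet_derivative f (at u) h \<bullet> b) *\<^sub>R frechet_derivative g (at (f u)) b)"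
      by (intro k_times_differentiable_on_sum[OF assms(1)]
          k_times_differentiable_on_bilinear[OF bounded_bilinear_scaleR assms(1)]) auto
  qed
qed

text \<open>The derivative of \<open>inverse\<close> is a polynomial in \<open>inverse\<close>, and that of \<open>norm\<close> is rational in \<open>norm\<close> with
  linear coefficients; this is what makes the two inductions work.\<close>

lemma k_times_differentiable_on_inverse:
  "k_times_differentiable_on k (- {0}) (inverse :: 'a::{real_normed_field} \<Rightarrow> 'a)"
proof (induction k)
  case 0
  then show ?case by (auto intro!: continuous_intros)
next
  case (Suc k)
  have o: "open (- {0::'a})" by auto
  show ?case
  proof (rule k_times_differentiable_on_SucI[OF o])
    show "(inverse has_derivative (\<lambda>h. (inverse u * inverse u) * - h)) (at u)"
      if "u \<in> - {0}" for u :: 'a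
      using has_derivative_inverse'[of u UNIV] that by (simp add: mult_ac)
    show "k_times_differentiable_on k (- {0}) (\<lambda>u. (inverse u * inverse u) * - h)" for h :: 'a
      by (intro k_times_differentiable_on_bilinear[OF bounded_bilinear_mult o]
          Suc k_times_differentiable_on_const[OF o])
  qed
qed

lemma k_times_differentiable_on_norm:
  "k_times_differentiable_on k (- {0}) (norm :: 'a::euclidean_space \<Rightarrow> real)"
proof (induction k)
  case 0
  then show ?case by (auto intro!: continuous_intros)
next
  case (Suc k)
  have o: "open (- {0::'a})" "open (- {0::real})" by auto
  show ?case
  proof (rule k_times_differentiable_on_SucI[OF o(1)])
    show "(norm has_derivative (\<lambda>h. inverse (norm u) * (u \<bullet> h))) (at u)" if "u \<in> - {0}" for u :: 'a
      using has_derivative_norm[of u] that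
      by (simp add: sgn_div_norm inner_commute divide_inverse)
    show "k_times_differentiable_on k (- {0}) (\<lambda>u. inverse (norm u) * (u \<bullet> h))" for h :: 'a
    proof (rule k_times_differentiable_on_bilinear[OF bounded_bilinear_mult o(1)])
      show "k_times_differentiable_on k (- {0}) (\<lambda>u::'a. inverse (norm u))"
        by (rule k_times_differentiable_on_compose[OF o _ Suc k_times_differentiable_on_inverse]) auto
      show "k_times_differentiable_on k (- {0}) (\<lambda>u. u \<bullet> h)"
        by (rule k_times_differentiable_on_bounded_linear[OF o(1) bounded_linear_inner_left])
    qed
  qed
qed

lemma smooth_on_iff:
  "smooth_on U f \<longleftrightarrow>
     (\<forall>u\<in>U. f differentiable (at u)) \<and> (\<forall>h. smooth_on U (\<lambda>u. frechet_derivative f (at u) h))"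
proof -
  have "smooth_on U f \<longleftrightarrow> (\<forall>k. k_times_differentiable_on (Suc k) U f)"
    unfolding smooth_on_def using k_times_differentiable_on_Suc_imp by blast
  then show ?thesis unfolding smooth_on_def by auto
qed

lemma smooth_on_cong:
  "open U \<Longrightarrow> (\<And>u. u \<in> U \<Longrightarrow> f u = g u) \<Longrightarrow> smooth_on U f \<Longrightarrow> smooth_on U g"
  unfolding smooth_on_def using k_times_differentiable_on_cong by metis

lemma smooth_on_subset: "smooth_on U f \<Longrightarrow> V \<subseteq> U \<Longrightarrow> smooth_on V f"
  unfolding smooth_on_def using k_times_differentiable_on_subset by blast

lemma smooth_on_imp_continuous_on: "smooth_on U f \<Longrightarrow> continuous_on U f"
  unfolding smooth_on_def using k_times_differentiable_on_imp_continuous by blast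

lemma smooth_on_has_derivative:
  "smooth_on U f \<Longrightarrow> u \<in> U \<Longrightarrow> (f has_derivative frechet_derivative f (at u)) (at u)"
  using smooth_on_iff frechet_derivative_works by blast

lemma smooth_on_const: "open U \<Longrightarrow> smooth_on U (\<lambda>u. c)"
  by (simp add: smooth_on_def k_times_differentiable_on_const)

lemma smooth_on_bounded_linear: "open U \<Longrightarrow> bounded_linear f \<Longrightarrow> smooth_on U f"
  by (simp add: smooth_on_def k_times_differentiable_on_bounded_linear)

lemma smooth_on_add:
  "open U \<Longrightarrow> smooth_on U f \<Longrightarrow> smooth_on U g \<Longrightarrow> smooth_on U (\<lambda>u. f u + g u)"
  by (simp add: smooth_on_def k_times_differentiable_on_add)

lemma smooth_on_bilinear:
  "bounded_bilinear B \<Longrightarrow> open U \<Longrightarrow> smooth_on U f \<Longrightarrow> smooth_on U g \<Longrightarrow>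
   smooth_on U (\<lambda>u. B (f u) (g u))"
  by (simp add: smooth_on_def k_times_differentiable_on_bilinear)

lemma smooth_on_compose:
  fixes f :: "'a::real_normed_vector \<Rightarrow> 'b::euclidean_space"
  shows "open U \<Longrightarrow> open V \<Longrightarrow> f ` U \<subseteq> V \<Longrightarrow> smooth_on U f \<Longrightarrow> smooth_on V g \<Longrightarrow>
    smooth_on U (\<lambda>u. g (f u))"
  by (simp add: smooth_on_def k_times_differentiable_on_compose)

lemma smooth_on_linear_image:
  fixes f :: "'a::real_normed_vector \<Rightarrow> 'b::euclidean_space"
  shows "open U \<Longrightarrow> bounded_linear L \<Longrightarrow> smooth_on U f \<Longrightarrow> smooth_on U (\<lambda>u. L (f u))"
  by (rule smooth_on_compose[OF _ open_UNIV]) (auto intro: smooth_on_bounded_linear)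

lemma smooth_on_diff:
  fixes f g :: "'a::real_normed_vector \<Rightarrow> 'b::euclidean_space"
  assumes "open U" "smooth_on U f" "smooth_on U g"
  shows "smooth_on U (\<lambda>u. f u - g u)"
  using smooth_on_add[OF assms(1,2)
      smooth_on_linear_image[OF assms(1) bounded_linear_minus[OF bounded_linear_ident] assms(3)]]
  by simp

lemma smooth_on_inverse:
  fixes f :: "'a::real_normed_vector \<Rightarrow> 'b::{euclidean_space, real_normed_field}"
  assumes "open U" "smooth_on U f" "\<And>u. u \<in> U \<Longrightarrow> f u \<noteq> 0"
  shows "smooth_on U (\<lambda>u. inverse (f u))"
  by (rule smooth_on_compose[OF assms(1) _ _ assms(2), of "- {0}"])
     (use assms(3) in \<open>auto simp: smooth_on_def k_times_differentiable_on_inverse\<close>)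

lemma smooth_on_sgn:
  fixes f :: "'a::real_normed_vector \<Rightarrow> 'b::euclidean_space"
  assumes "open U" "smooth_on U f" "\<And>u. u \<in> U \<Longrightarrow> f u \<noteq> 0"
  shows "smooth_on U (\<lambda>u. sgn (f u))"
proof -
  have "smooth_on U (\<lambda>u. norm (f u))"
    by (rule smooth_on_compose[OF assms(1) _ _ assms(2), of "- {0}"])
       (use assms(3) in \<open>auto simp: smooth_on_def k_times_differentiable_on_norm\<close>)
  then have "smooth_on U (\<lambda>u. inverse (norm (f u)) *\<^sub>R f u)"
    using assms
    by (intro smooth_on_bilinear[OF bounded_bilinear_scaleR] smooth_on_inverse) auto
  then show ?thesis by (simp add: sgn_div_norm)
qed

lemma smooth_on_has_vector_derivative:
  assumes "smooth_on I f" "s \<in> I"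
  shows "(f has_vector_derivative deriv_curve f s) (at s)"
  using smooth_on_has_derivative[OF assms] vector_derivative_works differentiableI by blast

lemma smooth_on_deriv_curve:
  assumes "open I" "smooth_on I f"
  shows "smooth_on I (deriv_curve f)"
proof (rule smooth_on_cong[OF assms(1)])
  show "smooth_on I (\<lambda>u. frechet_derivative f (at u) 1)" using assms(2) smooth_on_iff by blast
  show "frechet_derivative f (at u) 1 = deriv_curve f u" if "u \<in> I" for u
    using frechet_derivative_at[OF smooth_on_has_vector_derivative[OF assms(2) that,
        unfolded has_vector_derivative_def]] by (metis scaleR_one)
qed

lemma smooth_on_antiderivative:
  fixes f :: "real \<Rightarrow> 'a::euclidean_space"
  assumes "open I" "\<And>s. s \<in> I \<Longrightarrow> (f has_vector_derivative f' s) (at s)" "smooth_on I f'"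
  shows "smooth_on I f"
proof -
  have "k_times_differentiable_on (Suc k) I f" for k
  proof (rule k_times_differentiable_on_SucI[OF assms(1)])
    show "(f has_derivative (\<lambda>h. h *\<^sub>R f' s)) (at s)" if "s \<in> I" for s
      using assms(2)[OF that] by (simp add: has_vector_derivative_def)
    show "k_times_differentiable_on k I (\<lambda>s. h *\<^sub>R f' s)" for h
      using smooth_on_linear_image[OF assms(1) bounded_linear_scaleR_right assms(3)]
      by (simp add: smooth_on_def)
  qed
  then show ?thesis unfolding smooth_on_def using k_times_differentiable_on_Suc_imp by blast
qed

section \<open>Hermitian geometry of the complex plane\<close>

text \<open>The Hermitian form has the inner product as its real part and the symplectic form as its imaginary
  part; one equation for it expresses orthogonality to a vector and to its image under \<open>J\<close>.\<close>

definition herm :: "complex^2 \<Rightarrow> complex^2 \<Rightarrow> complex" where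
  "herm v w = v $ 1 * cnj (w $ 1) + v $ 2 * cnj (w $ 2)"

text \<open>The quaternionic structure of \<open>\<complex>\<^sup>2\<close>, an antilinear map that takes a vector to a generator of its
  Hermitian complement.\<close>

definition perp :: "complex^2 \<Rightarrow> complex^2" where
  "perp v = vector [- cnj (v $ 2), cnj (v $ 1)]"

lemma vec2_eq_iff: "v = w \<longleftrightarrow> v $ 1 = w $ 1 \<and> v $ 2 = w $ (2::2)"
  by (auto simp: vec_eq_iff forall_2)

lemma inner_eq_Re_herm: "v \<bullet> w = Re (herm v w)"
  by (simp add: inner_vec_def sum_2 inner_complex_def herm_def)

lemma inner_J_eq_Im_herm: "v \<bullet> J w = Im (herm v w)"
  by (simp add: inner_vec_def sum_2 inner_complex_def herm_def J_def)

lemma herm_self: "herm v v = of_real ((norm v)\<^sup>2)"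
  unfolding power2_norm_eq_inner
  by (simp add: complex_eq_iff inner_vec_def sum_2 inner_complex_def herm_def)

lemma herm_linear_simps:
  "herm (u + v) w = herm u w + herm v w" "herm u (v + w) = herm u v + herm u w"
  "herm (u - v) w = herm u w - herm v w" "herm u (v - w) = herm u v - herm u w"
  "herm (c *s v) w = c * herm v w" "herm v (c *s w) = cnj c * herm v w"
  "herm (r *\<^sub>R v) w = of_real r * herm v w" "herm v (r *\<^sub>R w) = of_real r * herm v w"
  "herm 0 w = 0" "herm v 0 = 0" "herm (- v) w = - herm v w" "herm v (- w) = - herm v w"
  by (simp_all add: herm_def algebra_simps scaleR_conv_of_real[where 'a = complex])

lemma perp_nth [simp]: "perp v $ 1 = - cnj (v $ 2)" "perp v $ 2 = cnj (v $ 1)"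
  by (simp_all add: perp_def)

lemma perp_linear_simps:
  "perp (u + v) = perp u + perp v" "perp (r *\<^sub>R v) = r *\<^sub>R perp v"
  "perp (c *s v) = cnj c *s perp v" "perp (perp v) = - v"
  by (auto simp: vec2_eq_iff)

lemma herm_perp: "herm v (perp v) = 0" "herm (perp v) v = 0" "herm (perp v) (perp v) = herm v v"
  by (simp_all add: herm_def)

lemma norm_perp [simp]: "norm (perp v) = norm v"
  by (simp add: norm_eq inner_eq_Re_herm herm_perp)

lemma scaleR_eq_scalar_mult: "r *\<^sub>R (v::complex^2) = of_real r *s v"
  by (auto simp: vec2_eq_iff scaleR_conv_of_real[where 'a = complex])

lemma cnj_mult_eq_of_real_power: "b * cnj b = of_real ((cmod b)\<^sup>2)"
  using complex_norm_square[of b] by simp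

lemma norm_scalar_mult: "norm (c *s (v::complex^2)) = cmod c * norm v"
proof -
  have "complex_of_real ((norm (c *s v))\<^sup>2) = (c * cnj c) * herm v v"
    unfolding herm_self[symmetric] by (simp add: herm_linear_simps)
  also have "\<dots> = of_real ((cmod c * norm v)\<^sup>2)"
    by (simp add: cnj_mult_eq_of_real_power herm_self power_mult_distrib)
  finally have "(norm (c *s v))\<^sup>2 = (cmod c * norm v)\<^sup>2" unfolding of_real_eq_iff .
  then show ?thesis by (simp add: power2_eq_iff_nonneg)
qed

lemma bounded_linear_perp: "bounded_linear perp"
  by (rule bounded_linear_intro[where K = 1]) (auto simp: perp_linear_simps)

lemma bounded_linear_J: "bounded_linear J"
  by (rule bounded_linear_intro[where K = 1])
     (auto simp: J_def norm_scalar_mult vec2_eq_iff algebra_simps)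

lemma bounded_bilinear_scalar_mult: "bounded_bilinear ((*s) :: complex \<Rightarrow> complex^2 \<Rightarrow> complex^2)"
  by (rule bounded_bilinear.intro)
     (auto simp: vec2_eq_iff algebra_simps norm_scalar_mult intro!: exI[of _ 1])

lemma bounded_bilinear_herm: "bounded_bilinear herm"
proof (rule bounded_bilinear.intro)
  have "cmod (herm v w) \<le> 2 * norm v * norm w" for v w
  proof -
    have "cmod (herm v w) \<le> cmod (v $ 1) * cmod (w $ 1) + cmod (v $ 2) * cmod (w $ 2)"
      unfolding herm_def by (metis complex_mod_cnj norm_mult norm_triangle_ineq)
    also have "\<dots> \<le> norm v * norm w + norm v * norm w"
      by (intro add_mono mult_mono Finite_Cartesian_Product.norm_nth_le norm_ge_zero)
    finally show ?thesis by simp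
  qed
  then show "\<exists>K. \<forall>v w. norm (herm v w) \<le> norm v * norm w * K"
    by (intro exI[of _ 2]) (auto simp: mult_ac)
qed (auto simp: herm_linear_simps scaleR_conv_of_real[where 'a = complex])

lemma unitary_decomposition:
  assumes "norm g = 1"
  shows "v = herm v g *s g + herm v (perp g) *s perp g"
proof -
  have 1: "g $ 1 * cnj (g $ 1) + g $ 2 * cnj (g $ 2) = 1"
    using herm_self[of g] assms by (simp add: herm_def)
  have "v $ 1 = v $ 1 * (g $ 1 * cnj (g $ 1) + g $ 2 * cnj (g $ 2))"
    "v $ 2 = v $ 2 * (g $ 1 * cnj (g $ 1) + g $ 2 * cnj (g $ 2))"
    unfolding 1 by simp_all
  then show ?thesis by (simp add: vec2_eq_iff herm_def algebra_simps)
qed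

lemma real_multiple_eq:
  fixes b z :: complex
  assumes "b \<noteq> 0" "Im (z * cnj b) = 0"
  shows "z = of_real (Re (z * cnj b) / (cmod b)\<^sup>2) * b"
proof -
  have "z * cnj b = of_real (Re (z * cnj b))" using assms(2) by (simp add: complex_eq_iff)
  then have "z * (b * cnj b) = of_real (Re (z * cnj b)) * b" by (metis mult.assoc mult.commute)
  then show ?thesis using assms(1) by (simp add: cnj_mult_eq_of_real_power field_simps)
qed

text \<open>A real plane on which the symplectic form vanishes is the orthogonal complement of its image
  under \<open>J\<close>.\<close>

lemma lagrangian_plane_eq:
  assumes g: "norm g = 1" and b: "b \<noteq> 0"
    and "v \<bullet> J g = 0" and "v \<bullet> J (b *s perp g) = 0"
  obtains x y :: real where "v = x *\<^sub>R g + y *\<^sub>R (b *s perp g)"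
proof
  have 1: "herm v g = of_real (Re (herm v g))"
    using assms(3) by (simp add: inner_J_eq_Im_herm complex_eq_iff)
  have "Im (herm v (perp g) * cnj b) = 0"
    using assms(4) by (simp add: inner_J_eq_Im_herm herm_linear_simps mult.commute)
  note 2 = real_multiple_eq[OF b this]
  show "v = Re (herm v g) *\<^sub>R g + (Re (herm v (perp g) * cnj b) / (cmod b)\<^sup>2) *\<^sub>R (b *s perp g)"
    unfolding scaleR_eq_scalar_mult vector_smult_assoc 1[symmetric] 2[symmetric]
    by (rule unitary_decomposition[OF g])
qed

lemma straight_line_iff:
  "straight_line L \<longleftrightarrow> (\<exists>a d. norm d = 1 \<and> L = range (\<lambda>t. a + t *\<^sub>R d))"
proof
  assume L: "straight_line L"
  then have "affine L" "aff_dim L = 1" by (auto simp: straight_line_def)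
  then have "L \<noteq> {}" by auto
  then obtain p where p: "p \<in> L" by auto
  have "L \<noteq> {p}" using \<open>aff_dim L = 1\<close> by auto
  then obtain q where q: "q \<in> L" "q \<noteq> p" using p by blast
  have "affine hull {p, q} = L"
    using p q \<open>affine L\<close> \<open>aff_dim L = 1\<close>
    by (intro affine_dim_equal) (auto simp: hull_minimal aff_dim_2)
  moreover have "affine hull {p, q} = range (\<lambda>t. p + t *\<^sub>R sgn (q - p))"
  proof (intro equalityI subsetI)
    fix x assume "x \<in> affine hull {p, q}"
    then obtain u v where uv: "u + v = 1" "x = u *\<^sub>R p + v *\<^sub>R q" by (auto simp: affine_hull_2)
    have "x = p + (v * norm (q - p)) *\<^sub>R sgn (q - p)"
      using q uv by (simp add: sgn_div_norm algebra_simps flip: scaleR_left_distrib)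
    then show "x \<in> range (\<lambda>t. p + t *\<^sub>R sgn (q - p))" by blast
  next
    fix x assume "x \<in> range (\<lambda>t. p + t *\<^sub>R sgn (q - p))"
    then obtain t where t: "x = p + t *\<^sub>R sgn (q - p)" by blast
    have "x = (1 - t / norm (q - p)) *\<^sub>R p + (t / norm (q - p)) *\<^sub>R q"
      unfolding t by (simp add: sgn_div_norm algebra_simps divide_inverse)
    then show "x \<in> affine hull {p, q}"
      unfolding affine_hull_2
      by (intro CollectI exI[of _ "1 - t / norm (q - p)"] exI[of _ "t / norm (q - p)"]) simp
  qed
  ultimately show "\<exists>a d. norm d = 1 \<and> L = range (\<lambda>t. a + t *\<^sub>R d)"
    using q(2) by (intro exI[of _ p] exI[of _ "sgn (q - p)"]) (simp add: norm_sgn)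
next
  assume "\<exists>a d. norm d = 1 \<and> L = range (\<lambda>t. a + t *\<^sub>R d)"
  then obtain a d where d: "norm d = 1" "L = range (\<lambda>t. a + t *\<^sub>R d)" by blast
  have "L = affine hull {a, a + d}"
  proof (intro equalityI subsetI)
    fix x assume "x \<in> L"
    then obtain t where t: "x = a + t *\<^sub>R d" using d by blast
    have "x = (1 - t) *\<^sub>R a + t *\<^sub>R (a + d)"
      unfolding t by (simp add: algebra_simps)
    then show "x \<in> affine hull {a, a + d}"
      unfolding affine_hull_2 by (intro CollectI exI[of _ "1 - t"] exI[of _ t]) simp
  next
    fix x assume "x \<in> affine hull {a, a + d}"
    then obtain u v where uv: "u + v = 1" "x = u *\<^sub>R a + v *\<^sub>R (a + d)" by (auto simp: affine_hull_2)
    from uv(2) have "x = (u + v) *\<^sub>R a + v *\<^sub>R d"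
      by (simp only: scaleR_left_distrib scaleR_right_distrib add.assoc)
    then have "x = a + v *\<^sub>R d" by (simp only: uv scaleR_one)
    then show "x \<in> L" using d by blast
  qed
  moreover have "aff_dim {a, a + d} = 1" using d by (auto simp: aff_dim_2)
  ultimately show "straight_line L" by (simp add: straight_line_def)
qed

section \<open>Intervals and differential equations on them\<close>

lemma open_interval_around:
  assumes "open A" "s \<in> A"
  obtains I where "open_interval I" "s \<in> I" "I \<subseteq> A"
proof -
  obtain \<delta> where \<delta>: "\<delta> > 0" "ball s \<delta> \<subseteq> A" using assms openE by blast
  then show ?thesis using that[of "ball s \<delta>"] by (simp add: open_interval_def is_interval_ball_real)
qed

lemma is_interval_between:
  fixes I :: "real set"
  assumes "is_interval I" "s \<in> I" "s' \<in> I"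
  shows "{min s s'..max s s'} \<subseteq> I"
proof
  fix x assume "x \<in> {min s s'..max s s'}"
  then show "x \<in> I"
    using mem_is_interval_1_I[OF assms] mem_is_interval_1_I[OF assms(1,3,2)] by (cases "s \<le> s'") simp_all
qed

lemma deriv_unit_curve_orthogonal:
  fixes \<gamma> :: "real \<Rightarrow> 'a::real_inner"
  assumes "open I" "s \<in> I" and unit: "\<And>x. x \<in> I \<Longrightarrow> norm (\<gamma> x) = 1"
    and \<gamma>': "(\<gamma> has_vector_derivative \<gamma>') (at s)"
  shows "\<gamma>' \<bullet> \<gamma> s = 0"
proof -
  have "((\<lambda>x. \<gamma> x \<bullet> \<gamma> x) has_vector_derivative \<gamma> s \<bullet> \<gamma>' + \<gamma>' \<bullet> \<gamma> s) (at s)"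
    by (intro bounded_bilinear.has_vector_derivative[OF bounded_bilinear_inner] \<gamma>')
  moreover have "((\<lambda>x. \<gamma> x \<bullet> \<gamma> x) has_vector_derivative 0) (at s)"
    by (rule has_vector_derivative_transform_within_open[OF has_vector_derivative_const assms(1,2), of 1])
       (simp add: unit norm_eq_1[symmetric])
  ultimately show ?thesis using vector_derivative_unique_at by (fastforce simp: inner_commute)
qed

text \<open>The product of \<open>w\<close> and the integrating factor \<open>exp (- H)\<close> is constant, where \<open>H\<close> is an antiderivative
  of \<open>h\<close>.\<close>

lemma linear_ode_zero:
  fixes w h :: "real \<Rightarrow> real"
  assumes I: "is_interval I" and h: "continuous_on I h"
    and w: "\<And>s. s \<in> I \<Longrightarrow> (w has_vector_derivative h s * w s) (at s)"
    and s0: "s0 \<in> I" "w s0 = 0" and s: "s \<in> I"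
  shows "w s = 0"
proof -
  define A B where "A = min s0 s" and "B = max s0 s"
  have sub: "{A..B} \<subseteq> I" unfolding A_def B_def by (rule is_interval_between[OF I s0(1) s])
  obtain H where H: "\<And>x. x \<in> {A..B} \<Longrightarrow> (H has_vector_derivative h x) (at x within {A..B})"
    using antiderivative_continuous[OF continuous_on_subset[OF h sub]] by blast
  define z where "z x = w x * exp (- H x)" for x
  have "(z has_vector_derivative 0) (at x within {A..B})" if "x \<in> {A..B}" for x
  proof -
    have "(w has_real_derivative h x * w x) (at x within {A..B})"
      unfolding has_real_derivative_iff_has_vector_derivative
      by (rule has_vector_derivative_at_within[OF w]) (use that sub in blast)
    moreover have "(H has_real_derivative h x) (at x within {A..B})"
      using H[OF that] by (simp add: has_real_derivative_iff_has_vector_derivative)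
    ultimately have "(z has_real_derivative 0) (at x within {A..B})"
      unfolding z_def by (auto intro!: derivative_eq_intros)
    then show ?thesis by (simp add: has_real_derivative_iff_has_vector_derivative)
  qed
  then obtain c where "\<And>x. x \<in> {A..B} \<Longrightarrow> z x = c"
    using has_vector_derivative_zero_constant[of "{A..B}" z] by auto
  moreover have "s0 \<in> {A..B}" "s \<in> {A..B}" by (auto simp: A_def B_def)
  ultimately have "z s = z s0" by simp
  then show ?thesis using s0(2) by (simp add: z_def)
qed

section \<open>Local parametrizations\<close>

lemma smooth_on_slice:
  fixes f :: "real \<times> real \<Rightarrow> 'b::euclidean_space"
  assumes "open I" "open T" "t \<in> T" "smooth_on (I \<times> T) f"
  shows "smooth_on I (\<lambda>s. f (s, t))"
proof (rule smooth_on_compose[OF assms(1) open_Times[OF assms(1,2)] _ _ assms(4)])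
  have "bounded_linear (\<lambda>s::real. (s, 0::real))"
    by (intro bounded_linear_Pair bounded_linear_ident bounded_linear_zero)
  then have "smooth_on I (\<lambda>s. (s, 0) + (0, t))"
    using assms(1) by (intro smooth_on_add smooth_on_const smooth_on_bounded_linear)
  then show "smooth_on I (\<lambda>s. (s, t))" by simp
qed (use assms(3) in auto)

lemma smooth_on_fst:
  fixes f :: "real \<Rightarrow> 'b::euclidean_space"
  assumes "open I" "open T" "smooth_on I f"
  shows "smooth_on (I \<times> (T::real set)) (\<lambda>u. f (fst u))"
  by (rule smooth_on_compose[OF open_Times[OF assms(1,2)] assms(1) _ _ assms(3)])
     (use assms in \<open>auto intro!: smooth_on_bounded_linear bounded_linear_fst open_Times\<close>)

lemma smooth_on_ruled_map:
  fixes \<gamma> V :: "real \<Rightarrow> 'b::euclidean_space"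
  assumes "open I" "open T" "smooth_on I \<gamma>" "smooth_on I V"
  shows "smooth_on (I \<times> T) (\<lambda>(s, t). V s + t *\<^sub>R \<gamma> s)"
proof -
  have o: "open (I \<times> T)" using assms by (simp add: open_Times)
  have "smooth_on (I \<times> T) (\<lambda>u. V (fst u) + snd u *\<^sub>R \<gamma> (fst u))"
    using assms
    by (intro smooth_on_add o smooth_on_bilinear[OF bounded_bilinear_scaleR]
        smooth_on_fst smooth_on_bounded_linear[OF o bounded_linear_snd])
  then show ?thesis by (simp add: case_prod_unfold)
qed

lemma local_parametrization_subset:
  "local_parametrization S U \<phi> \<Longrightarrow> \<phi> ` U \<subseteq> S"
  unfolding local_parametrization_def using openin_imp_subset by blast

lemma local_parametrization_open_map:
  assumes "local_parametrization S U \<phi>" "open W" "W \<subseteq> U"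
  shows "openin (top_of_set S) (\<phi> ` W)"
proof -
  obtain \<psi> where "homeomorphism U (\<phi> ` U) \<phi> \<psi>" "openin (top_of_set S) (\<phi> ` U)"
    using assms(1) by (auto simp: local_parametrization_def)
  moreover have "openin (top_of_set U) W" using assms(2,3) by (simp add: open_subset)
  ultimately show ?thesis using homeomorphism_imp_open_map openin_trans by blast
qed

lemma local_parametrization_has_derivative:
  assumes "local_parametrization S U \<phi>" "u \<in> U"
  shows "(\<phi> has_derivative frechet_derivative \<phi> (at u)) (at u)"
  using assms smooth_on_has_derivative by (auto simp: local_parametrization_def)

lemma local_parametrization_derivative_nonzero:
  assumes "local_parametrization S U \<phi>" "u \<in> U" "h \<noteq> 0"
  shows "frechet_derivative \<phi> (at u) h \<noteq> 0"
proof
  assume "frechet_derivative \<phi> (at u) h = 0"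
  then have "frechet_derivative \<phi> (at u) h = frechet_derivative \<phi> (at u) 0"
    using linear_0[OF has_derivative_linear[OF local_parametrization_has_derivative[OF assms(1,2)]]] by simp
  moreover have "inj (frechet_derivative \<phi> (at u))"
    using assms(1,2) by (simp add: local_parametrization_def)
  ultimately show False using assms(3) by (auto dest: injD)
qed

text \<open>A local parametrization \<open>\<phi>\<close> that factors as \<open>X \<circ> \<Sigma>\<close> makes \<open>X\<close> a local parametrization on the open
  subsets of the image of \<open>\<Sigma>\<close>: composing \<open>\<Sigma>\<close> with the inverse of \<open>\<phi>\<close> gives the inverse of \<open>X\<close>, and the derivative of \<open>\<Sigma>\<close>, being injective between planes, is surjective, so
  that injectivity passes from \<open>\<phi>'\<close> to \<open>X'\<close>.\<close>

lemma local_parametrization_reparametrize: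
  assumes \<phi>: "local_parametrization S U \<phi>"
    and \<Sigma>: "smooth_on U \<Sigma>" "\<And>u. u \<in> U \<Longrightarrow> \<phi> u = X (\<Sigma> u)"
    and W: "open W" "W \<subseteq> \<Sigma> ` U" "smooth_on W X"
  shows "local_parametrization S W X"
proof -
  have U: "open U" using \<phi> by (simp add: local_parametrization_def)
  obtain \<psi> where \<psi>: "homeomorphism U (\<phi> ` U) \<phi> \<psi>"
    using \<phi> by (auto simp: local_parametrization_def)
  define W' where "W' = U \<inter> \<Sigma> -` W"
  have cont: "continuous_on U \<Sigma>" using \<Sigma>(1) smooth_on_imp_continuous_on by blast
  have "open W'" unfolding W'_def using continuous_open_preimage[OF cont U W(1)] .
  have image: "X ` W = \<phi> ` W'"
  proof (intro equalityI subsetI)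
    fix x assume "x \<in> X ` W"
    then obtain w where w: "w \<in> W" "x = X w" by auto
    then obtain u where "u \<in> U" "w = \<Sigma> u" using W(2) by auto
    then show "x \<in> \<phi> ` W'" using w \<Sigma>(2) by (auto simp: W'_def)
  qed (use \<Sigma>(2) in \<open>auto simp: W'_def\<close>)
  have "openin (top_of_set S) (X ` W)"
    unfolding image using local_parametrization_open_map[OF \<phi> \<open>open W'\<close>] by (auto simp: W'_def)
  moreover have "homeomorphism W (X ` W) X (\<Sigma> \<circ> \<psi>)"
  proof (rule homeomorphismI)
    show "continuous_on W X" using W(3) smooth_on_imp_continuous_on by blast
    have "continuous_on (X ` W) \<psi>"
      unfolding image using homeomorphism_cont2[OF \<psi>] by (rule continuous_on_subset) (auto simp: W'_def)
    moreover have "\<psi> ` (X ` W) \<subseteq> U"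
      unfolding image using homeomorphism_apply1[OF \<psi>] by (auto simp: W'_def)
    ultimately show "continuous_on (X ` W) (\<Sigma> \<circ> \<psi>)"
      by (intro continuous_on_compose continuous_on_subset[OF cont])
    show inv: "(\<Sigma> \<circ> \<psi>) (X x) = x" if x: "x \<in> W" for x
    proof -
      obtain u where u: "u \<in> U" "x = \<Sigma> u" using x W(2) by blast
      have "\<psi> (X x) = u" using u homeomorphism_apply1[OF \<psi>] \<Sigma>(2) by metis
      then show ?thesis using u by simp
    qed
    then show "(\<Sigma> \<circ> \<psi>) ` X ` W \<subseteq> W" by auto
    show "X ((\<Sigma> \<circ> \<psi>) y) = y" if "y \<in> X ` W" for y using that inv by auto
  qed auto
  moreover have "inj (frechet_derivative X (at w))" if w: "w \<in> W" for w
  proof -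
    obtain u where u: "u \<in> U" "w = \<Sigma> u" using w W(2) by blast
    let ?A = "frechet_derivative X (at w)" and ?B = "frechet_derivative \<Sigma> (at u)"
    have A: "(X has_derivative ?A) (at (\<Sigma> u))"
      using smooth_on_has_derivative[OF W(3) w] u by simp
    have B: "(\<Sigma> has_derivative ?B) (at u)" using smooth_on_has_derivative[OF \<Sigma>(1) u(1)] .
    have "(\<phi> has_derivative (\<lambda>h. ?A (?B h))) (at u)"
      by (rule has_derivative_transform_within_open[OF has_derivative_compose[OF B A] U u(1)])
         (simp add: \<Sigma>(2))
    then have "frechet_derivative \<phi> (at u) = (\<lambda>h. ?A (?B h))"
      using frechet_derivative_at by metis
    moreover have "inj (frechet_derivative \<phi> (at u))"
      using \<phi> u(1) by (auto simp: local_parametrization_def)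
    ultimately have inj: "inj (?A \<circ> ?B)" by (simp add: comp_def)
    then have "inj ?B" by (rule inj_on_imageI2)
    then have "surj ?B"
      using linear_injective_imp_surjective has_derivative_linear[OF B] by blast
    then show "inj ?A" using inj_on_imageI[OF inj] by simp
  qed
  ultimately show ?thesis using W by (auto simp: local_parametrization_def)
qed

lemma local_parametrization_restrict:
  assumes "local_parametrization S U \<phi>" "open W" "W \<subseteq> U"
  shows "local_parametrization S W \<phi>"
proof (rule local_parametrization_reparametrize[OF assms(1) _ _ assms(2), of "\<lambda>u. u"])
  show "smooth_on U (\<lambda>u. u)"
    using assms(1) smooth_on_bounded_linear[OF _ bounded_linear_ident]
    by (auto simp: local_parametrization_def)
  show "smooth_on W \<phi>" using assms smooth_on_subset by (auto simp: local_parametrization_def)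
qed (use assms(3) in auto)

lemma lagrangian_frechet_derivative:
  assumes "lagrangian S" "local_parametrization S U \<phi>" "u \<in> U"
  shows "frechet_derivative \<phi> (at u) h \<bullet> J (frechet_derivative \<phi> (at u) k) = 0"
proof -
  have "frechet_derivative \<phi> (at u) h \<in> tangent_space S (\<phi> u)" for h
    unfolding tangent_space_def using assms(2,3) by blast
  moreover have "\<phi> u \<in> S" using local_parametrization_subset[OF assms(2)] assms(3) by auto
  ultimately show ?thesis using assms(1) by (auto simp: lagrangian_def)
qed

section \<open>Ruled patches\<close>

lemma ruled_map_has_derivative:
  fixes \<gamma> V :: "real \<Rightarrow> 'b::real_normed_vector"
  assumes "(V has_vector_derivative V') (at s)" "(\<gamma> has_vector_derivative \<gamma>') (at s)"
  shows "((\<lambda>(s, t). V s + t *\<^sub>R \<gamma> s) has_derivative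
    (\<lambda>(x, y). x *\<^sub>R (V' + t *\<^sub>R \<gamma>') + y *\<^sub>R \<gamma> s)) (at (s, t))"
proof -
  have 1: "((\<lambda>u::real\<times>real. f (fst u)) has_derivative (\<lambda>h. fst h *\<^sub>R f')) (at (s, t))"
    if "(f has_vector_derivative f') (at s)" for f :: "real \<Rightarrow> 'b" and f'
    using has_derivative_compose[OF has_derivative_fst[OF has_derivative_ident], of f _ "(s, t)" UNIV]
      that by (simp add: has_vector_derivative_def)
  have "((\<lambda>u. V (fst u) + snd u *\<^sub>R \<gamma> (fst u)) has_derivative
    (\<lambda>h. fst h *\<^sub>R V' + (snd (s, t) *\<^sub>R (fst h *\<^sub>R \<gamma>') + snd h *\<^sub>R \<gamma> (fst (s, t))))) (at (s, t))"
    by (intro has_derivative_add has_derivative_scaleR 1 assms has_derivative_snd has_derivative_ident)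
  then show ?thesis by (simp add: case_prod_unfold algebra_simps)
qed

text \<open>The normal form: the base curve \<open>V\<close> crosses the rulings orthogonally. The parameter \<open>t = 0\<close> belongs to
  the patch, so that the base curve lies in the surface.\<close>

locale ruled_patch =
  fixes S :: "(complex^2) set" and F :: "(complex^2) set set" and I T :: "real set"
    and \<gamma> V :: "real \<Rightarrow> complex^2"
  assumes lagrangian: "lagrangian S"
    and interval: "open_interval I" "open_interval T" "0 \<in> T"
    and smooth: "smooth_on I \<gamma>" "smooth_on I V"
    and unit: "s \<in> I \<Longrightarrow> norm (\<gamma> s) = 1"
    and base_orthogonal: "s \<in> I \<Longrightarrow> deriv_curve V s \<bullet> \<gamma> s = 0"
    and parametrization: "local_parametrization S (I \<times> T) (\<lambda>(s, t). V s + t *\<^sub>R \<gamma> s)"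
    and leaf: "s \<in> I \<Longrightarrow> \<exists>l\<in>F. \<forall>t\<in>T. V s + t *\<^sub>R \<gamma> s \<in> l"
begin

text \<open>The vectors \<open>\<gamma>\<close> and \<open>e\<close> form a unitary frame; \<open>a\<close> and \<open>b\<close> are the speeds of the direction and of the base
  curve along \<open>e\<close>.\<close>

definition e :: "real \<Rightarrow> complex^2" where "e s = perp (\<gamma> s)"
definition a :: "real \<Rightarrow> complex" where "a s = herm (deriv_curve \<gamma> s) (e s)"
definition b :: "real \<Rightarrow> complex" where "b s = herm (deriv_curve V s) (e s)"

lemma open_I: "open I" and open_T: "open T"
  using interval by (auto simp: open_interval_def)

lemma nonzero_parameter:
  obtains t where "t \<in> T" "- t \<in> T" "t \<noteq> 0"
proof -
  obtain \<epsilon> where "\<epsilon> > 0" "ball 0 \<epsilon> \<subseteq> T" using open_T interval(3) openE by blast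
  then show ?thesis using that[of "\<epsilon> / 2"] by (auto simp: subset_iff)
qed

lemma has_vector_derivative:
  assumes "s \<in> I"
  shows "(\<gamma> has_vector_derivative deriv_curve \<gamma> s) (at s)"
    "(V has_vector_derivative deriv_curve V s) (at s)"
  using smooth_on_has_vector_derivative smooth assms by auto

lemmas parametrization_has_derivative = ruled_map_has_derivative[OF has_vector_derivative(2,1)]

lemma frechet_derivative_parametrization:
  assumes "s \<in> I"
  shows "frechet_derivative (\<lambda>(s, t). V s + t *\<^sub>R \<gamma> s) (at (s, t)) =
    (\<lambda>(x, y). x *\<^sub>R (deriv_curve V s + t *\<^sub>R deriv_curve \<gamma> s) + y *\<^sub>R \<gamma> s)"
  using frechet_derivative_at[OF parametrization_has_derivative[OF assms assms]] by simp

text \<open>The Lagrangian condition makes \<open>V' + t \<gamma>'\<close> orthogonal to \<open>J \<gamma>\<close>; as this holds for two values of \<open>t\<close>,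
  both \<open>V'\<close> and \<open>\<gamma>'\<close> are.\<close>

lemma herm_deriv_direction:
  assumes "s \<in> I"
  shows "herm (deriv_curve \<gamma> s) (\<gamma> s) = 0" "herm (deriv_curve V s) (\<gamma> s) = 0"
proof -
  have lag: "(deriv_curve V s + t *\<^sub>R deriv_curve \<gamma> s) \<bullet> J (\<gamma> s) = 0" if "t \<in> T" for t
    using lagrangian_frechet_derivative[OF lagrangian parametrization, of "(s, t)" "(1, 0)" "(0, 1)"]
      assms that by (simp add: frechet_derivative_parametrization)
  have base: "deriv_curve V s \<bullet> J (\<gamma> s) = 0" using lag[OF interval(3)] by simp
  obtain t where "t \<in> T" "t \<noteq> 0" using nonzero_parameter .
  then have "deriv_curve \<gamma> s \<bullet> J (\<gamma> s) = 0" using lag[of t] base by (simp add: inner_add_left)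
  moreover have "deriv_curve \<gamma> s \<bullet> \<gamma> s = 0"
    using deriv_unit_curve_orthogonal[OF open_I assms unit has_vector_derivative(1)[OF assms]] .
  ultimately show "herm (deriv_curve \<gamma> s) (\<gamma> s) = 0"
    by (simp add: complex_eq_iff flip: inner_eq_Re_herm inner_J_eq_Im_herm)
  show "herm (deriv_curve V s) (\<gamma> s) = 0"
    using base base_orthogonal[OF assms]
    by (simp add: complex_eq_iff flip: inner_eq_Re_herm inner_J_eq_Im_herm)
qed

lemma deriv_direction:
  assumes "s \<in> I"
  shows "deriv_curve \<gamma> s = a s *s e s" "deriv_curve V s = b s *s e s"
  using unitary_decomposition[OF unit[OF assms], of "deriv_curve \<gamma> s"]
    unitary_decomposition[OF unit[OF assms], of "deriv_curve V s"]
  by (simp_all add: herm_deriv_direction[OF assms] a_def b_def e_def)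

lemma deriv_ruled_map:
  assumes "s \<in> I"
  shows "deriv_curve V s + t *\<^sub>R deriv_curve \<gamma> s = (t *\<^sub>R a s + b s) *s e s"
  unfolding deriv_direction[OF assms] by (simp add: vec2_eq_iff algebra_simps)

lemma immersed:
  assumes "s \<in> I" "t \<in> T"
  shows "t *\<^sub>R a s + b s \<noteq> 0"
proof
  assume "t *\<^sub>R a s + b s = 0"
  then have "deriv_curve V s + t *\<^sub>R deriv_curve \<gamma> s = 0"
    by (simp add: deriv_ruled_map[OF assms(1)])
  then have "frechet_derivative (\<lambda>(s, t). V s + t *\<^sub>R \<gamma> s) (at (s, t)) (1, 0) = 0"
    by (simp add: frechet_derivative_parametrization[OF assms(1)])
  then show False
    using local_parametrization_derivative_nonzero[OF parametrization, of "(s, t)" "(1, 0)"] assms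
    by (simp add: zero_prod_def)
qed

lemma b_nonzero: "s \<in> I \<Longrightarrow> b s \<noteq> 0"
  using immersed[of s 0] interval(3) by simp

end

lemma ruled_patch_restrict:
  assumes "ruled_patch S F I T \<gamma> V" "open_interval I'" "I' \<subseteq> I"
  shows "ruled_patch S F I' T \<gamma> V"
proof -
  interpret ruled_patch S F I T \<gamma> V by fact
  show ?thesis
  proof
    show "smooth_on I' \<gamma>" "smooth_on I' V" using smooth assms(3) smooth_on_subset by blast+
    show "local_parametrization S (I' \<times> T) (\<lambda>(s, t). V s + t *\<^sub>R \<gamma> s)"
      by (rule local_parametrization_restrict[OF parametrization])
         (use assms open_T in \<open>auto simp: open_interval_def intro: open_Times\<close>)
  qed (use assms lagrangian interval unit base_orthogonal leaf in auto)
qed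

section \<open>Ruled patches around the points of a ruled surface\<close>

lemma has_vector_derivative_slice:
  fixes \<phi> :: "real \<times> real \<Rightarrow> 'b::real_normed_vector"
  assumes "(\<phi> has_derivative D) (at (s, t))"
  shows "((\<lambda>s. \<phi> (s, t)) has_vector_derivative D (1, 0)) (at s)"
    "((\<lambda>t. \<phi> (s, t)) has_vector_derivative D (0, 1)) (at t)"
proof -
  have lin: "linear D" using assms has_derivative_linear by blast
  have "((\<lambda>s. (s, t)) has_derivative (\<lambda>h. (h, 0))) (at s)"
    "((\<lambda>t. (s, t)) has_derivative (\<lambda>h. (0, h))) (at t)"
    by (intro has_derivative_Pair has_derivative_ident has_derivative_const)+
  then have D: "((\<lambda>s. \<phi> (s, t)) has_derivative (\<lambda>h. D (h, 0))) (at s)"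
    "((\<lambda>t. \<phi> (s, t)) has_derivative (\<lambda>h. D (0, h))) (at t)"
    using has_derivative_compose[of "\<lambda>s. (s, t)" "\<lambda>h. (h, 0)" s UNIV \<phi> D]
      has_derivative_compose[of "\<lambda>t. (s, t)" "\<lambda>h. (0, h)" t UNIV \<phi> D] assms by blast+
  have lin': "D (h, 0) = h *\<^sub>R D (1, 0)" "D (0, h) = h *\<^sub>R D (0, 1)" for h
    using linear_cmul[OF lin, of h "(1, 0)"] linear_cmul[OF lin, of h "(0, 1)"] by simp_all
  show "((\<lambda>s. \<phi> (s, t)) has_vector_derivative D (1, 0)) (at s)"
    unfolding has_vector_derivative_def by (rule has_derivative_eq_rhs[OF D(1) ext]) (rule lin')
  show "((\<lambda>t. \<phi> (s, t)) has_vector_derivative D (0, 1)) (at t)"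
    unfolding has_vector_derivative_def by (rule has_derivative_eq_rhs[OF D(2) ext]) (rule lin')
qed

lemma continuous_nonzero_on_interval_sgn_constant:
  fixes m :: "real \<Rightarrow> real"
  assumes "is_interval T" "continuous_on T m" "\<And>t. t \<in> T \<Longrightarrow> m t \<noteq> 0" "t \<in> T" "t' \<in> T"
  shows "sgn (m t) = sgn (m t')"
proof (rule ccontr)
  assume neq: "sgn (m t) \<noteq> sgn (m t')"
  have "connected (m ` T)"
    using assms(1,2) by (intro connected_continuous_image) (simp_all add: is_interval_connected_1)
  then have int: "is_interval (m ` T)" by (simp add: is_interval_connected_1)
  have "0 \<in> m ` T"
  proof (cases "m t < 0")
    case True
    then have "m t' > 0" using neq assms(3)[OF assms(5)] by (auto simp: sgn_real_def split: if_splits)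
    then show ?thesis using mem_is_interval_1_I[OF int, of "m t" "m t'" 0] True assms by auto
  next
    case False
    then have "m t > 0" "m t' < 0"
      using neq assms(3)[OF assms(4)] assms(3)[OF assms(5)]
      by (auto simp: sgn_real_def split: if_splits)
    then show ?thesis using mem_is_interval_1_I[OF int, of "m t'" "m t" 0] assms by auto
  qed
  then show False using assms(3) by auto
qed

lemma leaf_subset_line:
  assumes "ruling S F" "l \<in> F"
  obtains p d where "norm d = 1" "l \<subseteq> range (\<lambda>t. p + t *\<^sub>R d)"
proof -
  obtain L where "straight_line L" "openin (top_of_set L) l"
    using assms unfolding ruling_def by blast
  then show ?thesis
    using that openin_imp_subset unfolding straight_line_iff by blast
qed

text \<open>Along a plaque, the chart is \<open>p + r(t) d\<close> for a fixed unit vector \<open>d\<close>. The derivative of \<open>r\<close> does not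
  vanish because the chart is immersed, so it has constant sign.\<close>

lemma foliated_chart_along_leaf:
  assumes "ruling S F" and chart: "foliated_chart S F I T \<phi>"
    and s: "s \<in> I" and t: "t \<in> T" "t' \<in> T"
  shows "leaf_direction \<phi> (s, t) = leaf_direction \<phi> (s, t')"
    and "\<phi> (s, t) = \<phi> (s, t') +
      ((\<phi> (s, t) - \<phi> (s, t')) \<bullet> leaf_direction \<phi> (s, t')) *\<^sub>R leaf_direction \<phi> (s, t')"
    and "norm (leaf_direction \<phi> (s, t')) = 1"
    and "t' < t \<Longrightarrow> (\<phi> (s, t) - \<phi> (s, t')) \<bullet> leaf_direction \<phi> (s, t') > 0"
proof -
  have T: "open T" "is_interval T" and \<phi>: "local_parametrization S (I \<times> T) \<phi>"
    using chart by (auto simp: foliated_chart_def open_interval_def)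
  obtain l where l: "l \<in> F" "\<phi> ` ({s} \<times> T) \<subseteq> l"
    using chart s by (auto simp: foliated_chart_def)
  obtain p d where d: "norm d = 1" "l \<subseteq> range (\<lambda>t. p + t *\<^sub>R d)"
    using leaf_subset_line[OF assms(1) l(1)] .
  have dd: "d \<bullet> d = 1" using d(1) by (simp add: norm_eq_1)
  define r where "r x = (\<phi> (s, x) - p) \<bullet> d" for x
  have r: "\<phi> (s, x) = p + r x *\<^sub>R d" if x: "x \<in> T" for x
  proof -
    have "\<phi> (s, x) \<in> l" using l(2) x by auto
    then obtain y where "\<phi> (s, x) = p + y *\<^sub>R d" using d(2) by blast
    then show ?thesis by (simp add: r_def dd)
  qed
  define m where "m x = frechet_derivative \<phi> (at (s, x)) (0, 1) \<bullet> d" for x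
  have D: "((\<lambda>x. \<phi> (s, x)) has_vector_derivative frechet_derivative \<phi> (at (s, x)) (0, 1)) (at x)"
    if "x \<in> T" for x
    using has_vector_derivative_slice(2) local_parametrization_has_derivative[OF \<phi>, of "(s, x)"]
      that s by auto
  have r': "(r has_real_derivative m x) (at x)" if "x \<in> T" for x
    unfolding has_real_derivative_iff_has_vector_derivative r_def m_def
    using bounded_linear.has_vector_derivative[OF bounded_linear_inner_left
        has_vector_derivative_diff[OF D[OF that] has_vector_derivative_const]] by simp
  have \<phi>': "frechet_derivative \<phi> (at (s, x)) (0, 1) = m x *\<^sub>R d" if x: "x \<in> T" for x
  proof (rule vector_derivative_unique_at[OF D[OF x]])
    have "((\<lambda>x. p + r x *\<^sub>R d) has_vector_derivative m x *\<^sub>R d) (at x)"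
      using r'[OF x] by (auto intro!: derivative_eq_intros)
    then show "((\<lambda>x. \<phi> (s, x)) has_vector_derivative m x *\<^sub>R d) (at x)"
      by (rule has_vector_derivative_transform_within_open[OF _ T(1) x]) (simp add: r)
  qed
  have m_nz: "m x \<noteq> 0" if x: "x \<in> T" for x
    using local_parametrization_derivative_nonzero[OF \<phi>, of "(s, x)" "(0, 1)"] \<phi>'[OF x] x s
    by (auto simp: zero_prod_def)
  have "continuous_on T m"
  proof -
    have "smooth_on (I \<times> T) (\<lambda>u. frechet_derivative \<phi> (at u) (0, 1))"
      using \<phi> smooth_on_iff by (auto simp: local_parametrization_def)
    then have "continuous_on (I \<times> T) (\<lambda>u. frechet_derivative \<phi> (at u) (0, 1))"
      using smooth_on_imp_continuous_on by blast
    then show ?thesis unfolding m_def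
      by (intro continuous_intros) (rule continuous_on_compose2[of _ _ _ "\<lambda>x. (s, x)"],
          use s in \<open>auto intro!: continuous_intros\<close>)
  qed
  then have sgn_m: "sgn (m x) = sgn (m t')" if "x \<in> T" for x
    using continuous_nonzero_on_interval_sgn_constant[of T m x t'] T(2) m_nz that t by simp
  define \<epsilon> where "\<epsilon> = sgn (m t')"
  have \<epsilon>: "\<epsilon> * \<epsilon> = 1" "\<bar>\<epsilon>\<bar> = 1" using m_nz[OF t(2)] by (auto simp: \<epsilon>_def sgn_real_def)
  have dir: "leaf_direction \<phi> (s, x) = \<epsilon> *\<^sub>R d" if "x \<in> T" for x
    using sgn_m[OF that] d(1) unfolding leaf_direction_def \<phi>'[OF that] \<epsilon>_def
    by (simp add: sgn_scaleR sgn_div_norm[of d])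
  show "leaf_direction \<phi> (s, t) = leaf_direction \<phi> (s, t')" using dir t by simp
  have diff: "(\<phi> (s, t) - \<phi> (s, t')) \<bullet> leaf_direction \<phi> (s, t') = \<epsilon> * (r t - r t')"
    unfolding dir[OF t(2)] r[OF t(1)] r[OF t(2)] by (simp add: algebra_simps dd)
  have "\<epsilon> * (r t - r t') * \<epsilon> = r t - r t'"
    using \<epsilon>(1) by (metis mult.assoc mult.commute mult.right_neutral)
  then have "(\<epsilon> * (r t - r t')) *\<^sub>R \<epsilon> *\<^sub>R d = (r t - r t') *\<^sub>R d" by (simp only: scaleR_scaleR)
  then show "\<phi> (s, t) = \<phi> (s, t') +
      ((\<phi> (s, t) - \<phi> (s, t')) \<bullet> leaf_direction \<phi> (s, t')) *\<^sub>R leaf_direction \<phi> (s, t')"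
    unfolding diff unfolding dir[OF t(2)] r[OF t(1)] r[OF t(2)] by (simp add: scaleR_left_diff_distrib)
  show "norm (leaf_direction \<phi> (s, t')) = 1"
    using dir[OF t(2)] \<epsilon>(2) d(1) by simp
  assume "t' < t"
  have "\<epsilon> * r t' < \<epsilon> * r t"
  proof (rule DERIV_pos_imp_increasing[OF \<open>t' < t\<close>])
    fix x assume "t' \<le> x" "x \<le> t"
    then have x: "x \<in> T" using mem_is_interval_1_I[OF T(2) t(2,1)] by simp
    have "((\<lambda>x. \<epsilon> * r x) has_real_derivative \<epsilon> * m x) (at x)"
      using r'[OF x] by (auto intro!: derivative_eq_intros)
    moreover have "\<epsilon> * m x > 0"
      using sgn_m[OF x] m_nz[OF x] unfolding \<epsilon>_def by (metis abs_sgn mult.commute zero_less_abs_iff)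
    ultimately show "\<exists>y. ((\<lambda>x. \<epsilon> * r x) has_real_derivative y) (at x) \<and> 0 < y" by blast
  qed
  then show "(\<phi> (s, t) - \<phi> (s, t')) \<bullet> leaf_direction \<phi> (s, t') > 0"
    unfolding diff by (simp add: algebra_simps)
qed

lemma smooth_on_leaf_direction:
  assumes "local_parametrization S U \<phi>"
  shows "smooth_on U (leaf_direction \<phi>)"
proof -
  have U: "open U" "smooth_on U \<phi>" using assms(1) by (auto simp: local_parametrization_def)
  have "frechet_derivative \<phi> (at u) (0, 1) \<noteq> 0" if "u \<in> U" for u
    using local_parametrization_derivative_nonzero[OF assms that] by (simp add: zero_prod_def)
  moreover have "smooth_on U (\<lambda>u. frechet_derivative \<phi> (at u) (0, 1))" using U(2) smooth_on_iff by blast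
  ultimately have "smooth_on U (\<lambda>u. sgn (frechet_derivative \<phi> (at u) (0, 1)))"
    using smooth_on_sgn[OF U(1)] by blast
  then show ?thesis by (simp add: leaf_direction_def[abs_def])
qed

text \<open>The chart factors through the ruled map by a change \<open>(s, t) \<mapsto> (s, \<sigma> s t)\<close> of parameters that is
  increasing in \<open>t\<close>.\<close>

lemma foliated_chart_imp_ruled_patch:
  assumes "lagrangian S" "ruling S F" and chart: "foliated_chart S F I0 T0 \<phi>"
    and s0: "s0 \<in> I0" and t0: "t0 \<in> T0"
  obtains I T \<gamma> V where "ruled_patch S F I T \<gamma> V" "s0 \<in> I" "I \<subseteq> I0" "V s0 = \<phi> (s0, t0)"
    "\<And>s. s \<in> I \<Longrightarrow> \<gamma> s = leaf_direction \<phi> (s, t0)"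
proof -
  note along = foliated_chart_along_leaf[OF assms(2) chart]
  have I0: "open I0" and T0: "open T0" "is_interval T0" and \<phi>: "local_parametrization S (I0 \<times> T0) \<phi>"
    using chart by (auto simp: foliated_chart_def open_interval_def)
  have smooth_\<phi>: "smooth_on (I0 \<times> T0) \<phi>" using \<phi> by (simp add: local_parametrization_def)
  define q where "q s = \<phi> (s, t0)" for s
  define \<gamma> where "\<gamma> s = leaf_direction \<phi> (s, t0)" for s
  have smooth_q: "smooth_on I0 q"
    unfolding q_def by (rule smooth_on_slice[OF I0 T0(1) t0 smooth_\<phi>])
  have smooth_\<gamma>: "smooth_on I0 \<gamma>"
    unfolding \<gamma>_def by (rule smooth_on_slice[OF I0 T0(1) t0 smooth_on_leaf_direction[OF \<phi>]])
  have unit: "norm (\<gamma> s) = 1" if "s \<in> I0" for s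
    unfolding \<gamma>_def using along(3) that t0 by blast
  \<comment> \<open>\<open>f\<close> slides the base curve along the leaves until it is orthogonal to them.\<close>
  define f' where "f' s = deriv_curve q s \<bullet> \<gamma> s" for s
  have smooth_f': "smooth_on I0 f'"
    unfolding f'_def
    by (rule smooth_on_bilinear[OF bounded_bilinear_inner I0 smooth_on_deriv_curve[OF I0 smooth_q] smooth_\<gamma>])
  obtain \<eta> where \<eta>: "\<eta> > 0" "cball s0 \<eta> \<subseteq> I0" using I0 s0 open_contains_cball by blast
  then have sub: "{s0 - \<eta>..s0 + \<eta>} \<subseteq> I0" by (simp add: cball_eq_atLeastAtMost)
  obtain f0 where f0: "\<And>s. s \<in> {s0 - \<eta>..s0 + \<eta>} \<Longrightarrow>
      (f0 has_vector_derivative f' s) (at s within {s0 - \<eta>..s0 + \<eta>})"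
    using antiderivative_continuous[OF continuous_on_subset[OF smooth_on_imp_continuous_on[OF smooth_f'] sub]]
    by blast
  define I1 where "I1 = {s0 - \<eta><..<s0 + \<eta>}"
  have I1: "open I1" "I1 \<subseteq> I0" "s0 \<in> I1" using sub \<eta>(1) by (auto simp: I1_def subset_iff)
  define f where "f s = f0 s - f0 s0" for s
  have f: "(f has_vector_derivative f' s) (at s)" if "s \<in> I1" for s
  proof -
    have "(f0 has_vector_derivative f' s) (at s)"
      using f0[of s] that at_within_interior[of s "{s0 - \<eta>..s0 + \<eta>}"]
      by (simp add: I1_def)
    then show ?thesis unfolding f_def by (auto intro!: derivative_eq_intros)
  qed
  have smooth_f: "smooth_on I1 f"
    using smooth_on_antiderivative[OF I1(1) f smooth_on_subset[OF smooth_f' I1(2)]] .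
  define V where "V s = q s - f s *\<^sub>R \<gamma> s" for s
  have smooth_V: "smooth_on I1 V"
    unfolding V_def using smooth_on_subset[OF smooth_q I1(2)] smooth_on_subset[OF smooth_\<gamma> I1(2)] smooth_f I1(1)
    by (intro smooth_on_diff smooth_on_bilinear[OF bounded_bilinear_scaleR])
  have \<gamma>': "(\<gamma> has_vector_derivative deriv_curve \<gamma> s) (at s)" "deriv_curve \<gamma> s \<bullet> \<gamma> s = 0"
    if s: "s \<in> I1" for s
  proof -
    have "s \<in> I0" using s I1(2) by auto
    then show d: "(\<gamma> has_vector_derivative deriv_curve \<gamma> s) (at s)"
      using smooth_on_has_vector_derivative[OF smooth_\<gamma>] by blast
    show "deriv_curve \<gamma> s \<bullet> \<gamma> s = 0"
      using deriv_unit_curve_orthogonal[OF I0 \<open>s \<in> I0\<close> unit d] .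
  qed
  have base: "deriv_curve V s \<bullet> \<gamma> s = 0" if s: "s \<in> I1" for s
  proof -
    have "(V has_vector_derivative deriv_curve q s - (f s *\<^sub>R deriv_curve \<gamma> s + f' s *\<^sub>R \<gamma> s)) (at s)"
      unfolding V_def using smooth_on_has_vector_derivative[OF smooth_q, of s] s I1(2)
      by (intro has_vector_derivative_diff
          bounded_bilinear.has_vector_derivative[OF bounded_bilinear_scaleR] f \<gamma>') auto
    then have "deriv_curve V s = deriv_curve q s - (f s *\<^sub>R deriv_curve \<gamma> s + f' s *\<^sub>R \<gamma> s)"
      by (rule vector_derivative_at)
    moreover have "\<gamma> s \<bullet> \<gamma> s = 1" using unit[of s] s I1(2) by (auto simp: norm_eq_1)
    ultimately show ?thesis by (simp add: inner_diff_left inner_add_left \<gamma>'(2)[OF s] f'_def)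
  qed
  define \<sigma> where "\<sigma> s t = (\<phi> (s, t) - V s) \<bullet> \<gamma> s" for s t
  have \<sigma>_eq: "\<sigma> s t = (\<phi> (s, t) - \<phi> (s, t0)) \<bullet> \<gamma> s + f s" if "s \<in> I1" for s t
    using unit[of s] that I1(2) by (auto simp: \<sigma>_def V_def q_def algebra_simps norm_eq_1)
  have \<phi>_eq: "\<phi> (s, t) = V s + \<sigma> s t *\<^sub>R \<gamma> s" if "s \<in> I1" "t \<in> T0" for s t
    using along(2)[of s t t0] that I1(2) t0 unfolding \<sigma>_eq[OF that(1)]
    by (auto simp: V_def q_def \<gamma>_def algebra_simps)
  have smooth_\<Sigma>: "smooth_on (I1 \<times> T0) (\<lambda>u. (fst u, \<sigma> (fst u) (snd u)))"
  proof -
    have o: "open (I1 \<times> T0)" using I1 T0 by (simp add: open_Times)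
    have "smooth_on (I1 \<times> T0) (\<lambda>u. (\<phi> u - V (fst u)) \<bullet> \<gamma> (fst u))"
      using smooth_on_fst[OF I1(1) T0(1) smooth_V]
        smooth_on_fst[OF I1(1) T0(1) smooth_on_subset[OF smooth_\<gamma> I1(2)]]
        smooth_on_subset[OF smooth_\<phi>, of "I1 \<times> T0"] I1(2)
      by (intro smooth_on_bilinear[OF bounded_bilinear_inner o] smooth_on_diff o) auto
    then have "smooth_on (I1 \<times> T0) (\<lambda>u. (0, (\<phi> u - V (fst u)) \<bullet> \<gamma> (fst u)))"
      by (rule smooth_on_linear_image[OF o, rotated])
         (intro bounded_linear_Pair bounded_linear_ident bounded_linear_zero)
    moreover have "smooth_on (I1 \<times> T0) (\<lambda>u. (fst u, 0::real))"
      by (rule smooth_on_bounded_linear[OF o])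
         (intro bounded_linear_Pair bounded_linear_fst bounded_linear_zero)
    ultimately have "smooth_on (I1 \<times> T0)
        (\<lambda>u. (fst u, 0) + (0, (\<phi> u - V (fst u)) \<bullet> \<gamma> (fst u)))"
      by (intro smooth_on_add o)
    then show ?thesis by (simp add: \<sigma>_def)
  qed
  have cont_\<Sigma>: "continuous_on (I1 \<times> T0) (\<lambda>u. \<sigma> (fst u) (snd u))"
    using smooth_on_imp_continuous_on[OF smooth_\<Sigma>, THEN continuous_on_snd] by simp
  have cont_\<sigma>: "continuous_on I1 (\<lambda>s. \<sigma> s t)" if "t \<in> T0" for t
  proof -
    have "continuous_on I1 (\<lambda>s. (s, t))" by (intro continuous_intros)
    then show ?thesis using continuous_on_compose2[OF cont_\<Sigma>, of I1 "\<lambda>s. (s, t)"] that by auto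
  qed
  have cont_\<sigma>': "continuous_on T0 (\<sigma> s)" if "s \<in> I1" for s
  proof -
    have "continuous_on T0 (\<lambda>t. (s, t))" by (intro continuous_intros)
    then show ?thesis using continuous_on_compose2[OF cont_\<Sigma>, of T0 "\<lambda>t. (s, t)"] that by auto
  qed
  \<comment> \<open>\<open>\<sigma> s0\<close> changes sign at \<open>t0\<close>, so by the intermediate value theorem the change of parameters covers
    a rectangle around \<open>(s0, 0)\<close>.\<close>
  obtain \<tau> where \<tau>: "\<tau> > 0" "cball t0 \<tau> \<subseteq> T0" using T0(1) t0 open_contains_cball by blast
  then have T': "{t0 - \<tau>..t0 + \<tau>} \<subseteq> T0" by (simp add: cball_eq_atLeastAtMost)
  then have t_pm: "t0 - \<tau> \<in> T0" "t0 + \<tau> \<in> T0" using \<tau>(1) by auto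
  have "\<sigma> s0 (t0 - \<tau>) < 0" "\<sigma> s0 (t0 + \<tau>) > 0"
    using along(4)[OF s0 t_pm(2) t0] along(4)[OF s0 t0 t_pm(1)] along(1)[OF s0 t0 t_pm(1)] \<tau>(1)
    unfolding \<sigma>_eq[OF I1(3)] by (auto simp: f_def \<gamma>_def inner_diff_left)
  define \<epsilon> where "\<epsilon> = min (- \<sigma> s0 (t0 - \<tau>)) (\<sigma> s0 (t0 + \<tau>)) / 2"
  have \<epsilon>: "\<epsilon> > 0" "\<sigma> s0 (t0 - \<tau>) < - \<epsilon>" "\<sigma> s0 (t0 + \<tau>) > \<epsilon>"
    using \<open>\<sigma> s0 (t0 - \<tau>) < 0\<close> \<open>\<sigma> s0 (t0 + \<tau>) > 0\<close> by (auto simp: \<epsilon>_def)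
  define O1 where "O1 = (I1 \<inter> (\<lambda>s. \<sigma> s (t0 - \<tau>)) -` {..<- \<epsilon>}) \<inter> (I1 \<inter> (\<lambda>s. \<sigma> s (t0 + \<tau>)) -` {\<epsilon><..})"
  have "open O1" unfolding O1_def
    using t_pm I1 by (intro open_Int continuous_open_preimage cont_\<sigma>) auto
  moreover have "s0 \<in> O1" using \<epsilon> I1 by (auto simp: O1_def)
  ultimately obtain I where I: "open_interval I" "s0 \<in> I" and I_O1: "I \<subseteq> O1"
    using open_interval_around by metis
  define T where "T = {- \<epsilon><..<\<epsilon>}"
  have open_I: "open I" using I(1) by (simp add: open_interval_def)
  have I_I1: "I \<subseteq> I1" using I_O1 by (auto simp: O1_def)
  have hit: "\<exists>t\<in>T0. \<sigma> s t = y" if s: "s \<in> I" and y: "y \<in> T" for s y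
  proof -
    have "\<sigma> s (t0 - \<tau>) \<le> y" "y \<le> \<sigma> s (t0 + \<tau>)" using I_O1 s y by (auto simp: O1_def T_def)
    moreover have "continuous_on {t0 - \<tau>..t0 + \<tau>} (\<sigma> s)"
      using continuous_on_subset[OF cont_\<sigma>' T'] s I_I1 by blast
    ultimately obtain t where "t0 - \<tau> \<le> t" "t \<le> t0 + \<tau>" "\<sigma> s t = y"
      using IVT'[of "\<sigma> s" "t0 - \<tau>" y "t0 + \<tau>"] \<tau>(1) by auto
    then show ?thesis using T' by auto
  qed
  have smooth_I: "smooth_on I \<gamma>" "smooth_on I V"
    using smooth_on_subset smooth_\<gamma> smooth_V I_I1 I1(2) by blast+
  have "ruled_patch S F I T \<gamma> V"
  proof
    show "open_interval I" "open_interval T" "0 \<in> T"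
      using I(1) \<epsilon>(1) by (auto simp: open_interval_def T_def is_interval_oo)
    show "norm (\<gamma> s) = 1" "deriv_curve V s \<bullet> \<gamma> s = 0" if "s \<in> I" for s
      using unit base that I_I1 I1(2) by auto
    show "local_parametrization S (I \<times> T) (\<lambda>(s, t). V s + t *\<^sub>R \<gamma> s)"
    proof (rule local_parametrization_reparametrize[OF _ smooth_\<Sigma>])
      show "local_parametrization S (I1 \<times> T0) \<phi>"
        by (rule local_parametrization_restrict[OF \<phi>]) (use I1 T0 in \<open>auto intro: open_Times\<close>)
      show "\<phi> u = (\<lambda>(s, t). V s + t *\<^sub>R \<gamma> s) (fst u, \<sigma> (fst u) (snd u))" if "u \<in> I1 \<times> T0" for u
        using that \<phi>_eq by auto
      show "open (I \<times> T)" using open_I by (simp add: T_def open_Times)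
      show "I \<times> T \<subseteq> (\<lambda>u. (fst u, \<sigma> (fst u) (snd u))) ` (I1 \<times> T0)"
        using hit I_I1 by (force simp: image_iff)
      show "smooth_on (I \<times> T) (\<lambda>(s, t). V s + t *\<^sub>R \<gamma> s)"
        using smooth_I open_I by (intro smooth_on_ruled_map) (auto simp: T_def)
    qed
    show "\<exists>l\<in>F. \<forall>t\<in>T. V s + t *\<^sub>R \<gamma> s \<in> l" if s: "s \<in> I" for s
    proof -
      have s1: "s \<in> I1" "s \<in> I0" using s I_I1 I1(2) by auto
      then obtain l where l: "l \<in> F" "\<phi> ` ({s} \<times> T0) \<subseteq> l"
        using chart unfolding foliated_chart_def by blast
      have "V s + y *\<^sub>R \<gamma> s \<in> l" if y: "y \<in> T" for y
      proof -
        obtain t where "t \<in> T0" "\<sigma> s t = y" using hit[OF s y] by blast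
        then have "V s + y *\<^sub>R \<gamma> s = \<phi> (s, t)" using \<phi>_eq[OF s1(1)] by simp
        then show ?thesis using l(2) \<open>t \<in> T0\<close> by auto
      qed
      then show ?thesis using l(1) by blast
    qed
  qed (use assms(1) smooth_I in auto)
  moreover have "s0 \<in> I" "I \<subseteq> I0" using I(2) I_I1 I1(2) by auto
  moreover have "V s0 = \<phi> (s0, t0)" by (simp add: V_def q_def f_def)
  ultimately show ?thesis using that[of I T \<gamma> V] by (simp add: \<gamma>_def)
qed

lemma ruled_patch_at:
  assumes "lagrangian S" "ruling S F" "p \<in> S"
  obtains I T \<gamma> V s0 where "ruled_patch S F I T \<gamma> V" "s0 \<in> I" "V s0 = p"
proof -
  obtain I0 T0 \<phi> where chart: "foliated_chart S F I0 T0 \<phi>" and p: "p \<in> \<phi> ` (I0 \<times> T0)"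
    using assms(2,3) unfolding ruling_def by blast
  obtain s t where st: "s \<in> I0" "t \<in> T0" "p = \<phi> (s, t)" using p by auto
  obtain I T \<gamma> V where "ruled_patch S F I T \<gamma> V" "s \<in> I" "V s = \<phi> (s, t)"
    using foliated_chart_imp_ruled_patch[OF assms(1,2) chart st(1,2)] .
  then show ?thesis using that st(3) by simp
qed

section \<open>Patches that contain entire lines\<close>

lemma has_vector_derivative_zero_dominated:
  assumes c: "(c has_vector_derivative 0) (at x)"
    and dom: "\<forall>\<^sub>F y in at x. norm (f y - f x) \<le> K * norm (c y - c x)"
  shows "(f has_vector_derivative 0) (at x)"
proof -
  have "((\<lambda>y. norm (c y - c x) / norm (y - x)) \<longlongrightarrow> 0) (at x)"
    using c by (simp add: has_vector_derivative_def has_derivative_iff_norm)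
  then have lim: "((\<lambda>y. K * (norm (c y - c x) / norm (y - x))) \<longlongrightarrow> 0) (at x)"
    using tendsto_mult_right_zero by blast
  have "((\<lambda>y. norm (f y - f x) / norm (y - x)) \<longlongrightarrow> 0) (at x)"
  proof (rule Lim_null_comparison[OF _ lim])
    show "\<forall>\<^sub>F y in at x. norm (norm (f y - f x) / norm (y - x)) \<le> K * (norm (c y - c x) / norm (y - x))"
      using dom
    proof eventually_elim
      case (elim y)
      then show ?case using divide_right_mono[OF elim, of "norm (y - x)"] by simp
    qed
  qed
  then show ?thesis by (simp add: has_vector_derivative_def has_derivative_iff_norm)
qed

text \<open>Together with the previous lemma, this shows that a curve on the surface which is stationary at some
  parameter is stationary there in the coordinates of any local parametrization.\<close>

lemma local_parametrization_bounded_below: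
  assumes "local_parametrization S U \<phi>" "u \<in> U"
  obtains m where "m > 0" "\<forall>\<^sub>F w in nhds u. m * norm (w - u) \<le> norm (\<phi> w - \<phi> u)"
proof -
  let ?A = "frechet_derivative \<phi> (at u)"
  have D: "(\<phi> has_derivative ?A) (at u)" using local_parametrization_has_derivative[OF assms] .
  have "inj ?A" using assms by (auto simp: local_parametrization_def)
  then obtain B where B: "B > 0" "\<And>h. B * norm h \<le> norm (?A h)"
    using linear_inj_bounded_below_pos[OF has_derivative_linear[OF D]] by blast
  then obtain d where d: "d > 0"
    "\<And>w. norm (w - u) < d \<Longrightarrow> norm (\<phi> w - \<phi> u - ?A (w - u)) \<le> B / 2 * norm (w - u)"
    using D unfolding has_derivative_at_alt by (meson half_gt_zero)
  have "B / 2 * norm (w - u) \<le> norm (\<phi> w - \<phi> u)" if "norm (w - u) < d" for w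
    using d(2)[OF that] B(2)[of "w - u"] norm_triangle_sub[of "?A (w - u)" "\<phi> w - \<phi> u"]
    by (simp add: norm_minus_commute)
  then have "\<forall>\<^sub>F w in nhds u. B / 2 * norm (w - u) \<le> norm (\<phi> w - \<phi> u)"
    using d(1) by (auto simp: eventually_nhds_metric dist_norm)
  then show ?thesis using that[of "B / 2"] B(1) by simp
qed

lemma line_eq_imp_direction:
  fixes d d' :: "'a::real_normed_vector"
  assumes "norm d = 1" "norm d' = 1" "range (\<lambda>t. p + t *\<^sub>R d) = range (\<lambda>t. p' + t *\<^sub>R d')"
  shows "d' = d \<or> d' = - d"
proof -
  obtain t0 where t0: "p' + 0 *\<^sub>R d' = p + t0 *\<^sub>R d" using assms(3) by blast
  obtain t1 where t1: "p' + 1 *\<^sub>R d' = p + t1 *\<^sub>R d" using assms(3) by blast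
  have eq: "d' = (t1 - t0) *\<^sub>R d"
    using t0 t1 by (metis add_diff_cancel_left add_diff_cancel_left' add.right_neutral scaleR_zero_left
        scaleR_one scaleR_left_diff_distrib)
  then have "\<bar>t1 - t0\<bar> = 1" using assms(1,2) by (metis norm_scaleR mult.right_neutral)
  then have "t1 - t0 = 1 \<or> t1 - t0 = - 1" by linarith
  then show ?thesis using eq by auto
qed

lemma line_eqI:
  fixes d :: "'a::real_normed_vector"
  assumes "x \<noteq> y" "x \<in> range (\<lambda>t. p + t *\<^sub>R d)" "y \<in> range (\<lambda>t. p + t *\<^sub>R d)"
    "x \<in> range (\<lambda>t. p' + t *\<^sub>R d')" "y \<in> range (\<lambda>t. p' + t *\<^sub>R d')"
  shows "range (\<lambda>t. p + t *\<^sub>R d) = range (\<lambda>t. p' + t *\<^sub>R d')"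
proof -
  have "range (\<lambda>t. q + t *\<^sub>R v) = range (\<lambda>t. x + t *\<^sub>R (y - x))"
    if xy: "x \<in> range (\<lambda>t. q + t *\<^sub>R v)" "y \<in> range (\<lambda>t. q + t *\<^sub>R v)" for q v
  proof -
    obtain u w where uw: "x = q + u *\<^sub>R v" "y = q + w *\<^sub>R v" using xy by blast
    then have "u \<noteq> w" using assms(1) by auto
    show ?thesis
    proof (intro equalityI subsetI)
      fix z assume "z \<in> range (\<lambda>t. q + t *\<^sub>R v)"
      then obtain t where "z = q + t *\<^sub>R v" by blast
      then have "z = x + ((t - u) / (w - u)) *\<^sub>R (y - x)"
        using \<open>u \<noteq> w\<close> unfolding uw by (simp flip: scaleR_left_diff_distrib) (simp add: algebra_simps)
      then show "z \<in> range (\<lambda>t. x + t *\<^sub>R (y - x))" by blast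
    next
      fix z assume "z \<in> range (\<lambda>t. x + t *\<^sub>R (y - x))"
      then obtain t where "z = x + t *\<^sub>R (y - x)" by blast
      then have "z = q + (u + t * (w - u)) *\<^sub>R v" unfolding uw by (simp add: algebra_simps)
      then show "z \<in> range (\<lambda>t. q + t *\<^sub>R v)" by blast
    qed
  qed
  then show ?thesis using assms by metis
qed

lemma leaf_unique:
  "ruling S F \<Longrightarrow> l \<in> F \<Longrightarrow> l' \<in> F \<Longrightarrow> x \<in> l \<Longrightarrow> x \<in> l' \<Longrightarrow> l = l'"
  by (auto simp: ruling_def disjoint_def)

context ruled_patch begin

definition line :: "real \<Rightarrow> (complex^2) set" where
  "line s = range (\<lambda>t. V s + t *\<^sub>R \<gamma> s)"

lemma line_in_complete_ruling:
  assumes "complete_ruling F" "s \<in> I"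
  shows "line s \<in> F"
proof -
  obtain l where l: "l \<in> F" "\<forall>t\<in>T. V s + t *\<^sub>R \<gamma> s \<in> l" using leaf[OF assms(2)] by blast
  obtain p d where pd: "l = range (\<lambda>t. p + t *\<^sub>R d)"
    using assms(1) l(1) unfolding complete_ruling_def straight_line_iff by blast
  obtain t where t: "t \<in> T" "t \<noteq> 0" using nonzero_parameter .
  have "V s \<noteq> V s + t *\<^sub>R \<gamma> s" using t(2) unit[OF assms(2)] by auto
  moreover have "V s \<in> line s" unfolding line_def by (rule range_eqI[of _ _ 0]) simp
  moreover have "V s + t *\<^sub>R \<gamma> s \<in> line s" unfolding line_def by blast
  moreover have "V s \<in> l" using l(2) interval(3) by force
  moreover have "V s + t *\<^sub>R \<gamma> s \<in> l" using l(2) t(1) by blast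
  ultimately have "line s = l" unfolding line_def pd by (rule line_eqI)
  then show ?thesis using l(1) by simp
qed

lemma base_in_line: "V s \<in> line s"
  unfolding line_def by (rule range_eqI[of _ _ 0]) simp

text \<open>If the lines of two parameters near \<open>s0\<close> agree, then the segment between their base points
  stays in the patch, so the lines of all parameters in between agree as well; since the base curve
  is orthogonal to the lines, it cannot move along one of them.\<close>

lemma lines_distinct_locally:
  assumes ruling: "ruling S F" and complete: "complete_ruling F" and s0: "s0 \<in> I"
  obtains I' where "open_interval I'" "s0 \<in> I'" "I' \<subseteq> I"
    "\<And>s s'. s \<in> I' \<Longrightarrow> s' \<in> I' \<Longrightarrow> line s = line s' \<Longrightarrow> s = s'"
proof -
  let ?X = "\<lambda>(s, t). V s + t *\<^sub>R \<gamma> s"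
  have p0: "V s0 \<in> ?X ` (I \<times> T)"
    using s0 interval(3) by (intro image_eqI[of _ _ "(s0, 0)"]) auto
  have "openin (top_of_set S) (?X ` (I \<times> T))"
    using parametrization by (simp add: local_parametrization_def)
  then obtain r where r: "r > 0" "ball (V s0) r \<inter> S \<subseteq> ?X ` (I \<times> T)"
    using p0 unfolding openin_contains_ball by blast
  obtain \<psi> where \<psi>: "homeomorphism (I \<times> T) (?X ` (I \<times> T)) ?X \<psi>"
    using parametrization unfolding local_parametrization_def by blast
  have "open (I \<inter> V -` ball (V s0) r)"
    using continuous_open_preimage[OF smooth_on_imp_continuous_on[OF smooth(2)] open_I] by simp
  moreover have "s0 \<in> I \<inter> V -` ball (V s0) r" using s0 r(1) by simp
  ultimately obtain I' where int_I': "open_interval I'" "s0 \<in> I'" "I' \<subseteq> I \<inter> V -` ball (V s0) r"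
    using open_interval_around by metis
  then have I': "open_interval I'" "s0 \<in> I'" "I' \<subseteq> I" and V_ball: "V ` I' \<subseteq> ball (V s0) r" by auto
  have less: False if st: "s \<in> I'" "s' \<in> I'" "line s = line s'" "s < s'" for s s'
  proof -
    have sI: "s \<in> I" "s' \<in> I" using st I'(3) by auto
    have seg: "closed_segment (V s) (V s') \<subseteq> line s"
    proof -
      have "affine (line s)"
      proof -
        have "straight_line (line s)"
          unfolding straight_line_iff line_def using unit[OF sI(1)] by blast
        then show ?thesis by (simp add: straight_line_def)
      qed
      then have "convex (line s)" by (rule affine_imp_convex)
      then show ?thesis using closed_segment_subset base_in_line st(3) by blast
    qed
    have "line s \<subseteq> S"
      using line_in_complete_ruling[OF complete sI(1)] ruling by (auto simp: ruling_def)
    moreover have "closed_segment (V s) (V s') \<subseteq> ball (V s0) r"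
      using st(1,2) V_ball by (intro closed_segment_subset convex_ball) auto
    ultimately have seg': "closed_segment (V s) (V s') \<subseteq> ?X ` (I \<times> T)" using seg r(2) by blast
    have "connected ((\<lambda>x. fst (\<psi> x)) ` closed_segment (V s) (V s'))"
      by (intro connected_continuous_image connected_segment continuous_on_fst
          continuous_on_subset[OF homeomorphism_cont2[OF \<psi>] seg'])
    then have int: "is_interval ((\<lambda>x. fst (\<psi> x)) ` closed_segment (V s) (V s'))"
      by (simp add: is_interval_connected_1)
    have fst_\<psi>: "fst (\<psi> (V x)) = x" if "x \<in> I" for x
      using homeomorphism_apply1[OF \<psi>, of "(x, 0)"] that interval(3) by simp
    have same: "line x = line s" "x \<in> I" if x: "s \<le> x" "x \<le> s'" for x
    proof -
      have "x \<in> (\<lambda>x. fst (\<psi> x)) ` closed_segment (V s) (V s')"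
      proof (rule mem_is_interval_1_I[OF int _ _ x])
        show "s \<in> (\<lambda>x. fst (\<psi> x)) ` closed_segment (V s) (V s')"
          using fst_\<psi>[OF sI(1)] by (intro image_eqI[of _ _ "V s"]) auto
        show "s' \<in> (\<lambda>x. fst (\<psi> x)) ` closed_segment (V s) (V s')"
          using fst_\<psi>[OF sI(2)] by (intro image_eqI[of _ _ "V s'"]) auto
      qed
      then obtain y where y: "y \<in> closed_segment (V s) (V s')" "x = fst (\<psi> y)" by blast
      have "y \<in> ?X ` (I \<times> T)" using y(1) seg' by blast
      then have "\<psi> y \<in> I \<times> T" "?X (\<psi> y) = y"
        using homeomorphism_image2[OF \<psi>] homeomorphism_apply2[OF \<psi>] by blast+
      then have x: "x \<in> I" "y \<in> line x" using y(2) by (auto simp: line_def case_prod_unfold)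
      then show "x \<in> I" by simp
      have "y \<in> line s" using y(1) seg by blast
      then show "line x = line s"
        by (rule leaf_unique[OF ruling line_in_complete_ruling[OF complete x(1)]
            line_in_complete_ruling[OF complete sI(1)] x(2)])
    qed
    define x where "x = (s + s') / 2"
    have x: "s < x" "x < s'" using st(4) by (auto simp: x_def)
    have sx: "line x = line s" "x \<in> I" using same[of x] x by simp_all
    have on_line: "V y = V s + ((V y - V s) \<bullet> \<gamma> s) *\<^sub>R \<gamma> s" if y: "y \<in> {s<..<s'}" for y
    proof -
      have "V y \<in> line s" using base_in_line[of y] same(1)[of y] y by simp
      then obtain t where "V y = V s + t *\<^sub>R \<gamma> s" unfolding line_def by blast
      then show ?thesis using unit[OF sI(1)] by (simp add: norm_eq_1)
    qed
    have "((\<lambda>y. V s + ((V y - V s) \<bullet> \<gamma> s) *\<^sub>R \<gamma> s) has_vector_derivative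
        (deriv_curve V x \<bullet> \<gamma> s) *\<^sub>R \<gamma> s) (at x)"
    proof -
      have "((\<lambda>y. (V y - V s) \<bullet> \<gamma> s) has_real_derivative deriv_curve V x \<bullet> \<gamma> s) (at x)"
        unfolding has_real_derivative_iff_has_vector_derivative
        using bounded_linear.has_vector_derivative[OF bounded_linear_inner_left
            has_vector_derivative_diff[OF has_vector_derivative(2)[OF sx(2)] has_vector_derivative_const]]
        by simp
      then show ?thesis by (auto intro!: derivative_eq_intros)
    qed
    then have "(V has_vector_derivative (deriv_curve V x \<bullet> \<gamma> s) *\<^sub>R \<gamma> s) (at x)"
      by (rule has_vector_derivative_transform_within_open[of _ _ _ "{s<..<s'}"])
         (use x on_line in auto)
    then have "deriv_curve V x = (deriv_curve V x \<bullet> \<gamma> s) *\<^sub>R \<gamma> s" by (rule vector_derivative_at)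
    moreover have "\<gamma> s = \<gamma> x \<or> \<gamma> s = - \<gamma> x"
      using line_eq_imp_direction[OF unit[OF sx(2)] unit[OF sI(1)]] sx(1) by (simp add: line_def)
    ultimately have "deriv_curve V x = 0" using base_orthogonal[OF sx(2)] by auto
    then show False using b_nonzero[OF sx(2)] by (simp add: b_def herm_linear_simps)
  qed
  show ?thesis
  proof (rule that[OF I'])
    fix s s' assume "s \<in> I'" "s' \<in> I'" "line s = line s'"
    then show "s = s'" using less[of s s'] less[of s' s] by (cases s s' rule: linorder_cases) auto
  qed
qed

end

text \<open>Every point \<open>X(s, t)\<close> of a complete leaf has a patch of its own. In the coordinates of that patch the
  given ruled map is continuous and injective, hence open by invariance of domain. It is also
  immersed: if \<open>X\<^sub>s\<close> vanished at \<open>(s, t)\<close>, then the number \<open>\<sigma> x\<close> of the leaf through \<open>X(x, t)\<close> in the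
  new patch would be stationary at \<open>x = s\<close>, and with it the direction of that leaf, so that
  \<open>\<gamma>' = 0\<close> and therefore \<open>V' = X\<^sub>s = 0\<close> at \<open>s\<close>, which contradicts the immersion at \<open>t = 0\<close>.\<close>

lemma ruled_patch_complete:
  assumes patch: "ruled_patch S F I T \<gamma> V" and ruling: "ruling S F" and complete: "complete_ruling F"
    and s0: "s0 \<in> I"
  obtains I' where "ruled_patch S F I' UNIV \<gamma> V" "s0 \<in> I'" "I' \<subseteq> I"
proof -
  interpret ruled_patch S F I T \<gamma> V by fact
  obtain I' where I': "open_interval I'" "s0 \<in> I'" "I' \<subseteq> I"
    and distinct: "\<And>s s'. s \<in> I' \<Longrightarrow> s' \<in> I' \<Longrightarrow> line s = line s' \<Longrightarrow> s = s'"
    using lines_distinct_locally[OF ruling complete s0] by metis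
  have open_I': "open I'" using I'(1) by (simp add: open_interval_def)
  let ?X = "\<lambda>(s, t). V s + t *\<^sub>R \<gamma> s"
  let ?U = "I' \<times> (UNIV :: real set)"
  have U: "open ?U" using open_I' by (simp add: open_Times)
  have leaves: "line s \<in> F" "line s \<subseteq> S" if "s \<in> I" for s
    using line_in_complete_ruling[OF complete that] ruling by (auto simp: ruling_def)
  note leaf_unique = leaf_unique[OF ruling]
  have X_line: "?X (s, t) \<in> line s" for s t by (auto simp: line_def)
  have X_S: "?X u \<in> S" if "u \<in> ?U" for u
  proof -
    have "fst u \<in> I" using that I'(3) by auto
    then show ?thesis using leaves(2) X_line[of "fst u" "snd u"] by (auto simp: case_prod_unfold)
  qed
  have smooth_X: "smooth_on ?U ?X"
    using smooth_on_subset[OF _ I'(3)] smooth by (intro smooth_on_ruled_map open_I') auto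
  then have cont_X: "continuous_on ?U ?X" by (rule smooth_on_imp_continuous_on)
  have inj_X: "inj_on ?X ?U"
  proof (rule inj_onI)
    fix u u' assume u: "u \<in> ?U" "u' \<in> ?U" "?X u = ?X u'"
    obtain s t s' t' where st: "u = (s, t)" "u' = (s', t')" by (cases u; cases u')
    then have mem: "s \<in> I'" "s' \<in> I'" and eq: "?X (s, t) = ?X (s', t')" using u by auto
    then have mem': "s \<in> I" "s' \<in> I" using I'(3) by auto
    have "line s = line s'"
      by (rule leaf_unique[OF leaves(1)[OF mem'(1)] leaves(1)[OF mem'(2)] X_line[of s t]])
         (unfold eq, rule X_line)
    then have "s = s'" using distinct mem by blast
    moreover have "t = t'" using eq \<open>s = s'\<close> unit[OF mem'(1)] by auto
    ultimately show "u = u'" using st by simp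
  qed
  have at_point: "(\<exists>W. open W \<and> (s, t) \<in> W \<and> W \<subseteq> ?U \<and>
        (\<forall>W'. open W' \<longrightarrow> W' \<subseteq> W \<longrightarrow> openin (top_of_set S) (?X ` W'))) \<and> t *\<^sub>R a s + b s \<noteq> 0"
    if s: "s \<in> I'" for s t
  proof -
    have sI: "s \<in> I" using s I'(3) by auto
    have "?X (s, t) \<in> S" by (rule X_S) (use s in simp)
    then obtain I2 T2 \<gamma>2 V2 s2
      where p2: "ruled_patch S F I2 T2 \<gamma>2 V2" "s2 \<in> I2" "V2 s2 = ?X (s, t)"
      by (rule ruled_patch_at[OF lagrangian ruling])
    interpret two: ruled_patch S F I2 T2 \<gamma>2 V2 by fact
    let ?Y = "\<lambda>(s, t). V2 s + t *\<^sub>R \<gamma>2 s"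
    let ?P = "?Y ` (I2 \<times> T2)"
    obtain \<psi> where \<psi>: "homeomorphism (I2 \<times> T2) ?P ?Y \<psi>"
      using two.parametrization unfolding local_parametrization_def by blast
    have "openin (top_of_set S) ?P"
      using two.parametrization by (simp add: local_parametrization_def)
    then obtain G where G: "open G" "?P = S \<inter> G" by (auto simp: openin_open)
    define W where "W = ?U \<inter> ?X -` G"
    have W: "open W" "W \<subseteq> ?U" unfolding W_def using continuous_open_preimage[OF cont_X U G(1)] by auto
    have X_P: "?X u \<in> ?P" if "u \<in> W" for u using X_S[of u] that G(2) by (auto simp: W_def)
    have base_P: "?X (s, t) = ?Y (s2, 0)" using p2(3) by simp
    then have "?X (s, t) \<in> ?P"
      using p2(2) two.interval(3) by (intro image_eqI[of _ _ "(s2, 0)"]) auto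
    then have stW: "(s, t) \<in> W" using s G(2) by (auto simp: W_def)
    \<comment> \<open>\<open>w\<close> is the given ruled map in the coordinates of the patch around \<open>X(s, t)\<close>.\<close>
    define w where "w u = \<psi> (?X u)" for u
    have w_mem: "w u \<in> I2 \<times> T2" "?Y (w u) = ?X u" if "u \<in> W" for u
      unfolding w_def using homeomorphism_image2[OF \<psi>] X_P[OF that]
      by blast (rule homeomorphism_apply2[OF \<psi> X_P[OF that]])
    have cont_w: "continuous_on W w"
      unfolding w_def
      by (rule continuous_on_compose2[OF homeomorphism_cont2[OF \<psi>] continuous_on_subset[OF cont_X W(2)]])
         (use X_P in blast)
    have inj_w: "inj_on w W"
    proof (rule inj_onI)
      fix u u' assume u: "u \<in> W" "u' \<in> W" "w u = w u'"
      have "?X u = ?X u'" unfolding w_mem(2)[OF u(1), symmetric] w_mem(2)[OF u(2), symmetric] u(3) ..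
      then show "u = u'" by (rule inj_onD[OF inj_X]) (use u W(2) in blast)+
    qed
    have "openin (top_of_set S) (?X ` W')" if W': "open W'" "W' \<subseteq> W" for W'
    proof -
      have "open (w ` W')"
        by (rule invariance_of_domain[OF continuous_on_subset[OF cont_w W'(2)] W'(1)
              inj_on_subset[OF inj_w W'(2)]])
      moreover have "w ` W' \<subseteq> I2 \<times> T2" using w_mem(1) W'(2) by blast
      ultimately have "openin (top_of_set S) (?Y ` (w ` W'))"
        by (rule local_parametrization_open_map[OF two.parametrization])
      moreover have "?Y ` (w ` W') = ?X ` W'"
        unfolding image_image using w_mem(2) W'(2) by (intro image_cong) auto
      ultimately show ?thesis by simp
    qed
    moreover have "t *\<^sub>R a s + b s \<noteq> 0"
    proof
      assume zero: "t *\<^sub>R a s + b s = 0"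
      define c where "c x = ?X (x, t)" for x
      have "(c has_vector_derivative (deriv_curve V s + t *\<^sub>R deriv_curve \<gamma> s)) (at s)"
        unfolding c_def
        by (auto intro!: derivative_eq_intros has_vector_derivative[OF sI])
      moreover have "deriv_curve V s + t *\<^sub>R deriv_curve \<gamma> s = 0"
        using zero by (simp add: deriv_ruled_map[OF sI])
      ultimately have c': "(c has_vector_derivative 0) (at s)" by simp
      define \<sigma> where "\<sigma> x = fst (w (x, t))" for x
      have w_base: "w (s, t) = (s2, 0)"
        unfolding w_def base_P using homeomorphism_apply1[OF \<psi>, of "(s2, 0)"] p2(2) two.interval(3) by auto
      have "isCont (\<lambda>x. (x, t)) s" by (intro continuous_intros)
      then have "((\<lambda>x. (x, t)) \<longlongrightarrow> (s, t)) (at s)" by (simp add: isCont_def)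
      then have near_W: "\<forall>\<^sub>F x in at s. (x, t) \<in> W"
        using topological_tendstoD[OF _ W(1) stW] by blast
      have lim_w: "((\<lambda>x. w (x, t)) \<longlongrightarrow> (s2, 0)) (at s)"
      proof -
        have "isCont w (s, t)" using cont_w W(1) stW continuous_on_eq_continuous_at by blast
        then show ?thesis
          using isCont_tendsto_compose[OF _ \<open>((\<lambda>x. (x, t)) \<longlongrightarrow> (s, t)) (at s)\<close>] w_base by metis
      qed
      obtain m where m: "m > 0" "\<forall>\<^sub>F v in nhds (s2, 0). m * norm (v - (s2, 0)) \<le> norm (?Y v - ?Y (s2, 0))"
        using local_parametrization_bounded_below[OF two.parametrization, of "(s2, 0)"] p2(2)
          two.interval(3) by auto
      have "\<forall>\<^sub>F x in at s. norm (\<sigma> x - \<sigma> s) \<le> inverse m * norm (c x - c s)"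
        using near_W eventually_compose_filterlim[OF m(2) lim_w]
      proof eventually_elim
        case (elim x)
        have "norm (\<sigma> x - \<sigma> s) \<le> norm (w (x, t) - (s2, 0))"
          unfolding \<sigma>_def
          using norm_fst_le[of "fst (w (x, t)) - s2" "snd (w (x, t))"]
          by (cases "w (x, t)") (simp add: w_base)
        also have "\<dots> \<le> inverse m * norm (c x - c s)"
          using elim(2) m(1) unfolding w_mem(2)[OF elim(1)] base_P[symmetric] c_def
          by (simp add: field_simps)
        finally show ?case .
      qed
      then have \<sigma>': "(\<sigma> has_vector_derivative 0) (at s)"
        by (rule has_vector_derivative_zero_dominated[OF c'])
      have \<sigma>s: "\<sigma> s = s2" by (simp add: \<sigma>_def w_base)
      have g2': "((\<lambda>x. \<gamma>2 (\<sigma> x)) has_vector_derivative 0) (at s)"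
        using has_derivative_compose[OF
            \<sigma>'[unfolded has_vector_derivative_def]
            two.has_vector_derivative(1)[OF p2(2), unfolded has_vector_derivative_def, folded \<sigma>s]]
        by (simp add: has_vector_derivative_def)
      have dir: "\<gamma> x = \<gamma>2 (\<sigma> x) \<or> \<gamma> x = - \<gamma>2 (\<sigma> x)" if x: "(x, t) \<in> W" for x
      proof -
        have mem: "x \<in> I" "\<sigma> x \<in> I2"
          using x W(2) I'(3) w_mem(1)[OF x] by (auto simp: \<sigma>_def mem_Times_iff)
        have "?X (x, t) \<in> two.line (\<sigma> x)"
        proof -
          have "?X (x, t) = V2 (\<sigma> x) + snd (w (x, t)) *\<^sub>R \<gamma>2 (\<sigma> x)"
            using w_mem(2)[OF x] by (simp add: \<sigma>_def case_prod_unfold)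
          then show ?thesis unfolding two.line_def by blast
        qed
        then have "line x = two.line (\<sigma> x)"
          using leaf_unique[OF leaves(1)[OF mem(1)] two.line_in_complete_ruling[OF complete mem(2)]]
            X_line by blast
        then show ?thesis
          using line_eq_imp_direction[OF two.unit[OF mem(2)] unit[OF mem(1)]]
          unfolding line_def two.line_def by metis
      qed
      \<comment> \<open>The sign by which the directions of the two patches differ; it is continuous, so it is
        constant near \<open>s\<close>.\<close>
      define n where "n x = \<gamma> x \<bullet> \<gamma>2 (\<sigma> x)" for x
      have n: "\<gamma> x = n x *\<^sub>R \<gamma>2 (\<sigma> x)" "\<bar>n x\<bar> = 1" if x: "(x, t) \<in> W" for x
      proof -
        have "\<sigma> x \<in> I2" using w_mem(1)[OF x] by (auto simp: \<sigma>_def mem_Times_iff)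
        then have "\<gamma>2 (\<sigma> x) \<bullet> \<gamma>2 (\<sigma> x) = 1" using two.unit by (simp add: norm_eq_1)
        then show "\<gamma> x = n x *\<^sub>R \<gamma>2 (\<sigma> x)" "\<bar>n x\<bar> = 1" using dir[OF x] by (auto simp: n_def)
      qed
      have "isCont \<gamma> s" "isCont (\<lambda>x. \<gamma>2 (\<sigma> x)) s"
        using has_vector_derivative(1)[OF sI] g2' has_vector_derivative_continuous by blast+
      then have "isCont n s" unfolding n_def by (intro continuous_intros)
      then have "\<forall>\<^sub>F x in at s. dist (n x) (n s) < 1"
        unfolding isCont_def by (rule tendstoD) simp
      then have "\<forall>\<^sub>F x in at s. norm (\<gamma> x - \<gamma> s) \<le> 1 * norm (\<gamma>2 (\<sigma> x) - \<gamma>2 (\<sigma> s))"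
        using near_W
      proof eventually_elim
        case (elim x)
        have "n x = n s" using elim(1) n(2)[OF elim(2)] n(2)[OF stW] by (auto simp: dist_real_def)
        then have "\<gamma> x - \<gamma> s = n s *\<^sub>R (\<gamma>2 (\<sigma> x) - \<gamma>2 (\<sigma> s))"
          using n(1)[OF elim(2)] n(1)[OF stW] by (simp add: algebra_simps)
        then show ?case using n(2)[OF stW] by simp
      qed
      then have "(\<gamma> has_vector_derivative 0) (at s)"
        by (rule has_vector_derivative_zero_dominated[OF g2'])
      then have "a s = 0" by (simp add: a_def vector_derivative_at herm_linear_simps)
      then show False using zero b_nonzero[OF sI] by simp
    qed
    ultimately show ?thesis using W stW by blast
  qed
  have open_map: "openin (top_of_set S) (?X ` O')" if O': "open O'" "O' \<subseteq> ?U" for O'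
  proof (subst openin_subopen, intro ballI)
    fix x assume "x \<in> ?X ` O'"
    then obtain s t where st: "(s, t) \<in> O'" "x = ?X (s, t)" by auto
    then have "s \<in> I'" using O'(2) by auto
    from at_point[OF this, of t] obtain W where W: "open W" "(s, t) \<in> W"
      "\<And>W'. open W' \<Longrightarrow> W' \<subseteq> W \<Longrightarrow> openin (top_of_set S) (?X ` W')"
      by blast
    show "\<exists>T. openin (top_of_set S) T \<and> x \<in> T \<and> T \<subseteq> ?X ` O'"
    proof (intro exI conjI)
      show "openin (top_of_set S) (?X ` (W \<inter> O'))" using W(1) O'(1) by (intro W(3) open_Int) auto
      show "x \<in> ?X ` (W \<inter> O')" using st W(2) by blast
    qed auto
  qed
  have "local_parametrization S ?U ?X"
    unfolding local_parametrization_def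
  proof (intro conjI ballI U smooth_X open_map order_refl)
    fix u assume u: "u \<in> ?U"
    obtain s t where st: "u = (s, t)" "s \<in> I'" using u by auto
    then have sI: "s \<in> I" using I'(3) by auto
    have D: "frechet_derivative ?X (at u) = (\<lambda>(x, y). x *\<^sub>R (deriv_curve V s + t *\<^sub>R deriv_curve \<gamma> s) + y *\<^sub>R \<gamma> s)"
      using frechet_derivative_parametrization[OF sI] st(1) by simp
    have "linear (frechet_derivative ?X (at u))"
      unfolding D by (rule has_derivative_linear[OF parametrization_has_derivative[OF sI sI]])
    then show "inj (frechet_derivative ?X (at u))"
    proof (subst linear_injective_0, assumption, intro allI impI)
      fix h assume h: "frechet_derivative ?X (at u) h = 0"
      obtain x y where xy: "h = (x, y)" by (cases h)
      have "x *\<^sub>R ((t *\<^sub>R a s + b s) *s e s) + y *\<^sub>R \<gamma> s = 0"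
        using h unfolding D xy by (simp add: deriv_ruled_map[OF sI])
      then have 0: "herm (x *\<^sub>R ((t *\<^sub>R a s + b s) *s e s) + y *\<^sub>R \<gamma> s) z = 0" for z
        by (simp add: herm_linear_simps)
      have hh: "herm (\<gamma> s) (\<gamma> s) = 1" using unit[OF sI] by (simp add: herm_self)
      have "y = 0" using 0[of "\<gamma> s"] hh by (simp add: herm_linear_simps e_def herm_perp)
      moreover have "x = 0"
        using 0[of "e s"] hh at_point[OF st(2), of t] by (simp add: herm_linear_simps e_def herm_perp)
      ultimately show "h = 0" using xy by (simp add: zero_prod_def)
    qed
  next
    obtain g where "homeomorphism ?U (?X ` ?U) ?X g"
    proof (rule homeomorphism_injective_open_map[OF cont_X refl inj_X])
      fix O' assume "openin (top_of_set ?U) O'"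
      then have O': "open O'" "O' \<subseteq> ?U" unfolding openin_open_eq[OF U] by simp_all
      show "openin (top_of_set (?X ` ?U)) (?X ` O')"
        by (rule openin_subset_trans[OF open_map[OF O'] image_mono[OF O'(2)]]) (use X_S in blast)
    qed
    then show "\<exists>\<psi>. homeomorphism ?U (?X ` ?U) ?X \<psi>" by blast
  qed
  note param = this
  have "ruled_patch S F I' UNIV \<gamma> V"
  proof
    show "\<exists>l\<in>F. \<forall>t\<in>UNIV. V s + t *\<^sub>R \<gamma> s \<in> l" if "s \<in> I'" for s
      by (rule bexI[OF _ leaves(1)]) (use that I'(3) in \<open>auto simp: line_def\<close>)
    show "smooth_on I' \<gamma>" "smooth_on I' V" using smooth smooth_on_subset I'(3) by blast+
    show "norm (\<gamma> s) = 1" "deriv_curve V s \<bullet> \<gamma> s = 0" if "s \<in> I'" for s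
      using unit base_orthogonal that I'(3) by auto
    show "open_interval (UNIV :: real set)" by (simp add: open_interval_def is_interval_univ)
  qed (use lagrangian I'(1) param in auto)
  then show ?thesis using I'(2,3) by (rule that)
qed

section \<open>The two local models\<close>

context ruled_patch begin

lemma smooth_frame: "smooth_on I e" "smooth_on I a" "smooth_on I b"
proof -
  show e: "smooth_on I e"
    unfolding e_def by (rule smooth_on_linear_image[OF open_I bounded_linear_perp smooth(1)])
  show "smooth_on I a" "smooth_on I b"
    unfolding a_def b_def
    by (intro smooth_on_bilinear[OF bounded_bilinear_herm open_I] smooth_on_deriv_curve open_I smooth e)+
qed

lemma parametrization_cong:
  assumes "open_interval I'" "I' \<subseteq> I" "\<And>s t. s \<in> I' \<Longrightarrow> t \<in> T \<Longrightarrow> X (s, t) = V s + t *\<^sub>R \<gamma> s"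
  shows "local_parametrization S (I' \<times> T) X"
proof -
  have o: "open (I' \<times> T)" using assms(1) open_T by (simp add: open_interval_def open_Times)
  have p: "local_parametrization S (I' \<times> T) (\<lambda>(s, t). V s + t *\<^sub>R \<gamma> s)"
    by (rule local_parametrization_restrict[OF parametrization o]) (use assms(2) in auto)
  show ?thesis
  proof (rule local_parametrization_reparametrize[OF p, of "\<lambda>u. u"])
    show "smooth_on (I' \<times> T) (\<lambda>u. u)" by (rule smooth_on_bounded_linear[OF o bounded_linear_ident])
    show "smooth_on (I' \<times> T) X"
      by (rule smooth_on_cong[OF o, of "\<lambda>(s, t). V s + t *\<^sub>R \<gamma> s"])
         (use p assms(3) in \<open>auto simp: local_parametrization_def\<close>)
  qed (use o assms(3) in auto)
qed

text \<open>Where the direction moves, the base curve and the direction have parallel velocities in the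
  complex line spanned by \<open>e\<close>, and \<open>\<alpha>\<close> is their quotient.\<close>

lemma legendrian_ruled_near_if_direction_moves:
  assumes s0: "s0 \<in> I" "a s0 \<noteq> 0" and complete: "complete_ruling F \<Longrightarrow> T = UNIV"
  shows "legendrian_ruled_near S F (V s0)"
proof -
  have "open (I \<inter> a -` (- {0}))"
    by (rule continuous_open_preimage[OF smooth_on_imp_continuous_on[OF smooth_frame(2)] open_I]) auto
  moreover have "s0 \<in> I \<inter> a -` (- {0})" using s0 by simp
  ultimately obtain I' where int_I': "open_interval I'" "s0 \<in> I'" "I' \<subseteq> I \<inter> a -` (- {0})"
    using open_interval_around by metis
  then have I': "open_interval I'" "s0 \<in> I'" "I' \<subseteq> I" and nz: "\<And>s. s \<in> I' \<Longrightarrow> a s \<noteq> 0" by auto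
  have open_I': "open I'" using I'(1) by (simp add: open_interval_def)
  define \<alpha> where "\<alpha> s = b s * inverse (a s)" for s
  have smooth_\<alpha>: "smooth_on I' \<alpha>"
    unfolding \<alpha>_def using smooth_on_subset[OF _ I'(3)] smooth_frame nz
    by (intro smooth_on_bilinear[OF bounded_bilinear_mult] smooth_on_inverse open_I') auto
  have V': "(V has_vector_derivative \<alpha> s *s deriv_curve \<gamma> s) (at s)" if s: "s \<in> I'" for s
  proof -
    have sI: "s \<in> I" using s I'(3) by auto
    have "\<alpha> s *s deriv_curve \<gamma> s = deriv_curve V s"
      unfolding deriv_direction[OF sI] using nz[OF s] by (simp add: \<alpha>_def vector_smult_assoc)
    then show ?thesis using has_vector_derivative(2)[OF sI] by simp
  qed
  have integral: "(LBINT u=s0..s. \<alpha> u *s deriv_curve \<gamma> u) = V s - V s0" if s: "s \<in> I'" for s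
  proof (rule interval_integral_FTC_finite)
    have sub: "{min s0 s..max s0 s} \<subseteq> I'"
      by (rule is_interval_between[OF _ I'(2) s]) (use I'(1) in \<open>simp add: open_interval_def\<close>)
    have "smooth_on I' (\<lambda>u. \<alpha> u *s deriv_curve \<gamma> u)"
      by (intro smooth_on_bilinear[OF bounded_bilinear_scalar_mult] smooth_\<alpha> open_I'
          smooth_on_deriv_curve smooth_on_subset[OF smooth(1) I'(3)])
    then show "continuous_on {min s0 s..max s0 s} (\<lambda>u. \<alpha> u *s deriv_curve \<gamma> u)"
      using continuous_on_subset[OF smooth_on_imp_continuous_on sub] by blast
    show "(V has_vector_derivative \<alpha> x *s deriv_curve \<gamma> x) (at x within {min s0 s..max s0 s})"
      if "min s0 s \<le> x" "x \<le> max s0 s" for x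
      by (rule has_vector_derivative_at_within[OF V']) (use sub that in auto)
  qed
  define X where "X u = V s0 + legendrian_ruled_map \<gamma> \<alpha> s0 u" for u
  have X: "X (s, t) = V s + t *\<^sub>R \<gamma> s" if "s \<in> I'" for s t
    using integral[OF that] by (simp add: X_def legendrian_ruled_map_def)
  have "legendrian_curve I' \<gamma>"
    unfolding legendrian_curve_def
    using smooth_on_subset[OF smooth(1) I'(3)] unit herm_deriv_direction(1) I'(3)
    by (auto simp: inner_J_eq_Im_herm subset_iff)
  moreover have "local_parametrization S (I' \<times> T) X"
    by (rule parametrization_cong[OF I'(1,3)]) (rule X)
  moreover have "V s0 \<in> X ` (I' \<times> T)"
    using I'(2) interval(3) X[of s0 0] by (intro image_eqI[of _ _ "(s0, 0)"]) auto
  ultimately show ?thesis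
    unfolding legendrian_ruled_near_def using I' interval(2) complete smooth_\<alpha>
    by (intro exI[of _ I'] exI[of _ T] exI[of _ s0] exI[of _ \<gamma>] exI[of _ \<alpha>] exI[of _ "V s0"])
       (simp add: X_def[abs_def])
qed

lemma constant_direction:
  assumes stationary: "\<And>s. s \<in> I \<Longrightarrow> a s = 0" and s: "s0 \<in> I" "s \<in> I"
  shows "\<gamma> s = \<gamma> s0" "e s = e s0" "herm (V s) (\<gamma> s0) = herm (V s0) (\<gamma> s0)"
proof -
  have convex: "convex I" using interval(1) by (simp add: open_interval_def is_interval_convex)
  have const: "\<gamma> x = \<gamma> s0" if x: "x \<in> I" for x
  proof -
    have "(\<gamma> has_vector_derivative 0) (at x within I)" if "x \<in> I" for x
      using has_vector_derivative(1)[OF that] deriv_direction(1)[OF that] stationary[OF that]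
      by (simp add: has_vector_derivative_at_within)
    then obtain c where "\<And>x. x \<in> I \<Longrightarrow> \<gamma> x = c"
      using has_vector_derivative_zero_constant[OF convex, of \<gamma>] by blast
    then show ?thesis using x s(1) by simp
  qed
  then show "\<gamma> s = \<gamma> s0" "e s = e s0" using s(2) by (simp_all add: e_def)
  have "((\<lambda>x. herm (V x) (\<gamma> s0)) has_vector_derivative 0) (at x within I)" if x: "x \<in> I" for x
  proof -
    have "((\<lambda>x. herm (V x) (\<gamma> s0)) has_vector_derivative herm (deriv_curve V x) (\<gamma> s0)) (at x)"
      by (rule bounded_linear.has_vector_derivative[OF
            bounded_bilinear.bounded_linear_left[OF bounded_bilinear_herm] has_vector_derivative(2)[OF x]])
    then show ?thesis using herm_deriv_direction(2)[OF x] const[OF x]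
      by (simp add: has_vector_derivative_at_within)
  qed
  then obtain c where "\<And>x. x \<in> I \<Longrightarrow> herm (V x) (\<gamma> s0) = c"
    using has_vector_derivative_zero_constant[OF convex, of "\<lambda>x. herm (V x) (\<gamma> s0)"] by blast
  then show "herm (V s) (\<gamma> s0) = herm (V s0) (\<gamma> s0)" using s by simp
qed

text \<open>The second factor of the product is the component of the base curve that is Hermitian
  orthogonal to the constant direction.\<close>

lemma cartesian_near_if_direction_constant:
  assumes stationary: "\<And>s. s \<in> I \<Longrightarrow> a s = 0" and s0: "s0 \<in> I"
    and complete: "complete_ruling F \<Longrightarrow> T = UNIV"
  shows "cartesian_near S F (V s0) I (\<lambda>s. herm (V s) (e s) *s e s0)"
proof -
  define g where "g s = herm (V s) (e s) *s e s0" for s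
  define \<gamma>0 where "\<gamma>0 = \<gamma> s0"
  define e0 where "e0 = e s0"
  define c0 where "c0 = herm (V s0) \<gamma>0"
  have const: "\<gamma> s = \<gamma> s0" "e s = e s0" "herm (V s) (\<gamma> s0) = herm (V s0) (\<gamma> s0)" if "s \<in> I" for s
    using constant_direction[OF _ s0 that] stationary by blast+
  have n0: "norm \<gamma>0 = 1" "norm e0 = 1" "herm \<gamma>0 \<gamma>0 = 1" "herm \<gamma>0 e0 = 0" "herm e0 \<gamma>0 = 0"
    using unit[OF s0] by (simp_all add: \<gamma>0_def e0_def e_def herm_perp herm_self)
  have V: "V s = c0 *s \<gamma>0 + g s" if s: "s \<in> I" for s
    using unitary_decomposition[OF n0(1), of "V s"] const[OF s]
    by (simp add: g_def c0_def \<gamma>0_def e_def)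
  have "smooth_on I (\<lambda>s. V s - c0 *s \<gamma>0)"
    by (intro smooth_on_diff open_I smooth smooth_on_const)
  then have smooth_g: "smooth_on I g"
    by (rule smooth_on_cong[OF open_I, rotated]) (simp add: V)
  have g': "deriv_curve g s \<noteq> 0" if s: "s \<in> I" for s
  proof -
    have "((\<lambda>s. V s - c0 *s \<gamma>0) has_vector_derivative deriv_curve V s - 0) (at s)"
      by (intro has_vector_derivative_diff has_vector_derivative[OF s] has_vector_derivative_const)
    then have "(g has_vector_derivative deriv_curve V s) (at s)"
      using has_vector_derivative_transform_within_open[OF _ open_I s, of "\<lambda>s. V s - c0 *s \<gamma>0" _ g] V
      by simp
    then have "deriv_curve g s = deriv_curve V s" by (rule vector_derivative_at)
    then show ?thesis using b_nonzero[OF s] by (auto simp: b_def herm_linear_simps)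
  qed
  let ?X = "\<lambda>(s, t). V s + t *\<^sub>R \<gamma> s"
  define P where "P = ?X ` (I \<times> T)"
  obtain \<psi> where \<psi>: "homeomorphism (I \<times> T) P ?X \<psi>"
    using parametrization unfolding local_parametrization_def P_def by blast
  have P_S: "openin (top_of_set S) P"
    using parametrization by (simp add: local_parametrization_def P_def)
  have planar: "planar_curve (range (\<lambda>c. c *s e0)) I g"
    unfolding planar_curve_def
  proof (intro conjI interval(1) smooth_g ballI g')
    show "g ` I \<subseteq> range (\<lambda>c. c *s e0)" by (auto simp: g_def e0_def)
    have g_eq: "c0 *s \<gamma>0 + g s = ?X (s, 0)" if "s \<in> I" for s using V[OF that] by simp
    have in_P: "c0 *s \<gamma>0 + g s \<in> P" if "s \<in> I" for s
      unfolding g_eq[OF that] P_def using that interval(3) by blast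
    have inv: "fst (\<psi> (c0 *s \<gamma>0 + g s)) = s" if "s \<in> I" for s
      unfolding g_eq[OF that] using homeomorphism_apply1[OF \<psi>, of "(s, 0)"] that interval(3) by simp
    have "homeomorphism I (g ` I) g (\<lambda>y. fst (\<psi> (c0 *s \<gamma>0 + y)))"
    proof (rule homeomorphismI)
      show "continuous_on I g" using smooth_g by (rule smooth_on_imp_continuous_on)
      show "continuous_on (g ` I) (\<lambda>y. fst (\<psi> (c0 *s \<gamma>0 + y)))"
        by (intro continuous_on_fst continuous_on_compose2[OF homeomorphism_cont2[OF \<psi>]]
            continuous_intros) (use in_P in auto)
    qed (use inv in auto)
    then show "\<exists>h. homeomorphism I (g ` I) g h" by blast
  qed
  define L where "L = range (\<lambda>t. c0 *s \<gamma>0 + t *\<^sub>R \<gamma>0)"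
  have L: "straight_line L" unfolding straight_line_iff L_def using n0(1) by blast
  have L_P1: "L \<subseteq> range (\<lambda>c. c *s \<gamma>0)"
  proof
    fix x assume "x \<in> L"
    then obtain t where "x = c0 *s \<gamma>0 + t *\<^sub>R \<gamma>0" unfolding L_def by blast
    then have "x = (c0 + of_real t) *s \<gamma>0" by (simp add: scaleR_eq_scalar_mult vector_sadd_rdistrib)
    then show "x \<in> range (\<lambda>c. c *s \<gamma>0)" by blast
  qed
  have X_eq: "?X (s, t) = (c0 *s \<gamma>0 + t *\<^sub>R \<gamma>0) + g s" if "s \<in> I" for s t
    using V[OF that] const(1)[OF that] by (simp add: \<gamma>0_def)
  have product: "cartesian_product L (g ` I) = ?X ` (I \<times> UNIV)"
  proof (intro equalityI subsetI)
    fix z assume "z \<in> cartesian_product L (g ` I)"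
    then obtain t s where ts: "s \<in> I" "z = (c0 *s \<gamma>0 + t *\<^sub>R \<gamma>0) + g s"
      unfolding cartesian_product_def L_def by blast
    show "z \<in> ?X ` (I \<times> UNIV)"
      by (rule image_eqI[of _ _ "(s, t)"]) (use X_eq[OF ts(1), of t] ts in simp_all)
  next
    fix z assume "z \<in> ?X ` (I \<times> UNIV)"
    then obtain s t where st: "s \<in> I" "z = ?X (s, t)" by blast
    then have "z = (c0 *s \<gamma>0 + t *\<^sub>R \<gamma>0) + g s" using X_eq[OF st(1), of t] by simp
    then show "z \<in> cartesian_product L (g ` I)"
      unfolding cartesian_product_def L_def using \<open>s \<in> I\<close> by blast
  qed
  have height: "Re (herm (?X (s, t)) \<gamma>0) - Re c0 = t" if "s \<in> I" for s t
    unfolding X_eq[OF that] using n0 by (simp add: g_def e0_def[symmetric] herm_linear_simps)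
  have "P = cartesian_product L (g ` I) \<inter> (\<lambda>z. Re (herm z \<gamma>0) - Re c0) -` T"
  proof (intro equalityI subsetI)
    fix z assume "z \<in> P"
    then obtain s t where st: "s \<in> I" "t \<in> T" "z = ?X (s, t)" unfolding P_def by blast
    have "z \<in> ?X ` (I \<times> UNIV)" using st(1) unfolding st(3) by blast
    moreover have "Re (herm z \<gamma>0) - Re c0 \<in> T" using st(2) unfolding st(3) height[OF st(1)] .
    ultimately show "z \<in> cartesian_product L (g ` I) \<inter> (\<lambda>z. Re (herm z \<gamma>0) - Re c0) -` T"
      unfolding product by blast
  next
    fix z assume z: "z \<in> cartesian_product L (g ` I) \<inter> (\<lambda>z. Re (herm z \<gamma>0) - Re c0) -` T"
    then obtain s t where st: "s \<in> I" "z = ?X (s, t)" unfolding product by blast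
    then have "t \<in> T" using z height[OF st(1), of t] by auto
    then show "z \<in> P" unfolding P_def using st by blast
  qed
  moreover have "open ((\<lambda>z. Re (herm z \<gamma>0) - Re c0) -` T)"
  proof (rule open_vimage[OF open_T])
    have "continuous_on UNIV (\<lambda>z. herm z \<gamma>0)"
      using linear_continuous_on[OF bounded_bilinear.bounded_linear_left[OF bounded_bilinear_herm]] .
    then show "continuous_on UNIV (\<lambda>z. Re (herm z \<gamma>0) - Re c0)" by (intro continuous_intros)
  qed
  ultimately have P_product: "openin (top_of_set (cartesian_product L (g ` I))) P"
    by (auto simp: openin_open)
  have "complex_line (range (\<lambda>c. c *s \<gamma>0))" "complex_line (range (\<lambda>c. c *s e0))"
    unfolding complex_line_def using n0 by (metis norm_zero zero_neq_one)+
  moreover have "\<forall>v\<in>range (\<lambda>c. c *s \<gamma>0). \<forall>w\<in>range (\<lambda>c. c *s e0). v \<bullet> w = 0"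
    using n0 by (auto simp: inner_eq_Re_herm herm_linear_simps)
  moreover have "V s0 \<in> P"
    unfolding P_def using s0 interval(3) by (intro image_eqI[of _ _ "(s0, 0)"]) auto
  moreover have "complete_ruling F \<longrightarrow> P = cartesian_product L (g ` I)"
    using complete product by (simp add: P_def)
  ultimately have "cartesian_near S F (V s0) I g"
    unfolding cartesian_near_def using L L_P1 planar P_S P_product by blast
  then show ?thesis by (simp add: g_def[abs_def])
qed

end

section \<open>Generic points\<close>

lemma frechet_derivative_leaf_direction:
  assumes "ruling S F" and chart: "foliated_chart S F I T \<phi>" and st: "s \<in> I" "t \<in> T"
    and \<gamma>: "open I'" "s \<in> I'" "\<And>x. x \<in> I' \<Longrightarrow> \<gamma> x = leaf_direction \<phi> (x, t)"
    "(\<gamma> has_vector_derivative \<gamma>') (at s)"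
  shows "frechet_derivative (leaf_direction \<phi>) (at (s, t)) = (\<lambda>h. fst h *\<^sub>R \<gamma>')"
proof -
  have o: "open I" "open T" using chart by (auto simp: foliated_chart_def open_interval_def)
  have "((\<lambda>u. \<gamma> (fst u)) has_derivative (\<lambda>h. fst h *\<^sub>R \<gamma>')) (at (s, t))"
    using has_derivative_compose[OF has_derivative_fst[OF has_derivative_ident], of \<gamma> _ "(s, t)" UNIV]
      \<gamma>(4) by (simp add: has_vector_derivative_def)
  then have "(leaf_direction \<phi> has_derivative (\<lambda>h. fst h *\<^sub>R \<gamma>')) (at (s, t))"
  proof (rule has_derivative_transform_within_open)
    show "open ((I \<inter> I') \<times> T)" using o \<gamma>(1) by (intro open_Times open_Int)
    show "\<gamma> (fst u) = leaf_direction \<phi> u" if "u \<in> (I \<inter> I') \<times> T" for u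
      using that \<gamma>(3) foliated_chart_along_leaf(1)[OF assms(1) chart _ _ st(2)] by auto
  qed (use st \<gamma>(2) in auto)
  then show ?thesis using frechet_derivative_at by metis
qed

lemma adapted_ruled_patch:
  assumes "ruled_patch S F I T \<gamma> V" "ruling S F" "s0 \<in> I"
  obtains I' T' where "ruled_patch S F I' T' \<gamma> V" "s0 \<in> I'" "I' \<subseteq> I" "complete_ruling F \<Longrightarrow> T' = UNIV"
proof (cases "complete_ruling F")
  case True
  then show ?thesis using ruled_patch_complete[OF assms(1,2) True assms(3)] that by metis
qed (use assms that in blast)

text \<open>The direction \<open>\<gamma>\<close> of a patch is the leaf direction of the foliated chart from which the patch is
  obtained, so the derivative of the latter vanishes exactly where \<open>a\<close> does.\<close>

lemma generic_point_local_model: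
  assumes "lagrangian S" "ruling S F" "generic_point S F p"
  shows "(\<exists>I g. cartesian_near S F p I g) \<or> legendrian_ruled_near S F p"
proof (cases "stationary_ruling_at S F p")
  case False
  then obtain I0 T0 \<phi> u where chart: "foliated_chart S F I0 T0 \<phi>" and u: "u \<in> I0 \<times> T0" "\<phi> u = p"
    and D: "frechet_derivative (leaf_direction \<phi>) (at u) \<noteq> (\<lambda>h. 0)"
    unfolding stationary_ruling_at_def by blast
  obtain s0 t0 where st: "u = (s0, t0)" "s0 \<in> I0" "t0 \<in> T0" using u(1) by blast
  obtain I T \<gamma> V where patch: "ruled_patch S F I T \<gamma> V" "s0 \<in> I" "V s0 = p"
    and \<gamma>: "\<And>s. s \<in> I \<Longrightarrow> \<gamma> s = leaf_direction \<phi> (s, t0)"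
    using foliated_chart_imp_ruled_patch[OF assms(1,2) chart st(2,3)] u(2) st(1) by metis
  interpret ruled_patch S F I T \<gamma> V by fact
  have "a s0 \<noteq> 0"
  proof
    assume "a s0 = 0"
    then have "(\<gamma> has_vector_derivative 0) (at s0)"
      using has_vector_derivative(1)[OF patch(2)] deriv_direction(1)[OF patch(2)] by simp
    then show False
      using frechet_derivative_leaf_direction[OF assms(2) chart st(2,3) open_I patch(2) \<gamma>] D
      by (simp add: st(1))
  qed
  obtain I' T' where patch': "ruled_patch S F I' T' \<gamma> V" "s0 \<in> I'" "complete_ruling F \<Longrightarrow> T' = UNIV"
    using adapted_ruled_patch[OF patch(1) assms(2) patch(2)] by metis
  show ?thesis
    using ruled_patch.legendrian_ruled_near_if_direction_moves[OF patch'(1,2) \<open>a s0 \<noteq> 0\<close> patch'(3)]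
    by (simp add: patch(3))
next
  case True
  then obtain N where N: "openin (top_of_set S) N" "p \<in> N" "\<forall>q\<in>N. stationary_ruling_at S F q"
    and "p \<in> S" using assms(3) unfolding generic_point_def by blast
  obtain I0 T0 \<phi> u where chart: "foliated_chart S F I0 T0 \<phi>" and u: "u \<in> I0 \<times> T0" "\<phi> u = p"
    using assms(2) \<open>p \<in> S\<close> unfolding ruling_def by (metis imageE)
  obtain s0 t0 where st: "u = (s0, t0)" "s0 \<in> I0" "t0 \<in> T0" using u(1) by blast
  obtain I T \<gamma> V where patch: "ruled_patch S F I T \<gamma> V" "s0 \<in> I" "I \<subseteq> I0" "V s0 = p"
    and \<gamma>: "\<And>s. s \<in> I \<Longrightarrow> \<gamma> s = leaf_direction \<phi> (s, t0)"
    using foliated_chart_imp_ruled_patch[OF assms(1,2) chart st(2,3)] u(2) st(1) by metis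
  interpret ruled_patch S F I T \<gamma> V by fact
  have I0: "open I0" and T0: "open T0" and \<phi>: "local_parametrization S (I0 \<times> T0) \<phi>"
    using chart by (auto simp: foliated_chart_def open_interval_def)
  obtain G where G: "open G" "N = S \<inter> G" using N(1) by (auto simp: openin_open)
  have "continuous_on I0 (\<lambda>s. \<phi> (s, t0))"
    using \<phi> by (intro smooth_on_imp_continuous_on smooth_on_slice[OF I0 T0 st(3)])
      (simp add: local_parametrization_def)
  then have "open (I \<inter> (\<lambda>s. \<phi> (s, t0)) -` G)"
    by (intro continuous_open_preimage open_I G(1)) (rule continuous_on_subset[OF _ patch(3)])
  moreover have "s0 \<in> I \<inter> (\<lambda>s. \<phi> (s, t0)) -` G" using patch(2) N(2) G(2) u(2) st(1) by auto
  ultimately obtain I1 where I1: "open_interval I1" "s0 \<in> I1" "I1 \<subseteq> I \<inter> (\<lambda>s. \<phi> (s, t0)) -` G"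
    using open_interval_around by metis
  then have I1_I: "I1 \<subseteq> I" by blast
  have stationary: "a s = 0" if s: "s \<in> I1" for s
  proof -
    have sI: "s \<in> I" "s \<in> I0" using s I1(3) patch(3) by auto
    have "\<phi> (s, t0) \<in> N"
      using s I1(3) G(2) local_parametrization_subset[OF \<phi>] sI(2) st(3) by auto
    then have "frechet_derivative (leaf_direction \<phi>) (at (s, t0)) = (\<lambda>h. 0)"
      using N(3) chart sI(2) st(3) unfolding stationary_ruling_at_def by blast
    then have "(\<lambda>h. fst h *\<^sub>R deriv_curve \<gamma> s) = (\<lambda>h::real\<times>real. 0)"
      using frechet_derivative_leaf_direction[OF assms(2) chart sI(2) st(3) open_I sI(1) \<gamma>
          has_vector_derivative(1)[OF sI(1)]] by simp
    then have "fst (1::real, 0::real) *\<^sub>R deriv_curve \<gamma> s = 0" by meson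
    then show ?thesis by (simp add: a_def herm_linear_simps)
  qed
  obtain I' T' where patch': "ruled_patch S F I' T' \<gamma> V" "s0 \<in> I'" "I' \<subseteq> I1"
    "complete_ruling F \<Longrightarrow> T' = UNIV"
    using adapted_ruled_patch[OF ruled_patch_restrict[OF patch(1) I1(1) I1_I] assms(2) I1(2)] by metis
  show ?thesis
    using ruled_patch.cartesian_near_if_direction_constant[OF patch'(1) _ patch'(2,4)] stationary
      patch'(3) patch(4) by blast
qed

text \<open>A chart in which the direction moves at one point is a witness for all nearby points.\<close>

lemma openin_generic_points: "openin (top_of_set S) {p. generic_point S F p}"
proof (subst openin_subopen, intro ballI)
  fix p assume "p \<in> {p. generic_point S F p}"
  then have p: "generic_point S F p" by simp
  show "\<exists>N. openin (top_of_set S) N \<and> p \<in> N \<and> N \<subseteq> {p. generic_point S F p}"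
  proof (cases "stationary_ruling_at S F p")
    case True
    then obtain N where N: "openin (top_of_set S) N" "p \<in> N" "\<forall>q\<in>N. stationary_ruling_at S F q"
      using p unfolding generic_point_def by blast
    then have "N \<subseteq> {p. generic_point S F p}"
      using openin_imp_subset[OF N(1)] unfolding generic_point_def by blast
    then show ?thesis using N by blast
  next
    case False
    then obtain I0 T0 \<phi> u where chart: "foliated_chart S F I0 T0 \<phi>" and u: "u \<in> I0 \<times> T0" "\<phi> u = p"
      and D: "frechet_derivative (leaf_direction \<phi>) (at u) \<noteq> (\<lambda>h. 0)"
      unfolding stationary_ruling_at_def by blast
    obtain k where k: "frechet_derivative (leaf_direction \<phi>) (at u) k \<noteq> 0" using D by (meson ext)
    have \<phi>: "local_parametrization S (I0 \<times> T0) \<phi>" using chart by (simp add: foliated_chart_def)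
    then have o: "open (I0 \<times> T0)" by (simp add: local_parametrization_def)
    have "smooth_on (I0 \<times> T0) (\<lambda>u. frechet_derivative (leaf_direction \<phi>) (at u) k)"
      using smooth_on_leaf_direction[OF \<phi>] smooth_on_iff by blast
    then have "open ((I0 \<times> T0) \<inter> (\<lambda>u. frechet_derivative (leaf_direction \<phi>) (at u) k) -` (- {0}))"
      by (intro continuous_open_preimage smooth_on_imp_continuous_on o) auto
    then have "openin (top_of_set S)
        (\<phi> ` ((I0 \<times> T0) \<inter> (\<lambda>u. frechet_derivative (leaf_direction \<phi>) (at u) k) -` (- {0})))"
      (is "openin _ ?N") by (rule local_parametrization_open_map[OF \<phi>]) auto
    moreover have "p \<in> ?N" using u k by blast
    moreover have "?N \<subseteq> {p. generic_point S F p}"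
    proof
      fix q assume "q \<in> ?N"
      then obtain w where w: "w \<in> I0 \<times> T0" "\<phi> w = q"
        "frechet_derivative (leaf_direction \<phi>) (at w) k \<noteq> 0" by blast
      then have "\<not> stationary_ruling_at S F q"
        unfolding stationary_ruling_at_def using chart by metis
      then show "q \<in> {p. generic_point S F p}"
        using local_parametrization_subset[OF \<phi>] w(1,2) by (auto simp: generic_point_def)
    qed
    ultimately show ?thesis by blast
  qed
qed

lemma generic_points_dense: "S \<subseteq> closure {p. generic_point S F p}"
proof
  fix p assume p: "p \<in> S"
  show "p \<in> closure {p. generic_point S F p}"
    unfolding closure_iff_nhds_not_empty
  proof (intro allI impI)
    fix A G assume G: "G \<subseteq> A" "open G" "p \<in> G"
    show "{p. generic_point S F p} \<inter> A \<noteq> {}"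
    proof (cases "\<forall>q\<in>S \<inter> G. stationary_ruling_at S F q")
      case True
      have "openin (top_of_set S) (S \<inter> G)" using G(2) by (auto simp: openin_open)
      then have "generic_point S F p" unfolding generic_point_def using True p G(3) by blast
      then show ?thesis using G by blast
    next
      case False
      then obtain q where "q \<in> S" "q \<in> G" "\<not> stationary_ruling_at S F q" by blast
      then have "generic_point S F q" by (simp add: generic_point_def)
      then show ?thesis using G(1) \<open>q \<in> G\<close> by blast
    qed
  qed
qed

section \<open>The equations of self-similarity\<close>

lemma normal_component_inner:
  assumes W: "subspace W" and w: "\<And>v. v \<in> W \<Longrightarrow> v \<bullet> w = 0"
  shows "normal_component W x \<bullet> w = x \<bullet> w"
proof -
  have span: "span W = W" using W by (simp add: span_eq_iff)
  obtain y z where yz: "y \<in> W" "\<And>v. v \<in> W \<Longrightarrow> orthogonal z v" "x = y + z"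
    using orthogonal_subspace_decomp_exists[of W x] unfolding span by blast
  have "normal_component W x = z"
    unfolding normal_component_def
  proof (rule the_equality)
    show "x - z \<in> W \<and> (\<forall>v\<in>W. z \<bullet> v = 0)" using yz by (auto simp: orthogonal_def)
    fix n assume n: "x - n \<in> W \<and> (\<forall>v\<in>W. n \<bullet> v = 0)"
    have "z - n \<in> W" using subspace_diff[OF W conjunct1[OF n] yz(1)] by (simp add: yz(3))
    then have "(z - n) \<bullet> (z - n) = 0"
      using yz(2) n by (simp add: inner_diff_left orthogonal_def)
    then show "n = z" by simp
  qed
  then show ?thesis using w[OF yz(1)] by (simp add: yz(3) inner_add_left)
qed

context ruled_patch begin

lemma herm_frame:
  assumes "s \<in> I"
  shows "herm (\<gamma> s) (\<gamma> s) = 1" "herm (e s) (e s) = 1" "herm (\<gamma> s) (e s) = 0" "herm (e s) (\<gamma> s) = 0"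
  using unit[OF assms] by (simp_all add: e_def herm_perp herm_self)

text \<open>All tangent vectors at the point, from whichever parametrization, are orthogonal to the image under \<open>J\<close>
  of the plane on the right, because the surface is Lagrangian; this confines them to that plane.\<close>

lemma tangent_space_parametrization:
  assumes s: "s \<in> I" and t: "t \<in> T"
  shows "tangent_space S (V s + t *\<^sub>R \<gamma> s) =
    range (\<lambda>(x, y). x *\<^sub>R ((t *\<^sub>R a s + b s) *s e s) + y *\<^sub>R \<gamma> s)" (is "?S = ?R")
proof
  let ?X = "\<lambda>(s, t). V s + t *\<^sub>R \<gamma> s"
  have D: "frechet_derivative ?X (at (s, t)) = (\<lambda>(x, y). x *\<^sub>R ((t *\<^sub>R a s + b s) *s e s) + y *\<^sub>R \<gamma> s)"
    unfolding frechet_derivative_parametrization[OF s] deriv_ruled_map[OF s] ..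
  have tangent: "frechet_derivative ?X (at (s, t)) h \<in> ?S" for h
  proof -
    have "frechet_derivative ?X (at (s, t)) h \<in> tangent_space S (?X (s, t))"
      unfolding tangent_space_def using parametrization s t by blast
    then show ?thesis by simp
  qed
  then show "?R \<subseteq> ?S" unfolding D by blast
  show "?S \<subseteq> ?R"
  proof
    fix v assume v: "v \<in> ?S"
    have "?X (s, t) \<in> S" using local_parametrization_subset[OF parametrization] s t by blast
    then have orth: "v \<bullet> J w = 0" if "w \<in> ?S" for w
      using lagrangian v that by (simp add: lagrangian_def)
    have "v \<bullet> J (\<gamma> s) = 0" "v \<bullet> J ((t *\<^sub>R a s + b s) *s e s) = 0"
      using orth[OF tangent[of "(0, 1)"]] orth[OF tangent[of "(1, 0)"]] by (simp_all add: D)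
    then obtain x y where "v = y *\<^sub>R \<gamma> s + x *\<^sub>R ((t *\<^sub>R a s + b s) *s e s)"
      using lagrangian_plane_eq[OF unit[OF s] immersed[OF s t], folded e_def] by metis
    then show "v \<in> ?R" by (intro image_eqI[of _ _ "(x, y)"]) (auto simp: add.commute)
  qed
qed

text \<open>The coordinates are orthogonal, \<open>\<bar>X\<^sub>t\<bar> = 1\<close> and \<open>X\<^sub>t\<^sub>t = 0\<close>, so that only \<open>X\<^sub>s\<^sub>s\<close> contributes.\<close>

lemma mean_curvature_parametrization:
  assumes s: "s \<in> I" and t: "t \<in> T"
  shows "mean_curvature_vector (\<lambda>(s, t). V s + t *\<^sub>R \<gamma> s) (s, t) =
    (1 / (cmod (t *\<^sub>R a s + b s))\<^sup>2) *\<^sub>R normal_component (tangent_space S (V s + t *\<^sub>R \<gamma> s))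
      (deriv_curve (deriv_curve V) s + t *\<^sub>R deriv_curve (deriv_curve \<gamma>) s)"
proof -
  let ?X = "\<lambda>(s, t). V s + t *\<^sub>R \<gamma> s"
  have o: "open (I \<times> T)" using open_I open_T by (simp add: open_Times)
  have D1: "frechet_derivative ?X (at w) (1, 0) = (\<lambda>(s, t). deriv_curve V s + t *\<^sub>R deriv_curve \<gamma> s) w"
    and D2: "frechet_derivative ?X (at w) (0, 1) = (\<lambda>(s, t). \<gamma> s + t *\<^sub>R 0) w" if "w \<in> I \<times> T" for w
    using that by (auto simp: frechet_derivative_parametrization)
  have D11: "frechet_derivative (\<lambda>w. frechet_derivative ?X (at w) (1, 0)) (at (s, t)) (1, 0) =
      deriv_curve (deriv_curve V) s + t *\<^sub>R deriv_curve (deriv_curve \<gamma>) s"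
  proof -
    note d2 = smooth_on_has_vector_derivative[OF smooth_on_deriv_curve[OF open_I smooth(2)] s]
      smooth_on_has_vector_derivative[OF smooth_on_deriv_curve[OF open_I smooth(1)] s]
    have "((\<lambda>w. frechet_derivative ?X (at w) (1, 0)) has_derivative
        (\<lambda>(x, y). x *\<^sub>R (deriv_curve (deriv_curve V) s + t *\<^sub>R deriv_curve (deriv_curve \<gamma>) s)
           + y *\<^sub>R deriv_curve \<gamma> s)) (at (s, t))"
      by (rule has_derivative_transform_within_open[OF ruled_map_has_derivative[OF d2] o])
         (use s t D1 in auto)
    from frechet_derivative_at[OF this, symmetric] show ?thesis by simp
  qed
  have D22: "frechet_derivative (\<lambda>w. frechet_derivative ?X (at w) (0, 1)) (at (s, t)) (0, 1) = 0"
  proof -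
    have "((\<lambda>w. frechet_derivative ?X (at w) (0, 1)) has_derivative
        (\<lambda>(x, y). x *\<^sub>R (deriv_curve \<gamma> s + t *\<^sub>R 0) + y *\<^sub>R 0)) (at (s, t))"
      by (rule has_derivative_transform_within_open[OF ruled_map_has_derivative[OF
              has_vector_derivative(1)[OF s] has_vector_derivative_const] o])
         (use s t D2 in auto)
    from frechet_derivative_at[OF this, symmetric] show ?thesis by simp
  qed
  have Ds: "frechet_derivative ?X (at (s, t)) = (\<lambda>(x, y). x *\<^sub>R ((t *\<^sub>R a s + b s) *s e s) + y *\<^sub>R \<gamma> s)"
    unfolding frechet_derivative_parametrization[OF s] deriv_ruled_map[OF s] ..
  have E: "((t *\<^sub>R a s + b s) *s e s) \<bullet> ((t *\<^sub>R a s + b s) *s e s) = (cmod (t *\<^sub>R a s + b s))\<^sup>2"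
    unfolding power2_norm_eq_inner[symmetric] norm_scalar_mult using unit[OF s] by (simp add: e_def)
  have FG: "((t *\<^sub>R a s + b s) *s e s) \<bullet> \<gamma> s = 0" "\<gamma> s \<bullet> \<gamma> s = 1"
    using herm_frame[OF s] by (simp_all add: inner_eq_Re_herm herm_linear_simps)
  show ?thesis
    unfolding mean_curvature_vector_def Let_def D11 D22 tangent_space_parametrization[OF s t]
    unfolding Ds by (simp add: E FG del: vector_sadd_rdistrib)
qed

lemma second_derivatives:
  assumes s: "s \<in> I"
  shows "(e has_vector_derivative - (cnj (a s) *s \<gamma> s)) (at s)"
    "((\<lambda>s. b s *s e s) has_vector_derivative deriv_curve b s *s e s - (b s * cnj (a s)) *s \<gamma> s) (at s)"
    "deriv_curve (deriv_curve V) s = deriv_curve b s *s e s - (b s * cnj (a s)) *s \<gamma> s"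
    "deriv_curve (deriv_curve \<gamma>) s = deriv_curve a s *s e s - (a s * cnj (a s)) *s \<gamma> s"
proof -
  show e': "(e has_vector_derivative - (cnj (a s) *s \<gamma> s)) (at s)"
    using bounded_linear.has_vector_derivative[OF bounded_linear_perp has_vector_derivative(1)[OF s]]
    by (simp add: e_def[abs_def] deriv_direction(1)[OF s] perp_linear_simps vector_smult_rneg)
  have prod: "((\<lambda>s. f s *s e s) has_vector_derivative deriv_curve f s *s e s - (f s * cnj (a s)) *s \<gamma> s) (at s)"
    if "smooth_on I f" for f
    using bounded_bilinear.has_vector_derivative[OF bounded_bilinear_scalar_mult
        smooth_on_has_vector_derivative[OF that s] e']
    by (simp add: vector_smult_rneg vector_smult_assoc algebra_simps)
  show "((\<lambda>s. b s *s e s) has_vector_derivative deriv_curve b s *s e s - (b s * cnj (a s)) *s \<gamma> s) (at s)"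
    by (rule prod[OF smooth_frame(3)])
  show "deriv_curve (deriv_curve V) s = deriv_curve b s *s e s - (b s * cnj (a s)) *s \<gamma> s"
    by (rule vector_derivative_at, rule has_vector_derivative_transform_within_open[OF
          prod[OF smooth_frame(3)] open_I s]) (simp add: deriv_direction)
  show "deriv_curve (deriv_curve \<gamma>) s = deriv_curve a s *s e s - (a s * cnj (a s)) *s \<gamma> s"
    by (rule vector_derivative_at, rule has_vector_derivative_transform_within_open[OF
          prod[OF smooth_frame(2)] open_I s]) (simp add: deriv_direction)
qed

end

locale self_similar_patch = ruled_patch +
  fixes c :: real
  assumes c_nonzero: "c \<noteq> 0"
    and self_similar: "\<And>U \<phi> u. local_parametrization S U \<phi> \<Longrightarrow> u \<in> U \<Longrightarrow>
      mean_curvature_vector \<phi> u + c *\<^sub>R normal_component (tangent_space S (\<phi> u)) (\<phi> u) = 0"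
begin

text \<open>For a curve in the complex line spanned by \<open>e\<close>, \<open>w / \<bar>b\<bar>\<close> is the component of the position vector along
  the unit normal.\<close>

definition v :: "real \<Rightarrow> complex" where "v s = herm (V s) (e s)"
definition w :: "real \<Rightarrow> real" where "w s = Im (v s * cnj (b s))"

lemma self_similar_component:
  assumes s: "s \<in> I" and t: "t \<in> T"
    and n: "n = J (\<gamma> s) \<or> n = J ((t *\<^sub>R a s + b s) *s e s)"
  shows "(deriv_curve (deriv_curve V) s + t *\<^sub>R deriv_curve (deriv_curve \<gamma>) s) \<bullet> n +
    c * (cmod (t *\<^sub>R a s + b s))\<^sup>2 * ((V s + t *\<^sub>R \<gamma> s) \<bullet> n) = 0"
proof -
  let ?W = "tangent_space S (V s + t *\<^sub>R \<gamma> s)"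
  let ?A = "\<lambda>(x, y). x *\<^sub>R ((t *\<^sub>R a s + b s) *s e s) + y *\<^sub>R \<gamma> s"
  have "linear ?A"
    using has_derivative_linear[OF parametrization_has_derivative[OF s s, of t]]
    by (simp add: deriv_ruled_map[OF s])
  then have sub: "subspace ?W"
    unfolding tangent_space_parametrization[OF s t] by (rule linear_subspace_image) simp
  have orth: "x \<bullet> n = 0" if "x \<in> ?W" for x
  proof -
    have "\<gamma> s \<in> ?W" "(t *\<^sub>R a s + b s) *s e s \<in> ?W"
      unfolding tangent_space_parametrization[OF s t]
      by (rule image_eqI[of _ _ "(0, 1)"], simp_all) (rule image_eqI[of _ _ "(1, 0)"], simp_all)
    then have "n \<in> J ` ?W" using n by blast
    moreover have "V s + t *\<^sub>R \<gamma> s \<in> S"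
      using local_parametrization_subset[OF parametrization] s t by blast
    ultimately show ?thesis using lagrangian that by (auto simp: lagrangian_def)
  qed
  have nc: "normal_component ?W x \<bullet> n = x \<bullet> n" for x
    by (rule normal_component_inner[OF sub]) (rule orth)
  let ?E = "(cmod (t *\<^sub>R a s + b s))\<^sup>2"
  have E: "?E \<noteq> 0" using immersed[OF s t] by simp
  have "mean_curvature_vector (\<lambda>(s, t). V s + t *\<^sub>R \<gamma> s) (s, t) +
      c *\<^sub>R normal_component ?W (V s + t *\<^sub>R \<gamma> s) = 0"
    using self_similar[OF parametrization, of "(s, t)"] s t by simp
  then have "((1 / ?E) *\<^sub>R normal_component ?W
      (deriv_curve (deriv_curve V) s + t *\<^sub>R deriv_curve (deriv_curve \<gamma>) s) +
      c *\<^sub>R normal_component ?W (V s + t *\<^sub>R \<gamma> s)) \<bullet> n = 0"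
    unfolding mean_curvature_parametrization[OF s t] by simp
  then have "(1 / ?E) * ((deriv_curve (deriv_curve V) s + t *\<^sub>R deriv_curve (deriv_curve \<gamma>) s) \<bullet> n) +
      c * ((V s + t *\<^sub>R \<gamma> s) \<bullet> n) = 0"
    unfolding inner_add_left[of "(1 / ?E) *\<^sub>R _"] inner_scaleR_left nc .
  then show ?thesis using E by (simp add: field_simps)
qed

text \<open>This equation and the next one are the components of \<open>H + c X\<^sup>\<bottom> = 0\<close> along the normal vectors
  \<open>J X\<^sub>t\<close> and \<open>J X\<^sub>s\<close>.\<close>

lemma equation_along_ruling:
  assumes s: "s \<in> I" and t: "t \<in> T"
  shows "Im (b s * cnj (a s)) = c * (cmod (t *\<^sub>R a s + b s))\<^sup>2 * Im (herm (V s) (\<gamma> s))"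
proof -
  have "Im (a s * cnj (a s)) = 0" by (simp add: cnj_mult_eq_of_real_power)
  then show ?thesis
    using self_similar_component[OF s t disjI1[OF refl]]
    by (simp add: inner_J_eq_Im_herm second_derivatives[OF s] herm_linear_simps herm_frame[OF s])
qed

lemma equation_across_ruling:
  assumes s: "s \<in> I" and t: "t \<in> T"
  shows "Im ((t *\<^sub>R deriv_curve a s + deriv_curve b s) * cnj (t *\<^sub>R a s + b s)) +
    c * (cmod (t *\<^sub>R a s + b s))\<^sup>2 * Im (v s * cnj (t *\<^sub>R a s + b s)) = 0"
proof -
  let ?z = "t *\<^sub>R a s + b s"
  have "herm (deriv_curve (deriv_curve V) s + t *\<^sub>R deriv_curve (deriv_curve \<gamma>) s) (?z *s e s) =
      (t *\<^sub>R deriv_curve a s + deriv_curve b s) * cnj ?z"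
    by (simp only: second_derivatives[OF s] herm_linear_simps herm_frame[OF s])
       (simp add: scaleR_conv_of_real[where 'a = complex] algebra_simps)
  moreover have "herm (V s + t *\<^sub>R \<gamma> s) (?z *s e s) = v s * cnj ?z"
    by (simp only: v_def herm_linear_simps herm_frame[OF s]) simp
  ultimately show ?thesis
    using self_similar_component[OF s t disjI2[OF refl]] by (simp only: inner_J_eq_Im_herm)
qed

text \<open>The left-hand side of the first equation does not depend on \<open>t\<close>, but the factor
  \<open>\<bar>t a + b\<bar>\<^sup>2\<close> on the right is a quadratic polynomial with leading coefficient \<open>\<bar>a\<bar>\<^sup>2\<close>.\<close>

lemma along_ruling:
  assumes s: "s \<in> I"
  shows "Im (herm (V s) (\<gamma> s)) = 0" "Im (b s * cnj (a s)) = 0"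
proof -
  obtain \<tau> where t: "\<tau> \<in> T" "- \<tau> \<in> T" "\<tau> \<noteq> 0" using nonzero_parameter .
  define \<beta> where "\<beta> = Im (herm (V s) (\<gamma> s))"
  define k where "k = Im (b s * cnj (a s))"
  have quad: "(cmod (\<tau> *\<^sub>R a s + b s))\<^sup>2 + (cmod ((- \<tau>) *\<^sub>R a s + b s))\<^sup>2 =
      2 * (cmod (b s))\<^sup>2 + 2 * \<tau>\<^sup>2 * (cmod (a s))\<^sup>2"
    unfolding cmod_power2 by (simp add: power2_eq_square algebra_simps)
  have k: "k = c * (cmod (\<tau> *\<^sub>R a s + b s))\<^sup>2 * \<beta>" "k = c * (cmod ((- \<tau>) *\<^sub>R a s + b s))\<^sup>2 * \<beta>"
    "k = c * (cmod (b s))\<^sup>2 * \<beta>"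
    using equation_along_ruling[OF s t(1)] equation_along_ruling[OF s t(2)]
      equation_along_ruling[OF s interval(3)] by (simp_all add: k_def \<beta>_def)
  have "2 * k = c * ((cmod (\<tau> *\<^sub>R a s + b s))\<^sup>2 + (cmod ((- \<tau>) *\<^sub>R a s + b s))\<^sup>2) * \<beta>"
    using k(1,2) by (simp only: distrib_left distrib_right mult_2)
  also have "\<dots> = 2 * k + 2 * c * \<tau>\<^sup>2 * (cmod (a s))\<^sup>2 * \<beta>"
    unfolding quad unfolding k(3) by (simp add: algebra_simps)
  finally have "(cmod (a s))\<^sup>2 * \<beta> = 0" using c_nonzero t(3) by simp
  then have "a s = 0 \<or> \<beta> = 0" by simp
  then have "k = 0" using k(3) by (auto simp: k_def)
  then have "\<beta> = 0" using k(3) c_nonzero b_nonzero[OF s] by simp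
  then show "Im (herm (V s) (\<gamma> s)) = 0" "Im (b s * cnj (a s)) = 0"
    using \<open>k = 0\<close> by (simp_all add: k_def \<beta>_def)
qed

text \<open>The real function with \<open>a = r b\<close>.\<close>

definition r :: "real \<Rightarrow> real" where "r s = Re (a s * cnj (b s)) / (cmod (b s))\<^sup>2"

lemma a_eq: "s \<in> I \<Longrightarrow> a s = of_real (r s) * b s"
  unfolding r_def using real_multiple_eq[OF b_nonzero, of s "a s"] along_ruling(2)[of s]
  by (simp add: algebra_simps)

text \<open>The second equation on the base curve. For constant direction it is the self-similarity of the
  planar factor.\<close>

lemma curve_equation:
  assumes s: "s \<in> I"
  shows "Im (deriv_curve b s * cnj (b s)) = - (c * (cmod (b s))\<^sup>2 * w s)"
  using equation_across_ruling[OF s interval(3)] by (simp add: w_def)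

text \<open>With \<open>a = r b\<close>, the second equation is divisible by \<open>(1 + r t)\<^sup>2\<close>, and
  \<open>Im (b' cnj b) + c \<bar>b\<bar>\<^sup>2 (1 + r t) w = 0\<close> remains; subtracting the case \<open>t = 0\<close> leaves a multiple of \<open>r t w\<close>.\<close>

lemma w_zero_if_direction_moves:
  assumes s: "s \<in> I" and a: "a s \<noteq> 0"
  shows "w s = 0"
proof -
  obtain t where t: "t \<in> T" "t \<noteq> 0" using nonzero_parameter .
  define m where "m = 1 + r s * t"
  define K where "K = Im (deriv_curve b s * cnj (b s))"
  have r0: "r s \<noteq> 0" using a a_eq[OF s] by auto
  have tab: "t *\<^sub>R a s + b s = of_real m * b s"
    by (subst a_eq[OF s]) (simp add: m_def scaleR_conv_of_real algebra_simps)
  have m0: "m \<noteq> 0" using immersed[OF s t(1)] tab by auto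
  have "((\<lambda>s. Im (b s * cnj (a s))) has_vector_derivative
      Im (b s * cnj (deriv_curve a s) + deriv_curve b s * cnj (a s))) (at s)"
    by (intro bounded_linear.has_vector_derivative[OF bounded_linear_Im]
        bounded_bilinear.has_vector_derivative[OF bounded_bilinear_mult]
        bounded_linear.has_vector_derivative[OF bounded_linear_cnj]
        smooth_on_has_vector_derivative[OF _ s] smooth_frame)
  moreover have "((\<lambda>s. Im (b s * cnj (a s))) has_vector_derivative 0) (at s)"
    by (rule has_vector_derivative_transform_within_open[OF has_vector_derivative_const open_I s, of 0])
       (simp only: along_ruling)
  ultimately have "Im (b s * cnj (deriv_curve a s) + deriv_curve b s * cnj (a s)) = 0"
    by (rule vector_derivative_unique_at)
  moreover have "Im (deriv_curve b s * cnj (a s)) = r s * K"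
    unfolding K_def by (subst a_eq[OF s]) (simp add: algebra_simps)
  ultimately have a': "Im (deriv_curve a s * cnj (b s)) = r s * K" by (simp add: algebra_simps)
  have "Im ((t *\<^sub>R deriv_curve a s + deriv_curve b s) * cnj (of_real m * b s)) =
      m * (t * Im (deriv_curve a s * cnj (b s)) + K)"
    unfolding K_def by (simp add: algebra_simps)
  also have "\<dots> = m\<^sup>2 * K" unfolding a' by (simp add: m_def power2_eq_square algebra_simps)
  finally have "m\<^sup>2 * K + c * (cmod (of_real m * b s))\<^sup>2 * Im (v s * cnj (of_real m * b s)) = 0"
    using equation_across_ruling[OF s t(1)] unfolding tab by simp
  moreover have "Im (v s * cnj (of_real m * b s)) = m * w s" by (simp add: w_def algebra_simps)
  moreover have "(cmod (of_real m * b s))\<^sup>2 = m\<^sup>2 * (cmod (b s))\<^sup>2"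
    by (simp add: norm_mult power_mult_distrib)
  ultimately have "m\<^sup>2 * K + c * (m\<^sup>2 * (cmod (b s))\<^sup>2) * (m * w s) = 0" by (simp only:)
  then have "m\<^sup>2 * (K + c * (cmod (b s))\<^sup>2 * (m * w s)) = 0" by (simp add: algebra_simps)
  then have "K + c * (cmod (b s))\<^sup>2 * (m * w s) = 0" using m0 by simp
  then have "c * (cmod (b s))\<^sup>2 * (r s * t) * w s = 0"
    unfolding K_def curve_equation[OF s] by (simp add: m_def algebra_simps)
  then show ?thesis using c_nonzero b_nonzero[OF s] r0 t(2) by simp
qed

text \<open>Because \<open>v' = b - p a\<close> with \<open>p\<close> real and \<open>a\<close> a real multiple of \<open>b\<close>, only \<open>Im (v cnj b')\<close> survives in
  \<open>w'\<close>. The phase of \<open>b\<close> turns at a rate proportional to \<open>w\<close> (\<open>curve_equation\<close>), so \<open>w\<close> satisfies a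
  homogeneous linear differential equation.\<close>

lemma w_zero_everywhere:
  assumes s1: "s1 \<in> I" "w s1 = 0" and s: "s \<in> I"
  shows "w s = 0"
proof -
  have smooth_v: "smooth_on I v"
    unfolding v_def by (rule smooth_on_bilinear[OF bounded_bilinear_herm open_I smooth(2) smooth_frame(1)])
  define h where "h s = c * Re (v s * cnj (b s)) + Re (b s * cnj (deriv_curve b s)) / (cmod (b s))\<^sup>2" for s
  show ?thesis
  proof (rule linear_ode_zero[where w = w and h = h, OF _ _ _ s1 s])
    show "is_interval I" using interval(1) by (simp add: open_interval_def)
    note cont = smooth_on_imp_continuous_on[OF smooth_v] smooth_on_imp_continuous_on[OF smooth_frame(3)]
      smooth_on_imp_continuous_on[OF smooth_on_deriv_curve[OF open_I smooth_frame(3)]]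
    show "continuous_on I h" unfolding h_def
      by (intro continuous_intros cont) (use b_nonzero in auto)
    fix x assume x: "x \<in> I"
    have v': "(v has_vector_derivative b x - a x * herm (V x) (\<gamma> x)) (at x)"
      unfolding v_def
      using bounded_bilinear.has_vector_derivative[OF bounded_bilinear_herm has_vector_derivative(2)[OF x]
          second_derivatives(1)[OF x]]
      by (simp add: b_def herm_linear_simps)
    have w': "(w has_vector_derivative
        Im (v x * cnj (deriv_curve b x) + (b x - a x * herm (V x) (\<gamma> x)) * cnj (b x))) (at x)"
      unfolding w_def
      by (intro bounded_linear.has_vector_derivative[OF bounded_linear_Im]
          bounded_bilinear.has_vector_derivative[OF bounded_bilinear_mult]
          bounded_linear.has_vector_derivative[OF bounded_linear_cnj] v'
          smooth_on_has_vector_derivative[OF smooth_frame(3) x])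
    have p: "herm (V x) (\<gamma> x) = of_real (Re (herm (V x) (\<gamma> x)))"
      using along_ruling(1)[OF x] by (simp add: complex_eq_iff)
    have "Im ((b x - a x * herm (V x) (\<gamma> x)) * cnj (b x)) = 0"
      by (subst p, subst a_eq[OF x]) (simp add: algebra_simps)
    moreover have "Im (v x * cnj (deriv_curve b x)) = h x * w x"
    proof -
      let ?b' = "deriv_curve b x"
      have "(cmod (b x))\<^sup>2 * Im (v x * cnj ?b') = Im (of_real ((cmod (b x))\<^sup>2) * (v x * cnj ?b'))" by simp
      also have "\<dots> = Im ((v x * cnj (b x)) * (b x * cnj ?b'))"
        unfolding cnj_mult_eq_of_real_power[symmetric] by (simp only: mult_ac)
      also have "\<dots> = Re (v x * cnj (b x)) * Im (b x * cnj ?b') + w x * Re (b x * cnj ?b')"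
        by (simp only: w_def times_complex.sel(2)[of "v x * cnj (b x)"])
      also have "Im (b x * cnj ?b') = c * (cmod (b x))\<^sup>2 * w x"
        using curve_equation[OF x] by (simp add: algebra_simps)
      finally show ?thesis using b_nonzero[OF x] by (simp add: h_def field_simps)
    qed
    ultimately show "(w has_vector_derivative h x * w x) (at x)" using w' by simp
  qed
qed

text \<open>If \<open>w\<close> vanishes, then \<open>\<gamma>\<close> and \<open>b e\<close> span the same real plane at all parameters: the square \<open>Q\<close> of
  their components along a fixed normal vector, weighted so that the mixed terms cancel, satisfies
  \<open>Q' = 2 \<kappa> Q\<close>.\<close>

lemma frame_in_fixed_plane:
  assumes w: "\<And>s. s \<in> I \<Longrightarrow> w s = 0" and s0: "s0 \<in> I"
    and n: "\<gamma> s0 \<bullet> n = 0" "(b s0 *s e s0) \<bullet> n = 0" and s: "s \<in> I"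
  shows "\<gamma> s \<bullet> n = 0" "(b s *s e s) \<bullet> n = 0"
proof -
  define \<kappa> where "\<kappa> s = Re (deriv_curve b s * cnj (b s)) / (cmod (b s))\<^sup>2" for s
  define Q where "Q s = (cmod (b s))\<^sup>2 * (\<gamma> s \<bullet> n)\<^sup>2 + ((b s *s e s) \<bullet> n)\<^sup>2" for s
  have "Q s = 0"
  proof (rule linear_ode_zero[where w = Q and h = "\<lambda>s. 2 * \<kappa> s", OF _ _ _ s0 _ s])
    show "is_interval I" using interval(1) by (simp add: open_interval_def)
    note cont = smooth_on_imp_continuous_on[OF smooth_frame(3)]
      smooth_on_imp_continuous_on[OF smooth_on_deriv_curve[OF open_I smooth_frame(3)]]
    show "continuous_on I (\<lambda>s. 2 * \<kappa> s)" unfolding \<kappa>_def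
      by (intro continuous_intros cont) (use b_nonzero in auto)
    show "Q s0 = 0" using n by (simp add: Q_def)
    fix x assume x: "x \<in> I"
    have b': "deriv_curve b x = of_real (\<kappa> x) * b x"
      unfolding \<kappa>_def using real_multiple_eq[OF b_nonzero[OF x]] curve_equation[OF x] w[OF x] by simp
    have ba: "b x * cnj (a x) = of_real (r x * (cmod (b x))\<^sup>2)"
      using cnj_mult_eq_of_real_power[of "b x"] by (subst a_eq[OF x]) simp
    have \<gamma>': "((\<lambda>s. \<gamma> s \<bullet> n) has_real_derivative r x * ((b x *s e x) \<bullet> n)) (at x)"
    proof -
      have "deriv_curve \<gamma> x = r x *\<^sub>R (b x *s e x)"
        unfolding deriv_direction(1)[OF x] a_eq[OF x]
        by (simp add: scaleR_eq_scalar_mult vector_smult_assoc)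
      then show ?thesis unfolding has_real_derivative_iff_has_vector_derivative
        using bounded_linear.has_vector_derivative[OF bounded_linear_inner_left has_vector_derivative(1)[OF x]]
        by simp
    qed
    have be': "((\<lambda>s. (b s *s e s) \<bullet> n) has_real_derivative
        \<kappa> x * ((b x *s e x) \<bullet> n) - r x * (cmod (b x))\<^sup>2 * (\<gamma> x \<bullet> n)) (at x)"
    proof -
      have "deriv_curve b x *s e x - (b x * cnj (a x)) *s \<gamma> x =
          \<kappa> x *\<^sub>R (b x *s e x) - (r x * (cmod (b x))\<^sup>2) *\<^sub>R \<gamma> x"
        unfolding b' ba by (simp add: scaleR_eq_scalar_mult vector_smult_assoc)
      then show ?thesis unfolding has_real_derivative_iff_has_vector_derivative
        using bounded_linear.has_vector_derivative[OF bounded_linear_inner_left second_derivatives(2)[OF x]]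
        by (simp add: inner_diff_left)
    qed
    have bb': "((\<lambda>s. (cmod (b s))\<^sup>2) has_real_derivative 2 * \<kappa> x * (cmod (b x))\<^sup>2) (at x)"
    proof -
      have "((\<lambda>s. b s \<bullet> b s) has_vector_derivative b x \<bullet> deriv_curve b x + deriv_curve b x \<bullet> b x) (at x)"
        by (intro bounded_bilinear.has_vector_derivative[OF bounded_bilinear_inner]
            smooth_on_has_vector_derivative[OF smooth_frame(3) x])
      then show ?thesis unfolding has_real_derivative_iff_has_vector_derivative
        by (simp add: b'[folded scaleR_conv_of_real] power2_norm_eq_inner mult.assoc)
    qed
    have "(Q has_real_derivative 2 * \<kappa> x * Q x) (at x)"
      unfolding Q_def
      by (rule derivative_eq_intros \<gamma>' be' bb' refl)+ (simp add: power2_eq_square algebra_simps)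
    then show "(Q has_vector_derivative 2 * \<kappa> x * Q x) (at x)"
      by (simp add: has_real_derivative_iff_has_vector_derivative)
  qed
  then have "(cmod (b s))\<^sup>2 * (\<gamma> s \<bullet> n)\<^sup>2 = 0 \<and> ((b s *s e s) \<bullet> n)\<^sup>2 = 0"
    unfolding Q_def by (subst (asm) add_nonneg_eq_0_iff) auto
  then show "\<gamma> s \<bullet> n = 0" "(b s *s e s) \<bullet> n = 0" using b_nonzero[OF s] by auto
qed

end

section \<open>Self-similar ruled surfaces\<close>

context self_similar_patch begin

text \<open>The planar factor has velocity \<open>b e\<close> and position \<open>v e\<close>, so its curvature is \<open>Im (b' cnj b) / \<bar>b\<bar>\<^sup>3\<close> and
  its support function is \<open>w / \<bar>b\<bar>\<close>; the constant is that of the surface.\<close>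

lemma self_similar_curve_factor:
  assumes stationary: "\<And>s. s \<in> I \<Longrightarrow> a s = 0" and s0: "s0 \<in> I"
  shows "self_similar_curve I (\<lambda>s. herm (V s) (e s) *s e s0)"
proof -
  let ?g = "\<lambda>s. v s *s e s0"
  have scal: "((\<lambda>s. f s *s e s0) has_vector_derivative f' *s e s0) (at s)"
    if "(f has_vector_derivative f') (at s)" for f f' and s :: real
    using bounded_linear.has_vector_derivative[OF
        bounded_bilinear.bounded_linear_left[OF bounded_bilinear_scalar_mult] that] .
  have g': "deriv_curve ?g s = b s *s e s0" if s: "s \<in> I" for s
  proof -
    have "(v has_vector_derivative b s) (at s)"
      using bounded_bilinear.has_vector_derivative[OF bounded_bilinear_herm has_vector_derivative(2)[OF s]
          second_derivatives(1)[OF s]]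
      by (simp add: v_def[abs_def] b_def stationary[OF s] herm_linear_simps)
    then show ?thesis using scal vector_derivative_at by blast
  qed
  have g'': "deriv_curve (deriv_curve ?g) s = deriv_curve b s *s e s0" if s: "s \<in> I" for s
  proof (rule vector_derivative_at)
    show "(deriv_curve ?g has_vector_derivative deriv_curve b s *s e s0) (at s)"
      by (rule has_vector_derivative_transform_within_open[OF
            scal[OF smooth_on_has_vector_derivative[OF smooth_frame(3) s]] open_I s]) (simp add: g')
  qed
  have "curvature ?g s + c * (?g s \<bullet> unit_normal ?g s) = 0" if s: "s \<in> I" for s
  proof -
    let ?\<beta> = "cmod (b s)"
    have \<beta>: "?\<beta> \<noteq> 0" using b_nonzero[OF s] by simp
    have norm_g': "norm (deriv_curve ?g s) = ?\<beta>"
      unfolding g'[OF s] norm_scalar_mult using unit[OF s0] by (simp add: e_def)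
    have N: "(z *s e s0) \<bullet> unit_normal ?g s = Im (z * cnj (b s)) / ?\<beta>" for z
      unfolding unit_normal_def inner_J_eq_Im_herm sgn_div_norm norm_g'
      using \<beta> by (simp add: g'[OF s] herm_linear_simps herm_frame[OF s0] field_simps power2_eq_square)
    have "curvature ?g s = - (c * w s / ?\<beta>)"
      unfolding curvature_def g''[OF s] N norm_g' curve_equation[OF s]
      using \<beta> by (simp add: field_simps power2_eq_square)
    moreover have "?g s \<bullet> unit_normal ?g s = w s / ?\<beta>" unfolding N by (simp add: w_def)
    ultimately show ?thesis by simp
  qed
  then show ?thesis
    unfolding self_similar_curve_def v_def[symmetric] using c_nonzero by blast
qed

text \<open>By \<open>frame_in_fixed_plane\<close>, the patch lies in the real plane that \<open>\<gamma>\<close> and \<open>b e\<close> span at \<open>s0\<close>, and it is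
  open there by invariance of domain. The plane is the product of the lines spanned by these two
  vectors, and the second line is a self-similar curve because it passes through the origin.\<close>

lemma cartesian_near_if_planar:
  assumes w: "\<And>s. s \<in> I \<Longrightarrow> w s = 0" and s0: "s0 \<in> I" and incomplete: "\<not> complete_ruling F"
  shows "\<exists>g. cartesian_near S F (V s0) UNIV g \<and> self_similar_curve UNIV g"
proof -
  define \<gamma>0 where "\<gamma>0 = \<gamma> s0"
  define u0 where "u0 = b s0 *s e s0"
  define plane where "plane = range (\<lambda>(x, y). x *\<^sub>R \<gamma>0 + y *\<^sub>R u0)"
  note frame = herm_frame[OF s0]
  have n0: "norm \<gamma>0 = 1" "u0 \<noteq> 0" "e s0 \<noteq> 0"
  proof -
    show "norm \<gamma>0 = 1" using unit[OF s0] by (simp add: \<gamma>0_def)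
    then show "e s0 \<noteq> 0" using frame(2) by (auto simp: herm_linear_simps)
    have "norm u0 \<noteq> 0" unfolding u0_def norm_scalar_mult
      using b_nonzero[OF s0] unit[OF s0] by (simp add: e_def)
    then show "u0 \<noteq> 0" by auto
  qed
  have J_orth: "\<gamma>0 \<bullet> J \<gamma>0 = 0" "u0 \<bullet> J \<gamma>0 = 0" "\<gamma>0 \<bullet> J u0 = 0" "u0 \<bullet> J u0 = 0"
    using frame cnj_mult_eq_of_real_power[of "b s0"]
    by (simp_all add: inner_J_eq_Im_herm \<gamma>0_def u0_def herm_linear_simps)
  let ?X = "\<lambda>(s, t). V s + t *\<^sub>R \<gamma> s"
  have X_plane: "?X (s, t) \<in> plane" if s: "s \<in> I" for s t
  proof -
    have "?X (s, t) \<bullet> n = 0" if n: "\<gamma> s0 \<bullet> n = 0" "(b s0 *s e s0) \<bullet> n = 0" for n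
    proof -
      have "herm (V s) (\<gamma> s) = of_real (Re (herm (V s) (\<gamma> s)))"
        using along_ruling(1)[OF s] by (simp add: complex_eq_iff)
      moreover have "herm (V s) (e s) = of_real (Re (v s * cnj (b s)) / (cmod (b s))\<^sup>2) * b s"
        using real_multiple_eq[OF b_nonzero[OF s], of "v s"] w[OF s] by (simp add: w_def v_def)
      ultimately have "V s = Re (herm (V s) (\<gamma> s)) *\<^sub>R \<gamma> s +
          (Re (v s * cnj (b s)) / (cmod (b s))\<^sup>2) *\<^sub>R (b s *s e s)"
        using unitary_decomposition[OF unit[OF s], of "V s", folded e_def]
        unfolding scaleR_eq_scalar_mult vector_smult_assoc by metis
      then have "V s \<bullet> n = (Re (herm (V s) (\<gamma> s)) *\<^sub>R \<gamma> s +
          (Re (v s * cnj (b s)) / (cmod (b s))\<^sup>2) *\<^sub>R (b s *s e s)) \<bullet> n" by (rule arg_cong)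
      then show ?thesis
        using frame_in_fixed_plane[OF w s0 n s] by (simp add: inner_add_left)
    qed
    then have "?X (s, t) \<bullet> J \<gamma>0 = 0" "?X (s, t) \<bullet> J u0 = 0"
      using J_orth by (simp_all add: \<gamma>0_def u0_def)
    then obtain x y where "?X (s, t) = x *\<^sub>R \<gamma>0 + y *\<^sub>R u0"
      unfolding \<gamma>0_def u0_def e_def by (rule lagrangian_plane_eq[OF unit[OF s0] b_nonzero[OF s0]])
    then show ?thesis unfolding plane_def by (intro image_eqI[of _ _ "(x, y)"]) auto
  qed
  have linear: "linear (\<lambda>(x, y). x *\<^sub>R \<gamma>0 + y *\<^sub>R u0)"
    by (rule linearI) (auto simp: algebra_simps)
  have plane: "subspace plane" "dim plane \<le> dim (UNIV :: (real \<times> real) set)"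
    unfolding plane_def by (rule linear_subspace_image[OF linear subspace_UNIV] dim_image_le[OF linear])+
  define N where "N = ?X ` (I \<times> T)"
  obtain \<psi> where \<psi>: "homeomorphism (I \<times> T) N ?X \<psi>"
    using parametrization unfolding local_parametrization_def N_def by blast
  have N_S: "openin (top_of_set S) N"
    using parametrization by (simp add: local_parametrization_def N_def)
  have N_plane: "openin (top_of_set plane) N"
    unfolding N_def
  proof (rule invariance_of_domain_subspaces[OF _ subspace_UNIV plane])
    show "openin (top_of_set UNIV) (I \<times> T)" using open_I open_T by (simp add: open_Times)
    show "continuous_on (I \<times> T) ?X" using homeomorphism_cont1[OF \<psi>] .
    show "?X \<in> I \<times> T \<rightarrow> plane" using X_plane by auto
    show "inj_on ?X (I \<times> T)" using homeomorphism_apply1[OF \<psi>] by (rule inj_on_inverseI)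
  qed
  let ?g = "\<lambda>x::real. x *\<^sub>R u0"
  have g': "(?g has_vector_derivative u0) (at x)" for x
    by (auto intro!: derivative_eq_intros)
  then have deriv_g: "deriv_curve ?g = (\<lambda>x. u0)" using vector_derivative_at by blast
  have planar: "planar_curve (range (\<lambda>c. c *s e s0)) UNIV ?g"
    unfolding planar_curve_def
  proof (intro conjI ballI)
    show "open_interval (UNIV :: real set)" by (simp add: open_interval_def is_interval_univ)
    show "smooth_on UNIV ?g"
      by (rule smooth_on_bounded_linear) (auto intro: bounded_linear_scaleR_left)
    show "range ?g \<subseteq> range (\<lambda>c. c *s e s0)"
      by (auto simp: u0_def scaleR_eq_scalar_mult vector_smult_assoc)
    show "deriv_curve ?g x \<noteq> 0" for x using n0(2) by (simp add: deriv_g)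
    have "homeomorphism UNIV (range ?g) ?g (\<lambda>y. (y \<bullet> u0) / (u0 \<bullet> u0))"
      by (rule homeomorphismI) (use n0(2) in \<open>auto intro!: continuous_intros\<close>)
    then show "\<exists>h. homeomorphism UNIV (range ?g) ?g h" by blast
  qed
  define L where "L = range (\<lambda>t. 0 + t *\<^sub>R \<gamma>0)"
  have L: "straight_line L" unfolding straight_line_iff L_def using n0(1) by blast
  have L_P1: "L \<subseteq> range (\<lambda>c. c *s \<gamma>0)" by (auto simp: L_def scaleR_eq_scalar_mult)
  have product: "cartesian_product L (range ?g) = plane"
    unfolding cartesian_product_def L_def plane_def by (auto simp: image_iff)
  have "\<gamma>0 \<noteq> 0" using n0(1) by auto
  then have "complex_line (range (\<lambda>c. c *s \<gamma>0))" "complex_line (range (\<lambda>c. c *s e s0))"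
    unfolding complex_line_def using n0(3) by blast+
  moreover have "\<forall>v\<in>range (\<lambda>c. c *s \<gamma>0). \<forall>w\<in>range (\<lambda>c. c *s e s0). v \<bullet> w = 0"
    using frame by (auto simp: inner_eq_Re_herm herm_linear_simps \<gamma>0_def)
  moreover have "V s0 \<in> N"
    unfolding N_def using s0 interval(3) by (intro image_eqI[of _ _ "(s0, 0)"]) auto
  ultimately have "cartesian_near S F (V s0) UNIV ?g"
    unfolding cartesian_near_def using L L_P1 planar N_S N_plane[folded product] incomplete by blast
  moreover have "self_similar_curve UNIV ?g"
  proof -
    have "?g x \<bullet> unit_normal ?g x = 0" for x
      using J_orth(4) bounded_linear.linear[OF bounded_linear_J]
      by (simp add: unit_normal_def deriv_g sgn_div_norm linear_cmul)
    moreover have "curvature ?g x = 0" for x by (simp add: curvature_def deriv_g)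
    ultimately show ?thesis unfolding self_similar_curve_def by (intro exI[of _ 1]) simp
  qed
  ultimately show ?thesis by blast
qed

text \<open>If the direction moves at one parameter, then \<open>w\<close> vanishes there, hence everywhere, and the
  patch is flat. Its lines are then coplanar but not parallel, so entire lines would meet.\<close>

lemma cartesian_near_self_similar:
  assumes s0: "s0 \<in> I" and complete: "complete_ruling F \<Longrightarrow> T = UNIV"
  shows "\<exists>I g. cartesian_near S F (V s0) I g \<and> self_similar_curve I g"
proof (cases "\<exists>s\<in>I. a s \<noteq> 0")
  case True
  then obtain s where s: "s \<in> I" "a s \<noteq> 0" by blast
  have "w x = 0" if "x \<in> I" for x
    using w_zero_everywhere[OF s(1) w_zero_if_direction_moves[OF s] that] .
  moreover have "\<not> complete_ruling F"
  proof
    assume "complete_ruling F"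
    then have T: "- (1 / r s) \<in> T" using complete by simp
    have "r s \<noteq> 0" using s(2) a_eq[OF s(1)] by auto
    then have "(- (1 / r s)) *\<^sub>R a s + b s = 0"
      by (subst a_eq[OF s(1)]) (simp add: scaleR_conv_of_real)
    then show False using immersed[OF s(1) T] by simp
  qed
  ultimately show ?thesis using cartesian_near_if_planar[OF _ s0] by blast
next
  case False
  then show ?thesis
    using cartesian_near_if_direction_constant[OF _ s0 complete] self_similar_curve_factor[OF _ s0] by blast
qed

end

theorem theorem4:
  fixes S :: "(complex^2) set" and F :: "(complex^2) set set"
  assumes "smooth_surface S" and "lagrangian S" and "ruling S F"
  shows "(\<forall>p. generic_point S F p \<longrightarrow>
            (\<exists>I g. cartesian_near S F p I g) \<or> legendrian_ruled_near S F p) \<and>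
         openin (top_of_set S) {p. generic_point S F p} \<and>
         S \<subseteq> closure {p. generic_point S F p} \<and>
         (self_similar_surface S \<longrightarrow>
            (\<forall>p\<in>S. \<exists>I g. cartesian_near S F p I g \<and> self_similar_curve I g))"
proof (intro conjI allI impI ballI)
  show "(\<exists>I g. cartesian_near S F p I g) \<or> legendrian_ruled_near S F p" if "generic_point S F p" for p
    using generic_point_local_model[OF assms(2,3) that] .
  show "openin (top_of_set S) {p. generic_point S F p}"
    using openin_generic_points .
  show "S \<subseteq> closure {p. generic_point S F p}" by (rule generic_points_dense)
  fix p assume "self_similar_surface S" and p: "p \<in> S"
  then obtain c where c: "c \<noteq> 0" "\<And>U \<phi> u. local_parametrization S U \<phi> \<Longrightarrow> u \<in> U \<Longrightarrow>
      mean_curvature_vector \<phi> u + c *\<^sub>R normal_component (tangent_space S (\<phi> u)) (\<phi> u) = 0"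
    unfolding self_similar_surface_def by blast
  obtain I0 T0 \<gamma> V s0 where patch: "ruled_patch S F I0 T0 \<gamma> V" "s0 \<in> I0" "V s0 = p"
    using ruled_patch_at[OF assms(2,3) p] .
  obtain I T where patch': "ruled_patch S F I T \<gamma> V" "s0 \<in> I" "complete_ruling F \<Longrightarrow> T = UNIV"
    using adapted_ruled_patch[OF patch(1) assms(3) patch(2)] by metis
  interpret ruled_patch S F I T \<gamma> V by (rule patch'(1))
  interpret self_similar_patch S F I T \<gamma> V c by unfold_locales (use c in auto)
  show "\<exists>I g. cartesian_near S F p I g \<and> self_similar_curve I g"
    using cartesian_near_self_similar[OF patch'(2,3)] patch(3) by simp
qed

end
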